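(* Let $M$ be a supermanifold and let $\Delta=\frac12S^{ab}\partial_b\partial_a+T^a\partial_a$ be an odd differential operator of order $\leqslant 2$ acting on functions on $M$, with $\Delta(1)=0$, such that the odd bracket $\{\ ,\ \}$ generated by $\Delta$ satisfies the Jacobi identity (equivalently, $\operatorname{ord}\Delta^2\leqslant2$). Let $\gamma=\gamma^ap_a$ be the upper connection (subprincipal symbol) defined by $\Delta$ and let $D=(S,\,\cdot\,)$. Then $\Delta$ is a derivation of the bracket $\{\ ,\ \}$ (equivalently, $\operatorname{ord}\Delta^2\leqslant1$) if and only if $D\gamma=0$.
   Context: Tilde denotes parity: $\tilde a$ is the parity of the local coordinate $x^a$, $\tilde f$ that of $f$; $\partial_a=\partial/\partial x^a$. The bracket generated by the odd operator $\Delta$ (with $\Delta(1)=0$) is $\{f,g\}=\Delta(fg)-(\Delta f)g-(-1)^{\tilde f}f(\Delta g)$; in coordinates $\{f,g\}=S^{ab}\partial_bf\,\partial_ag\,(-1)^{\tilde a\tilde f}$. It is an odd bi-derivation, symmetric in the sense $\{f,g\}=(-1)^{\tilde f\tilde g}\{g,f\}$ (by the parity shift it becomes an even antisymmetric bracket). The Jacobi identity for it reads $\{\{f,g\},h\}+(-1)^{\tilde g\tilde h}\{\{f,h\},g\}+(-1)^{\tilde f(\tilde g+\tilde h)}\{\{g,h\},f\}=0$. That $\Delta$ is a derivation of this odd bracket means $\Delta\{f,g\}=-\{\Delta f,g\}-(-1)^{\tilde f}\{f,\Delta g\}$ for all functions $f,g$. Let $p_a$ be the momenta conjugate to $x^a$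 on $T^*M$ and let $(\ ,\ )$ be the canonical (even) Poisson bracket on $C^\infty(T^*M)$ (its overall sign convention is immaterial here). The principal symbol of $\Delta$ is $S=\frac12S^{ab}p_bp_a\in C^\infty(T^*M)$. The Jacobi identity for $\{\ ,\ \}$ amounts to $(S,S)=0$, so that $D=(S,\,\cdot\,)$ is a differential ($D^2=0$) on $C^\infty(T^*M)$. The subprincipal symbol of $\Delta$ is the coordinate-dependent Hamiltonian $\gamma=\gamma^ap_a$ with $\gamma^a=\partial_bS^{ba}(-1)^{\tilde b(\varepsilon+1)}-2T^a$, where $\varepsilon=1$ is the parity of $\Delta$ (so the sign factor equals $1$). Under a change of coordinates $\gamma^{a'}=(\gamma^a+S^{ab}\partial_b\ln J)\,\partial x^{a'}/\partial x^a$, $J=Dx'/Dx$ being the Jacobian (Berezinian), so $\gamma$ is interpreted as an upper connection in the bundle of volume forms, and $F=D\gamma$, its curvature, does not depend on the choice of coordinates. *)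

theory Defs
  imports
    "HOL-Analysis.Analysis"
    "HOL-Algebra.Module"
    "HOL-Algebra.Algebraic_Closure_Type"
begin

section \<open>Real supercommutative superalgebras\<close>

record 'f superalg = "(real, 'f) module" +
  even_part :: "'f set"
  odd_part :: "'f set"

text \<open>Parities are natural numbers read modulo 2, so that Koszul signs are powers of \<open>-1\<close>.\<close>

definition homog :: "('f, 'z) superalg_scheme \<Rightarrow> nat \<Rightarrow> 'f set" where
  "homog A p = (if even p then even_part A else odd_part A)"

definition superalgebra :: "('f, 'z) superalg_scheme \<Rightarrow> bool" where
  "superalgebra A \<longleftrightarrow>
     ring A \<and> module (ring_of_type_algebra :: real ring) A \<and>
     (\<forall>r. \<forall>x\<in>carrier A. \<forall>y\<in>carrier A.
        (r \<odot>\<^bsub>A\<^esub> x) \<otimes>\<^bsub>A\<^esub> y = r \<odot>\<^bsub>A\<^esub> (x \<otimes>\<^bsub>A\<^esub> y) \<and>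
        x \<otimes>\<^bsub>A\<^esub> (r \<odot>\<^bsub>A\<^esub> y) = r \<odot>\<^bsub>A\<^esub> (x \<otimes>\<^bsub>A\<^esub> y)) \<and>
     submodule (even_part A) (ring_of_type_algebra :: real ring) A \<and>
     submodule (odd_part A) (ring_of_type_algebra :: real ring) A \<and>
     even_part A \<inter> odd_part A = {\<zero>\<^bsub>A\<^esub>} \<and>
     (\<forall>x\<in>carrier A. \<exists>u\<in>even_part A. \<exists>v\<in>odd_part A. x = u \<oplus>\<^bsub>A\<^esub> v) \<and>
     \<one>\<^bsub>A\<^esub> \<in> even_part A \<and>
     (\<forall>p q. \<forall>x\<in>homog A p. \<forall>y\<in>homog A q.
        x \<otimes>\<^bsub>A\<^esub> y \<in> homog A (p + q) \<and>
        x \<otimes>\<^bsub>A\<^esub> y = (-1) ^ (p * q) \<odot>\<^bsub>A\<^esub> (y \<otimes>\<^bsub>A\<^esub> x))"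

definition superalg_hom ::
    "('f, 'y) superalg_scheme \<Rightarrow> ('g, 'z) superalg_scheme \<Rightarrow> ('f \<Rightarrow> 'g) set" where
  "superalg_hom A B =
     {h \<in> ring_hom A B.
        (\<forall>r. \<forall>x\<in>carrier A. h (r \<odot>\<^bsub>A\<^esub> x) = r \<odot>\<^bsub>B\<^esub> h x) \<and>
        (\<forall>p. \<forall>x\<in>homog A p. h x \<in> homog B p)}"

section \<open>The model superdomains\<close>

text \<open>
  Points of \<open>n\<close>-dimensional space are those of \<^const>\<open>Euclidean_space\<close> \<open>n\<close>, that is, functions
  \<open>nat \<Rightarrow> real\<close> vanishing outside \<open>{..<n}\<close>.
  A function on a superdomain over \<open>V\<close> with odd coordinates \<open>\<xi>\<^sub>j\<close>, \<open>j < m\<close>, is the family of its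
  coefficients: \<open>f A\<close> is the coefficient, to the left, of the product of the \<open>\<xi>\<^sub>j\<close>, \<open>j \<in> A\<close>, in
  increasing order of \<open>j\<close>. Coefficients are set to \<open>0\<close> outside \<open>V\<close>.
\<close>

type_synonym sfun = "nat set \<Rightarrow> (nat \<Rightarrow> real) \<Rightarrow> real"

definition partial :: "nat \<Rightarrow> ((nat \<Rightarrow> real) \<Rightarrow> real) \<Rightarrow> (nat \<Rightarrow> real) \<Rightarrow> real" where
  "partial i f x = deriv (\<lambda>t. f (x(i := t))) (x i)"

definition smooth_fun :: "nat \<Rightarrow> (nat \<Rightarrow> real) set \<Rightarrow> ((nat \<Rightarrow> real) \<Rightarrow> real) \<Rightarrow> bool" where
  "smooth_fun n V f \<longleftrightarrow>
     (\<forall>is. set is \<subseteq> {..<n} \<longrightarrow>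
        continuous_map (subtopology (Euclidean_space n) V) euclideanreal (foldr partial is f) \<and>
        (\<forall>x\<in>V. \<forall>i<n. (\<lambda>t. foldr partial is f (x(i := t))) differentiable (at (x i))))"

text \<open>Sign of the permutation sorting the concatenation of \<open>A\<close> and \<open>B\<close>.\<close>

definition shuffle_sign :: "nat set \<Rightarrow> nat set \<Rightarrow> real" where
  "shuffle_sign A B = (-1) ^ card {(a, b). a \<in> A \<and> b \<in> B \<and> b < a}"

definition sfun_alg :: "nat \<Rightarrow> nat \<Rightarrow> (nat \<Rightarrow> real) set \<Rightarrow> sfun superalg" where
  "sfun_alg n m V =
     (let C = {f. (\<forall>A. \<not> A \<subseteq> {..<m} \<longrightarrow> f A = (\<lambda>x. 0)) \<and>
                  (\<forall>A x. x \<notin> V \<longrightarrow> f A x = 0) \<and>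
                  (\<forall>A. smooth_fun n V (f A))}
      in \<lparr> carrier = C,
           mult = (\<lambda>f g A x. \<Sum>B\<in>Pow A. shuffle_sign B (A - B) * f B x * g (A - B) x),
           one = (\<lambda>A x. if A = {} \<and> x \<in> V then 1 else 0),
           zero = (\<lambda>A x. 0),
           add = (\<lambda>f g A x. f A x + g A x),
           smult = (\<lambda>r f A x. r * f A x),
           even_part = {f \<in> C. \<forall>A. odd (card A) \<longrightarrow> f A = (\<lambda>x. 0)},
           odd_part = {f \<in> C. \<forall>A. even (card A) \<longrightarrow> f A = (\<lambda>x. 0)} \<rparr>)"

definition sfun_restrict :: "(nat \<Rightarrow> real) set \<Rightarrow> sfun \<Rightarrow> sfun" where
  "sfun_restrict W f = (\<lambda>A x. if x \<in> W then f A x else 0)"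

text \<open>Indices of the even coordinates \<open>x\<^sub>i\<close> and of the odd coordinates \<open>\<xi>\<^sub>j\<close>.\<close>

datatype coord_index = Ev nat | Od nat

definition coords :: "nat \<Rightarrow> nat \<Rightarrow> coord_index set" where
  "coords n m = Ev ` {..<n} \<union> Od ` {..<m}"

primrec parity :: "coord_index \<Rightarrow> nat" where
  "parity (Ev i) = 0"
| "parity (Od j) = 1"

primrec coord_fun :: "(nat \<Rightarrow> real) set \<Rightarrow> coord_index \<Rightarrow> sfun" where
  "coord_fun V (Ev i) = (\<lambda>A x. if A = {} \<and> x \<in> V then x i else 0)"
| "coord_fun V (Od j) = (\<lambda>A x. if A = {j} \<and> x \<in> V then 1 else 0)"

text \<open>Left partial derivatives.\<close>

primrec sderiv :: "(nat \<Rightarrow> real) set \<Rightarrow> coord_index \<Rightarrow> sfun \<Rightarrow> sfun" where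
  "sderiv V (Ev i) f = (\<lambda>A x. if x \<in> V then partial i (f A) x else 0)"
| "sderiv V (Od j) f =
     (\<lambda>A x. if j \<in> A then 0 else (-1) ^ card {k \<in> A. k < j} * f (insert j A) x)"

section \<open>Supermanifolds\<close>

record ('p, 'f) superspace =
  topo :: "'p topology"
  sec :: "'p set \<Rightarrow> 'f superalg"
  res :: "'p set \<Rightarrow> 'p set \<Rightarrow> 'f \<Rightarrow> 'f"

text \<open>\<open>res M U W\<close> is the restriction of sections from \<open>U\<close> to \<open>W\<close>.\<close>

definition sheaf_of_superalgebras :: "('p, 'f) superspace \<Rightarrow> bool" where
  "sheaf_of_superalgebras M \<longleftrightarrow>
     (\<forall>U. openin (topo M) U \<longrightarrow> superalgebra (sec M U)) \<and>
     (\<forall>U W. openin (topo M) U \<and> openin (topo M) W \<and> W \<subseteq> U \<longrightarrow>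
        res M U W \<in> superalg_hom (sec M U) (sec M W)) \<and>
     (\<forall>U. openin (topo M) U \<longrightarrow> (\<forall>f\<in>carrier (sec M U). res M U U f = f)) \<and>
     (\<forall>U W Z. openin (topo M) U \<and> openin (topo M) W \<and> openin (topo M) Z \<and> Z \<subseteq> W \<and> W \<subseteq> U \<longrightarrow>
        (\<forall>f\<in>carrier (sec M U). res M W Z (res M U W f) = res M U Z f)) \<and>
     (\<forall>\<U> s. (\<forall>U\<in>\<U>. openin (topo M) U \<and> s U \<in> carrier (sec M U)) \<and>
        (\<forall>U\<in>\<U>. \<forall>W\<in>\<U>. res M U (U \<inter> W) (s U) = res M W (U \<inter> W) (s W)) \<longrightarrow>
        (\<exists>!f. f \<in> carrier (sec M (\<Union>\<U>)) \<and> (\<forall>U\<in>\<U>. res M (\<Union>\<U>) U f = s U)))"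

text \<open>
  A chart is an isomorphism of ringed spaces from an open part of \<open>M\<close> onto a superdomain:
  a homeomorphism together with compatible isomorphisms of the algebras of sections.
\<close>

record ('p, 'f) chart =
  cdom :: "'p set"
  cmap :: "'p \<Rightarrow> nat \<Rightarrow> real"
  cfun :: "'p set \<Rightarrow> 'f \<Rightarrow> sfun"

definition crange :: "('p, 'f) chart \<Rightarrow> (nat \<Rightarrow> real) set" where
  "crange c = cmap c ` cdom c"

definition is_chart :: "nat \<Rightarrow> nat \<Rightarrow> ('p, 'f) superspace \<Rightarrow> ('p, 'f) chart \<Rightarrow> bool" where
  "is_chart n m M c \<longleftrightarrow>
     openin (topo M) (cdom c) \<and> openin (Euclidean_space n) (crange c) \<and>
     homeomorphic_map (subtopology (topo M) (cdom c))
       (subtopology (Euclidean_space n) (crange c)) (cmap c) \<and>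
     (\<forall>W. openin (topo M) W \<and> W \<subseteq> cdom c \<longrightarrow>
        cfun c W \<in> superalg_hom (sec M W) (sfun_alg n m (cmap c ` W)) \<and>
        bij_betw (cfun c W) (carrier (sec M W)) (carrier (sfun_alg n m (cmap c ` W)))) \<and>
     (\<forall>W Z. openin (topo M) W \<and> openin (topo M) Z \<and> Z \<subseteq> W \<and> W \<subseteq> cdom c \<longrightarrow>
        (\<forall>f\<in>carrier (sec M W).
           cfun c Z (res M W Z f) = sfun_restrict (cmap c ` Z) (cfun c W f)))"

definition supermanifold :: "nat \<Rightarrow> nat \<Rightarrow> ('p, 'f) superspace \<Rightarrow> bool" where
  "supermanifold n m M \<longleftrightarrow>
     Hausdorff_space (topo M) \<and> second_countable (topo M) \<and> sheaf_of_superalgebras M \<and>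
     (\<forall>x\<in>topspace (topo M). \<exists>c. is_chart n m M c \<and> x \<in> cdom c)"

definition global_functions :: "('p, 'f) superspace \<Rightarrow> 'f superalg" where
  "global_functions M = sec M (topspace (topo M))"

section \<open>Operators on a superalgebra and the bracket generated by an odd operator\<close>

definition odd_operator :: "('f, 'z) superalg_scheme \<Rightarrow> ('f \<Rightarrow> 'f) \<Rightarrow> bool" where
  "odd_operator A \<Delta> \<longleftrightarrow>
     (\<forall>f\<in>carrier A. \<Delta> f \<in> carrier A) \<and>
     (\<forall>f\<in>carrier A. \<forall>g\<in>carrier A. \<Delta> (f \<oplus>\<^bsub>A\<^esub> g) = \<Delta> f \<oplus>\<^bsub>A\<^esub> \<Delta> g) \<and>
     (\<forall>r. \<forall>f\<in>carrier A. \<Delta> (r \<odot>\<^bsub>A\<^esub> f) = r \<odot>\<^bsub>A\<^esub> \<Delta> f) \<and>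
     (\<forall>p. \<forall>f\<in>homog A p. \<Delta> f \<in> homog A (p + 1))"

text \<open>
  The order of a differential operator is defined by iterated supercommutators with
  multiplication operators: an operator has order \<open>\<le> k\<close> iff its commutators with all functions
  have order \<open>\<le> k - 1\<close>, and order \<open>\<le> -1\<close> iff it vanishes. In \<open>order_less A k e F\<close> the operator
  \<open>F\<close> has parity \<open>e\<close> and the order is \<open>< k\<close>.
\<close>

primrec order_less ::
    "('f, 'z) superalg_scheme \<Rightarrow> nat \<Rightarrow> nat \<Rightarrow> ('f \<Rightarrow> 'f) \<Rightarrow> bool" where
  "order_less A 0 e F \<longleftrightarrow> (\<forall>g\<in>carrier A. F g = \<zero>\<^bsub>A\<^esub>)"
| "order_less A (Suc k) e F \<longleftrightarrow>
     (\<forall>p. \<forall>f\<in>homog A p.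
        order_less A k (e + p)
          (\<lambda>g. F (f \<otimes>\<^bsub>A\<^esub> g) \<ominus>\<^bsub>A\<^esub> (-1) ^ (e * p) \<odot>\<^bsub>A\<^esub> (f \<otimes>\<^bsub>A\<^esub> F g)))"

definition order_le ::
    "('f, 'z) superalg_scheme \<Rightarrow> nat \<Rightarrow> nat \<Rightarrow> ('f \<Rightarrow> 'f) \<Rightarrow> bool" where
  "order_le A k e F \<longleftrightarrow> order_less A (Suc k) e F"

text \<open>The argument \<open>p\<close> is the parity of \<open>f\<close>.\<close>

definition bracket ::
    "('f, 'z) superalg_scheme \<Rightarrow> ('f \<Rightarrow> 'f) \<Rightarrow> nat \<Rightarrow> 'f \<Rightarrow> 'f \<Rightarrow> 'f" where
  "bracket A \<Delta> p f g =
     \<Delta> (f \<otimes>\<^bsub>A\<^esub> g) \<ominus>\<^bsub>A\<^esub> \<Delta> f \<otimes>\<^bsub>A\<^esub> g \<ominus>\<^bsub>A\<^esub> (-1) ^ p \<odot>\<^bsub>A\<^esub> (f \<otimes>\<^bsub>A\<^esub> \<Delta> g)"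

definition jacobi_identity :: "('f, 'z) superalg_scheme \<Rightarrow> ('f \<Rightarrow> 'f) \<Rightarrow> bool" where
  "jacobi_identity A \<Delta> \<longleftrightarrow>
     (\<forall>p q r. \<forall>f\<in>homog A p. \<forall>g\<in>homog A q. \<forall>h\<in>homog A r.
        bracket A \<Delta> (p + q + 1) (bracket A \<Delta> p f g) h \<oplus>\<^bsub>A\<^esub>
        (-1) ^ (q * r) \<odot>\<^bsub>A\<^esub> bracket A \<Delta> (p + r + 1) (bracket A \<Delta> p f h) g \<oplus>\<^bsub>A\<^esub>
        (-1) ^ (p * (q + r)) \<odot>\<^bsub>A\<^esub> bracket A \<Delta> (q + r + 1) (bracket A \<Delta> q g h) f
        = \<zero>\<^bsub>A\<^esub>)"

definition derivation_of_bracket :: "('f, 'z) superalg_scheme \<Rightarrow> ('f \<Rightarrow> 'f) \<Rightarrow> bool" where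
  "derivation_of_bracket A \<Delta> \<longleftrightarrow>
     (\<forall>p q. \<forall>f\<in>homog A p. \<forall>g\<in>homog A q.
        \<Delta> (bracket A \<Delta> p f g) =
          \<ominus>\<^bsub>A\<^esub> bracket A \<Delta> (p + 1) (\<Delta> f) g \<ominus>\<^bsub>A\<^esub>
          (-1) ^ p \<odot>\<^bsub>A\<^esub> bracket A \<Delta> p f (\<Delta> g))"

section \<open>Second order operators in coordinates\<close>

text \<open>
  \<open>coord_expression n m M \<Delta> c S T\<close>: in the chart \<open>c\<close> the odd operator \<open>\<Delta>\<close> is
  \<open>1/2 S\<^sup>a\<^sup>b \<partial>\<^sub>b \<partial>\<^sub>a + T\<^sup>a \<partial>\<^sub>a\<close>. As usual, the coefficients \<open>S\<^sup>a\<^sup>b\<close> are taken to be symmetric in the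
  graded sense, which makes them unique.
\<close>

definition coord_expression ::
    "nat \<Rightarrow> nat \<Rightarrow> ('p, 'f) superspace \<Rightarrow> ('f \<Rightarrow> 'f) \<Rightarrow> ('p, 'f) chart \<Rightarrow>
     (coord_index \<Rightarrow> coord_index \<Rightarrow> sfun) \<Rightarrow> (coord_index \<Rightarrow> sfun) \<Rightarrow> bool" where
  "coord_expression n m M \<Delta> c S T \<longleftrightarrow>
     (let V = crange c; R = sfun_alg n m V; I = coords n m;
          loc = (\<lambda>f. cfun c (cdom c) (res M (topspace (topo M)) (cdom c) f))
      in (\<forall>a\<in>I. \<forall>b\<in>I. S a b \<in> homog R (parity a + parity b + 1)) \<and>
         (\<forall>a\<in>I. \<forall>b\<in>I. S a b = (-1) ^ (parity a * parity b) \<odot>\<^bsub>R\<^esub> S b a) \<and>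
         (\<forall>a\<in>I. T a \<in> homog R (parity a + 1)) \<and>
         (\<forall>f\<in>carrier (global_functions M).
            loc (\<Delta> f) =
              (1/2) \<odot>\<^bsub>R\<^esub>
                (\<Oplus>\<^bsub>R\<^esub>a\<in>I. \<Oplus>\<^bsub>R\<^esub>b\<in>I. S a b \<otimes>\<^bsub>R\<^esub> sderiv V b (sderiv V a (loc f)))
              \<oplus>\<^bsub>R\<^esub> (\<Oplus>\<^bsub>R\<^esub>a\<in>I. T a \<otimes>\<^bsub>R\<^esub> sderiv V a (loc f))))"

section \<open>The cotangent bundle over a coordinate domain\<close>

text \<open>
  The cotangent bundle of a superdomain of dimension \<open>n|m\<close> is a superdomain of dimension
  \<open>2n|2m\<close>, the momentum conjugate to a coordinate having the parity of that coordinate; the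
  momenta are numbered after the coordinates.
\<close>

definition base_point :: "nat \<Rightarrow> (nat \<Rightarrow> real) \<Rightarrow> nat \<Rightarrow> real" where
  "base_point n z = (\<lambda>i. if i < n then z i else 0)"

definition cotangent :: "nat \<Rightarrow> (nat \<Rightarrow> real) set \<Rightarrow> (nat \<Rightarrow> real) set" where
  "cotangent n V = {z \<in> topspace (Euclidean_space (2 * n)). base_point n z \<in> V}"

definition cotangent_alg :: "nat \<Rightarrow> nat \<Rightarrow> (nat \<Rightarrow> real) set \<Rightarrow> sfun superalg" where
  "cotangent_alg n m V = sfun_alg (2 * n) (2 * m) (cotangent n V)"

text \<open>Pull-back of functions along the projection to the base.\<close>

definition pull :: "nat \<Rightarrow> (nat \<Rightarrow> real) set \<Rightarrow> sfun \<Rightarrow> sfun" where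
  "pull n V f = (\<lambda>A z. if z \<in> cotangent n V then f A (base_point n z) else 0)"

primrec mom_index :: "nat \<Rightarrow> nat \<Rightarrow> coord_index \<Rightarrow> coord_index" where
  "mom_index n m (Ev i) = Ev (n + i)"
| "mom_index n m (Od j) = Od (m + j)"

definition mom :: "nat \<Rightarrow> nat \<Rightarrow> (nat \<Rightarrow> real) set \<Rightarrow> coord_index \<Rightarrow> sfun" where
  "mom n m V a = coord_fun (cotangent n V) (mom_index n m a)"

text \<open>
  Canonical even Poisson bracket with \<open>(p\<^sub>a, x\<^sup>b) = \<delta>\<close>; \<open>q\<close> is the parity of \<open>f\<close>. The signs
  are those making it graded antisymmetric and a derivation in the second argument.
\<close>

definition poisson ::
    "nat \<Rightarrow> nat \<Rightarrow> (nat \<Rightarrow> real) set \<Rightarrow> nat \<Rightarrow> sfun \<Rightarrow> sfun \<Rightarrow> sfun" where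
  "poisson n m V q f g =
     (let R = cotangent_alg n m V; W = cotangent n V; I = coords n m in
        (\<Oplus>\<^bsub>R\<^esub>a\<in>I. (-1) ^ (parity a * (q + 1)) \<odot>\<^bsub>R\<^esub>
           (sderiv W (mom_index n m a) f \<otimes>\<^bsub>R\<^esub> sderiv W a g)) \<ominus>\<^bsub>R\<^esub>
        (\<Oplus>\<^bsub>R\<^esub>a\<in>I. (-1) ^ (parity a * q) \<odot>\<^bsub>R\<^esub>
           (sderiv W a f \<otimes>\<^bsub>R\<^esub> sderiv W (mom_index n m a) g)))"

definition principal_symbol ::
    "nat \<Rightarrow> nat \<Rightarrow> (nat \<Rightarrow> real) set \<Rightarrow> (coord_index \<Rightarrow> coord_index \<Rightarrow> sfun) \<Rightarrow> sfun" where
  "principal_symbol n m V S =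
     (let R = cotangent_alg n m V; I = coords n m in
        (1/2) \<odot>\<^bsub>R\<^esub> (\<Oplus>\<^bsub>R\<^esub>a\<in>I. \<Oplus>\<^bsub>R\<^esub>b\<in>I.
           pull n V (S a b) \<otimes>\<^bsub>R\<^esub> (mom n m V b \<otimes>\<^bsub>R\<^esub> mom n m V a)))"

text \<open>
  The coefficients of the subprincipal symbol of an operator of parity \<open>\<epsilon>\<close> carry the sign
  \<open>(-1)\<close> to the power \<open>parity b * (\<epsilon> + 1)\<close> in front of the derivative with respect to the
  coordinate \<open>b\<close>; here \<open>\<epsilon> = 1\<close>.
\<close>

definition upper_connection_coeff ::
    "nat \<Rightarrow> nat \<Rightarrow> (nat \<Rightarrow> real) set \<Rightarrow> (coord_index \<Rightarrow> coord_index \<Rightarrow> sfun) \<Rightarrow>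
     (coord_index \<Rightarrow> sfun) \<Rightarrow> coord_index \<Rightarrow> sfun" where
  "upper_connection_coeff n m V S T a =
     (let R = sfun_alg n m V in
        (\<Oplus>\<^bsub>R\<^esub>b\<in>coords n m. sderiv V b (S b a)) \<ominus>\<^bsub>R\<^esub> 2 \<odot>\<^bsub>R\<^esub> T a)"

definition upper_connection ::
    "nat \<Rightarrow> nat \<Rightarrow> (nat \<Rightarrow> real) set \<Rightarrow> (coord_index \<Rightarrow> coord_index \<Rightarrow> sfun) \<Rightarrow>
     (coord_index \<Rightarrow> sfun) \<Rightarrow> sfun" where
  "upper_connection n m V S T =
     (let R = cotangent_alg n m V in
        \<Oplus>\<^bsub>R\<^esub>a\<in>coords n m.
          pull n V (upper_connection_coeff n m V S T a) \<otimes>\<^bsub>R\<^esub> mom n m V a)"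

text \<open>The operator \<open>D = (S, \<cdot>)\<close>; the principal symbol of an odd operator is odd.\<close>

definition symbol_diff ::
    "nat \<Rightarrow> nat \<Rightarrow> (nat \<Rightarrow> real) set \<Rightarrow> (coord_index \<Rightarrow> coord_index \<Rightarrow> sfun) \<Rightarrow> sfun \<Rightarrow> sfun" where
  "symbol_diff n m V S = poisson n m V 1 (principal_symbol n m V S)"

end

theory Submission
  imports Defs
begin

text \<open>
  With \<open>\<Phi>\<^sub>2\<close>, \<open>\<Phi>\<^sub>3\<close> the double and triple commutators of \<open>\<Delta>\<^sup>2\<close> with functions, evaluated at \<open>1\<close>,
  expanding the definition of the bracket gives
  \<open>\<Phi>\<^sub>2(f, g) = \<Delta>{f, g} + {\<Delta> f, g} \<plusminus> {f, \<Delta> g}\<close>, and since \<open>{f, \<cdot>}\<close> is a derivation,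
  \<open>\<Phi>\<^sub>3(f, g, h)\<close> is the Jacobiator. This yields both equivalences about the order of \<open>\<Delta>\<^sup>2\<close>. Bump
  functions make the identities for global functions equivalent to those on all charts.

  In a chart, assume the Jacobi identity. Then the double commutators of \<open>\<Delta>\<^sup>2\<close> with the coordinates
  are multiplications by \<open>\<Phi>\<^sub>2(x\<^sup>a, x\<^sup>b)\<close>, and if these vanish, \<open>\<Delta>\<^sup>2\<close> is a derivation because an
  operator in normal form is determined by its commutators with the coordinates.
  Finally \<open>\<Sum> \<Phi>\<^sub>2(x\<^sup>a, x\<^sup>b) p\<^sub>b p\<^sub>a = S\<^sup>a\<^sup>b \<partial>\<^sub>b \<partial>\<^sub>a S + 2 (S, T\<^sup>a p\<^sub>a)\<close>; applying \<open>\<Sum> \<partial>/\<partial>x\<^sup>b \<partial>/\<partial>p\<^sub>b\<close> to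
  \<open>(S, S) = 0\<close> turns the first term into \<open>- (S, \<partial>\<^sub>b S\<^sup>b\<^sup>a p\<^sub>a)\<close>, so that the sum is \<open>- D \<gamma>\<close>.
\<close>

section \<open>Second order operators on a supercommutative algebra\<close>

text \<open>Smooth functions are not generated by the coordinates, so vanishing on pairs of
  coordinates says nothing by itself about other functions. The finite order of \<Delta>^2 closes
  this gap; the normal form exploits it purely algebraically, without Taylor expansion. On the
  symbol side the obstacle is a term with second derivatives of S that is not a Poisson bracket,
  while the Jacobi identity contains first derivatives only. It has to be differentiated once, and
  the trace over a coordinate and its own momentum is the contraction that lowers the degree in the
  momenta from three to two. The Jacobi identity thus enters twice: it kills the remainder of the
  double commutators, and it trades the second order term. All signs are handled in an abstract
  algebra with two families of derivations. On the cotangent bundle \<Delta> acts with the momenta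
  as constants, so that a family of identities indexed by a, b becomes one identity between
  functions.\<close>

lemma minus_one_power_cong: "even m = even n \<Longrightarrow> (- 1 :: 'a::ring_1) ^ m = (- 1) ^ n"
  by (simp add: minus_one_power_iff)

text \<open>Products are normalised with all brackets to the right, so a sign rule for two factors
  is also needed in front of a remaining factor \<open>w\<close>.\<close>

lemma skew_comm_left:
  fixes u v w :: "'a::real_algebra_1"
  shows "u * v = r *\<^sub>R (v * u) \<Longrightarrow> u * (v * w) = r *\<^sub>R (v * (u * w))"
  by (simp flip: mult.assoc)

text \<open>The algebra is a subset \<open>C\<close> of a type, not the whole type, because
  functions on a domain are cut off to zero outside it; the unit of the type need not lie in
  \<open>C\<close>. Parities are naturals modulo 2 (\<open>H_cong\<close>) and are passed
  explicitly, since zero lies in every \<open>H p\<close> and has no parity of its own. The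
  derivations are a parameter: position and momentum derivatives will be two instances over the same
  \<open>H\<close> and \<open>C\<close>.\<close>

locale super_differential =
  fixes H :: "nat \<Rightarrow> 'a::real_algebra_1 set" and C :: "'a set"
    and I :: "'i set" and par :: "'i \<Rightarrow> nat" and D :: "'i \<Rightarrow> 'a \<Rightarrow> 'a"
  assumes finite_I: "finite I"
    and H_C: "f \<in> H p \<Longrightarrow> f \<in> C"
    and H_cong: "f \<in> H p \<Longrightarrow> even p = even q \<Longrightarrow> f \<in> H q"
    and H_zero: "0 \<in> H p"
    and H_add: "f \<in> H p \<Longrightarrow> g \<in> H p \<Longrightarrow> f + g \<in> H p"
    and H_scale: "f \<in> H p \<Longrightarrow> r *\<^sub>R f \<in> H p"
    and H_mult: "f \<in> H p \<Longrightarrow> g \<in> H q \<Longrightarrow> f * g \<in> H (p + q)"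
    and H_comm: "f \<in> H p \<Longrightarrow> g \<in> H q \<Longrightarrow> f * g = (-1) ^ (p * q) *\<^sub>R (g * f)"
    and C_add: "f \<in> C \<Longrightarrow> g \<in> C \<Longrightarrow> f + g \<in> C"
    and C_scale: "f \<in> C \<Longrightarrow> r *\<^sub>R f \<in> C"
    and C_split: "f \<in> C \<Longrightarrow> \<exists>u\<in>H 0. \<exists>v\<in>H 1. f = u + v"
    and C_mult: "f \<in> C \<Longrightarrow> g \<in> C \<Longrightarrow> f * g \<in> C"
    and D_C: "a \<in> I \<Longrightarrow> f \<in> C \<Longrightarrow> D a f \<in> C"
    and D_H: "a \<in> I \<Longrightarrow> f \<in> H p \<Longrightarrow> D a f \<in> H (par a + p)"
    and D_add: "a \<in> I \<Longrightarrow> f \<in> C \<Longrightarrow> g \<in> C \<Longrightarrow> D a (f + g) = D a f + D a g"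
    and D_scale: "a \<in> I \<Longrightarrow> f \<in> C \<Longrightarrow> D a (r *\<^sub>R f) = r *\<^sub>R D a f"
    and D_mult: "a \<in> I \<Longrightarrow> f \<in> H p \<Longrightarrow> g \<in> C \<Longrightarrow>
      D a (f * g) = D a f * g + (-1) ^ (par a * p) *\<^sub>R (f * D a g)"
    and D_comm: "a \<in> I \<Longrightarrow> b \<in> I \<Longrightarrow> f \<in> C \<Longrightarrow>
      D a (D b f) = (-1) ^ (par a * par b) *\<^sub>R D b (D a f)"
begin

lemma C_zero: "0 \<in> C"
  using H_C H_zero by blast

lemma C_sum: "(\<And>i. i \<in> J \<Longrightarrow> f i \<in> C) \<Longrightarrow> sum f J \<in> C"
  by (induction J rule: infinite_finite_induct) (auto intro: C_zero C_add)

lemma H_sum: "(\<And>i. i \<in> J \<Longrightarrow> f i \<in> H p) \<Longrightarrow> sum f J \<in> H p"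
  by (induction J rule: infinite_finite_induct) (auto intro: H_zero H_add)

lemma C_minus: "f \<in> C \<Longrightarrow> - f \<in> C"
  using C_scale[of f "-1"] by simp

lemma C_diff: "f \<in> C \<Longrightarrow> g \<in> C \<Longrightarrow> f - g \<in> C"
  using C_add[of f "- g"] C_minus by simp

lemma H_minus: "f \<in> H p \<Longrightarrow> - f \<in> H p"
  using H_scale[of f p "-1"] by simp

lemma H_diff: "f \<in> H p \<Longrightarrow> g \<in> H p \<Longrightarrow> f - g \<in> H p"
  using H_add[of f p "- g"] H_minus by simp

lemma D_zero: "a \<in> I \<Longrightarrow> D a 0 = 0"
  using D_scale[of a 0 0] C_zero by simp

lemma D_sum: "a \<in> I \<Longrightarrow> (\<And>i. i \<in> J \<Longrightarrow> f i \<in> C) \<Longrightarrow> D a (sum f J) = (\<Sum>i\<in>J. D a (f i))"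
  by (induction J rule: infinite_finite_induct) (auto simp: D_zero D_add C_sum)

lemma D_minus: "a \<in> I \<Longrightarrow> f \<in> C \<Longrightarrow> D a (- f) = - D a f"
  using D_scale[of a f "-1"] by simp

lemma D_diff: "a \<in> I \<Longrightarrow> f \<in> C \<Longrightarrow> g \<in> C \<Longrightarrow> D a (f - g) = D a f - D a g"
  using D_add[of a f "- g"] by (simp add: D_minus C_minus)

lemmas C_intros = H_C C_zero C_add C_scale C_mult C_minus C_diff D_C

end

section \<open>The bracket generated by a second order operator, and the square of the
  operator\<close>

locale second_order = super_differential H C I par D
  for H :: "nat \<Rightarrow> 'a::real_algebra_1 set" and C :: "'a set"
    and I :: "'i set" and par :: "'i \<Rightarrow> nat" and D :: "'i \<Rightarrow> 'a \<Rightarrow> 'a" +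
  fixes S :: "'i \<Rightarrow> 'i \<Rightarrow> 'a" and T :: "'i \<Rightarrow> 'a"
  assumes S_H: "a \<in> I \<Longrightarrow> b \<in> I \<Longrightarrow> S a b \<in> H (par a + par b + 1)"
    and S_sym: "a \<in> I \<Longrightarrow> b \<in> I \<Longrightarrow> S a b = (-1) ^ (par a * par b) *\<^sub>R S b a"
    and T_H: "a \<in> I \<Longrightarrow> T a \<in> H (par a + 1)"
begin

definition L :: "'a \<Rightarrow> 'a" where
  "L f = (1/2) *\<^sub>R (\<Sum>a\<in>I. \<Sum>b\<in>I. S a b * D b (D a f)) + (\<Sum>a\<in>I. T a * D a f)"

definition br :: "nat \<Rightarrow> 'a \<Rightarrow> 'a \<Rightarrow> 'a" where
  "br p f g = L (f * g) - L f * g - (-1) ^ p *\<^sub>R (f * L g)"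

lemma S_C: "a \<in> I \<Longrightarrow> b \<in> I \<Longrightarrow> S a b \<in> C" and T_C: "a \<in> I \<Longrightarrow> T a \<in> C"
  by (blast intro: H_C S_H T_H)+

lemma L_C: "f \<in> C \<Longrightarrow> L f \<in> C"
  unfolding L_def by (intro C_add C_scale C_sum C_mult S_C T_C D_C)

lemma L_H:
  assumes "f \<in> H p" shows "L f \<in> H (p + 1)"
proof -
  have "S a b * D b (D a f) \<in> H (p + 1)" if "a \<in> I" "b \<in> I" for a b
    by (rule H_cong[OF H_mult[OF S_H[OF that] D_H[OF that(2) D_H[OF that(1) assms]]]]) presburger
  moreover have "T a * D a f \<in> H (p + 1)" if "a \<in> I" for a
    by (rule H_cong[OF H_mult[OF T_H[OF that] D_H[OF that assms]]]) presburger
  ultimately show ?thesis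
    unfolding L_def by (intro H_add H_scale H_sum)
qed

lemma L_add: "f \<in> C \<Longrightarrow> g \<in> C \<Longrightarrow> L (f + g) = L f + L g"
  unfolding L_def
  by (simp add: D_add D_C sum.distrib distrib_left scaleR_add_right algebra_simps)

lemma L_scale: "f \<in> C \<Longrightarrow> L (r *\<^sub>R f) = r *\<^sub>R L f"
  unfolding L_def
  by (simp add: D_scale D_C scaleR_sum_right scaleR_add_right mult.commute)

lemma L_minus: "f \<in> C \<Longrightarrow> L (- f) = - L f"
  using L_scale[of f "-1"] by simp

lemma L_diff: "f \<in> C \<Longrightarrow> g \<in> C \<Longrightarrow> L (f - g) = L f - L g"
  using L_add[of f "- g"] by (simp add: L_minus C_minus)

lemma L_zero: "L 0 = 0"
  using L_scale[OF C_zero, of 0] by simp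

lemma sum_scale_swap:
  "(\<Sum>a\<in>I. \<Sum>b\<in>I. Z a b) = (\<Sum>a\<in>I. \<Sum>b\<in>I. Z b a)"
  by (rule sum.swap)

text \<open>The second order Leibniz rule gives four terms. Those with both derivatives on one
  factor, together with the first order part, cancel against \<open>L f * g\<close> and
  \<open>f * L g\<close>. The two mixed terms agree after exchanging \<open>a\<close> and
  \<open>b\<close> by the graded symmetry of \<open>S\<close>, which uses up the factor 1/2.\<close>

lemma br_eq:
  assumes f: "f \<in> H p" and g: "g \<in> C"
  shows "br p f g = (\<Sum>a\<in>I. \<Sum>b\<in>I. (-1) ^ (par a * p) *\<^sub>R (S a b * D b f * D a g))"
proof -
  have fC: "f \<in> C" using f by (rule H_C)
  have 1: "S a b * D b (D a (f * g)) = S a b * D b (D a f) * g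
      + ((-1) ^ (par b * (par a + p)) *\<^sub>R (S a b * D a f * D b g)
      + (-1) ^ (par a * p) *\<^sub>R (S a b * D b f * D a g)
      + (-1) ^ p *\<^sub>R (f * (S a b * D b (D a g))))"
    if ab: "a \<in> I" "b \<in> I" for a b
  proof -
    have c: "S a b * f = (-1) ^ ((par a + par b + 1) * p) *\<^sub>R (f * S a b)"
      by (rule H_comm[OF S_H[OF ab] f])
    have "D b (D a (f * g)) = D b (D a f) * g
      + (-1) ^ (par b * (par a + p)) *\<^sub>R (D a f * D b g)
      + (-1) ^ (par a * p) *\<^sub>R (D b f * D a g)
      + (-1) ^ (par a * p + par b * p) *\<^sub>R (f * D b (D a g))"
      using ab f g fC
      by (simp add: D_mult[OF _ f] D_mult[OF _ D_H[OF _ f]] D_add D_scale C_intros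
          scaleR_add_right power_add add.assoc)
    moreover have "S a b * (f * D b (D a g)) = (-1) ^ ((par a + par b + 1) * p) *\<^sub>R (f * (S a b * D b (D a g)))"
      by (simp add: mult.assoc[symmetric] c)
    ultimately show ?thesis
      by (auto simp add: distrib_left mult.assoc minus_one_power_iff)
  qed
  have 2: "(\<Sum>a\<in>I. \<Sum>b\<in>I. (-1) ^ (par b * (par a + p)) *\<^sub>R (S a b * D a f * D b g)) =
     (\<Sum>a\<in>I. \<Sum>b\<in>I. (-1) ^ (par a * p) *\<^sub>R (S a b * D b f * D a g))"
  proof (subst sum_scale_swap, intro sum.cong refl)
    fix a b assume ab: "a \<in> I" "b \<in> I"
    show "(- 1) ^ (par a * (par b + p)) *\<^sub>R (S b a * D b f * D a g) =
           (- 1) ^ (par a * p) *\<^sub>R (S a b * D b f * D a g)"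
      by (subst S_sym[OF ab]) (auto simp: minus_one_power_iff)
  qed
  have 3: "T a * D a (f * g) = T a * D a f * g + (-1) ^ p *\<^sub>R (f * (T a * D a g))"
    if a: "a \<in> I" for a
  proof -
    have "T a * f = (-1) ^ ((par a + 1) * p) *\<^sub>R (f * T a)"
      by (rule H_comm[OF T_H[OF a] f])
    then have "T a * (f * D a g) = (-1) ^ ((par a + 1) * p) *\<^sub>R (f * (T a * D a g))"
      by (simp add: mult.assoc[symmetric])
    then show ?thesis
      by (auto simp add: D_mult[OF a f g] distrib_left mult.assoc minus_one_power_iff)
  qed
  have "L (f * g) = (1/2) *\<^sub>R ((\<Sum>a\<in>I. \<Sum>b\<in>I. S a b * D b (D a f) * g)
      + (2 *\<^sub>R (\<Sum>a\<in>I. \<Sum>b\<in>I. (-1) ^ (par a * p) *\<^sub>R (S a b * D b f * D a g))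
      + (\<Sum>a\<in>I. \<Sum>b\<in>I. (-1) ^ p *\<^sub>R (f * (S a b * D b (D a g))))))
      + ((\<Sum>a\<in>I. T a * D a f * g) + (\<Sum>a\<in>I. (-1) ^ p *\<^sub>R (f * (T a * D a g))))"
    unfolding L_def by (simp add: 1 3 sum.distrib 2 scaleR_2 add.assoc cong: sum.cong)
  then show ?thesis
    unfolding br_def L_def
    by (simp add: algebra_simps scaleR_add_right sum_distrib_left sum_distrib_right scaleR_sum_right)
qed

lemma br_H:
  assumes f: "f \<in> H p" and g: "g \<in> H q" shows "br p f g \<in> H (p + q + 1)"
proof -
  have "L f * g \<in> H (p + q + 1)"
    using H_mult[OF L_H[OF f] g] by (simp add: ac_simps)
  moreover have "f * L g \<in> H (p + q + 1)"
    using H_mult[OF f L_H[OF g]] by (simp add: ac_simps)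
  ultimately show ?thesis
    unfolding br_def using L_H[OF H_mult[OF f g]] by (intro H_diff H_scale)
qed

lemma br_C: "f \<in> C \<Longrightarrow> g \<in> C \<Longrightarrow> br p f g \<in> C"
  unfolding br_def by (intro C_diff C_scale L_C C_mult)

lemma br_add: "f \<in> C \<Longrightarrow> g \<in> C \<Longrightarrow> h \<in> C \<Longrightarrow> br p f (g + h) = br p f g + br p f h"
  unfolding br_def by (simp add: distrib_left L_add C_mult L_C scaleR_add_right)

lemma br_scale: "f \<in> C \<Longrightarrow> g \<in> C \<Longrightarrow> br p f (r *\<^sub>R g) = r *\<^sub>R br p f g"
  unfolding br_def by (simp add: L_scale C_mult scaleR_diff_right)

lemma br_sym:
  assumes f: "f \<in> H p" and g: "g \<in> H q"
  shows "br p f g = (-1) ^ (p * q) *\<^sub>R br q g f"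
proof -
  have "L f * g = (-1) ^ ((p + 1) * q) *\<^sub>R (g * L f)"
    by (rule H_comm[OF L_H[OF f] g])
  moreover have "f * L g = (-1) ^ (p * (q + 1)) *\<^sub>R (L g * f)"
    by (rule H_comm[OF f L_H[OF g]])
  moreover have "L (f * g) = (-1) ^ (p * q) *\<^sub>R L (g * f)"
    using H_comm[OF f g] f g by (simp add: L_scale C_mult H_C)
  ultimately show ?thesis
    unfolding br_def by (cases "even p"; cases "even q") (auto simp: algebra_simps)
qed

text \<open>In the coordinate formula of \<open>br_eq\<close> the second argument stands under a
  single derivative, hence a Leibniz rule. The factor \<open>g\<close> passes the odd bracket as
  well as \<open>f\<close>, which accounts for \<open>p + 1\<close> in the sign.\<close>

lemma br_mult:
  assumes f: "f \<in> H p" and g: "g \<in> H q" and h: "h \<in> C"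
  shows "br p f (g * h) = br p f g * h + (-1) ^ ((p + 1) * q) *\<^sub>R (g * br p f h)"
proof -
  have gC: "g \<in> C" using g by (rule H_C)
  have "(-1) ^ (par a * p) *\<^sub>R (S a b * D b f * D a (g * h)) =
     (-1) ^ (par a * p) *\<^sub>R (S a b * D b f * D a g) * h +
     (-1) ^ ((p + 1) * q) *\<^sub>R (g * ((-1) ^ (par a * p) *\<^sub>R (S a b * D b f * D a h)))"
    if ab: "a \<in> I" "b \<in> I" for a b
  proof -
    have "S a b * D b f * (g * D a h) =
      (-1) ^ ((par a + par b + 1 + (par b + p)) * q) *\<^sub>R (g * (S a b * D b f * D a h))"
      by (rule skew_comm_left[OF H_comm[OF H_mult[OF S_H[OF ab] D_H[OF ab(2) f]] g]])
    then have "S a b * D b f * D a (g * h) = S a b * D b f * D a g * h +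
      (-1) ^ (par a * q + (par a + par b + 1 + (par b + p)) * q) *\<^sub>R (g * (S a b * D b f * D a h))"
      by (simp add: D_mult[OF ab(1) g h] distrib_left mult.assoc power_add)
    moreover have "(-1::real) ^ (par a * q + (par a + par b + 1 + (par b + p)) * q) = (-1) ^ ((p + 1) * q)"
      by (rule minus_one_power_cong) auto
    ultimately show ?thesis
      by (simp add: scaleR_add_right mult.commute)
  qed
  then have "br p f (g * h) = (\<Sum>a\<in>I. \<Sum>b\<in>I.
     (-1) ^ (par a * p) *\<^sub>R (S a b * D b f * D a g) * h +
     (-1) ^ ((p + 1) * q) *\<^sub>R (g * ((-1) ^ (par a * p) *\<^sub>R (S a b * D b f * D a h))))"
    unfolding br_eq[OF f C_mult[OF gC h]] by (intro sum.cong refl)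
  also have "\<dots> = br p f g * h + (-1) ^ ((p + 1) * q) *\<^sub>R (g * br p f h)"
    unfolding br_eq[OF f gC] br_eq[OF f h]
    by (simp only: sum.distrib sum_distrib_left sum_distrib_right scaleR_sum_right)
  finally show ?thesis .
qed

text \<open>This is \<open>\<Phi>\<^sub>2\<close>. The square of an odd operator is even, so neither
  a sign nor a parity argument occurs.\<close>

definition E :: "'a \<Rightarrow> 'a \<Rightarrow> 'a" where
  "E f g = L (L (f * g)) - L (L f) * g - f * L (L g)"

lemma E_C: "f \<in> C \<Longrightarrow> g \<in> C \<Longrightarrow> E f g \<in> C"
  unfolding E_def by (intro C_diff L_C C_mult)

lemma E_add: "f \<in> C \<Longrightarrow> g \<in> C \<Longrightarrow> h \<in> C \<Longrightarrow> E f (g + h) = E f g + E f h"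
  unfolding E_def by (simp add: distrib_left L_add C_mult L_C)

lemma E_H:
  assumes f: "f \<in> H p" and g: "g \<in> H q" shows "E f g \<in> H (p + q)"
proof -
  have *: "L (L h) \<in> H r" if "h \<in> H r" for h r
    by (rule H_cong[OF L_H[OF L_H[OF that]]]) simp
  show ?thesis
    unfolding E_def by (intro H_diff H_mult * f g)
qed

lemma E_sym:
  assumes f: "f \<in> H p" and g: "g \<in> H q"
  shows "E f g = (-1) ^ (p * q) *\<^sub>R E g f"
proof -
  have *: "L (L h) \<in> H r" if "h \<in> H r" for h r
    by (rule H_cong[OF L_H[OF L_H[OF that]]]) simp
  have "L (L (f * g)) = (-1) ^ (p * q) *\<^sub>R L (L (g * f))"
    using H_comm[OF f g] f g by (simp add: L_scale C_mult H_C L_C)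
  then show ?thesis
    unfolding E_def H_comm[OF *[OF f] g] H_comm[OF f *[OF g]]
    by (simp add: algebra_simps)
qed

text \<open>The terms \<open>L (L f * g)\<close>, \<open>L (f * L g)\<close> and
  \<open>L f * L g\<close> each occur twice with opposite signs. Thus \<open>E\<close> measures how
  far \<open>L\<close> is from being a derivation of its bracket.\<close>

lemma E_eq:
  assumes f: "f \<in> C" and g: "g \<in> C"
  shows "E f g = L (br p f g) + br (p + 1) (L f) g + (-1) ^ p *\<^sub>R br p f (L g)"
  unfolding E_def br_def using f g
  by (cases "even p") (auto simp: L_diff L_add L_scale L_minus C_mult L_C C_diff C_add)

text \<open>This is \<open>\<Phi>\<^sub>3\<close>, taken as the failure of \<open>E f\<close> to be
  a derivation. In this form it can be compared both with iterated brackets and with iterated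
  commutators.\<close>

definition triple :: "nat \<Rightarrow> nat \<Rightarrow> 'a \<Rightarrow> 'a \<Rightarrow> 'a \<Rightarrow> 'a" where
  "triple p q f g h = E f (g * h) - E f g * h - (-1) ^ (p * q) *\<^sub>R (g * E f h)"

text \<open>The definition of the bracket is read as the product rule of \<open>L\<close> with the
  bracket as defect (\<open>L_mult\<close>). After \<open>E_eq\<close> all terms that still contain
  an \<open>L\<close> cancel, and only iterated brackets survive.\<close>

lemma triple_eq:
  assumes f: "f \<in> H p" and g: "g \<in> H q" and h: "h \<in> C"
  shows "triple p q f g h = br (p + q + 1) (br p f g) h
    + (-1) ^ ((p + 1) * q) *\<^sub>R br q g (br p f h) + (-1) ^ p *\<^sub>R br p f (br q g h)"
proof -
  have fC: "f \<in> C" and gC: "g \<in> C" using f g by (auto intro: H_C)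
  note C = fC gC h L_C C_mult br_C C_scale C_add
  have L_mult: "L (u * v) = L u * v + (-1) ^ s *\<^sub>R (u * L v) + br s u v" for u v s
    unfolding br_def by simp
  have 1: "L (br p f (g * h)) = L (br p f g) * h + (-1) ^ (p + q + 1) *\<^sub>R (br p f g * L h)
      + br (p + q + 1) (br p f g) h
      + (-1) ^ ((p + 1) * q) *\<^sub>R (L g * br p f h + (-1) ^ q *\<^sub>R (g * L (br p f h)) + br q g (br p f h))"
    by (simp add: br_mult[OF f g h] L_add L_scale C L_mult[of "br p f g" h "p + q + 1"]
        L_mult[of g "br p f h" q])
  have 2: "br (p + 1) (L f) (g * h) = br (p + 1) (L f) g * h
      + (-1) ^ ((p + 2) * q) *\<^sub>R (g * br (p + 1) (L f) h)"
    using br_mult[OF L_H[OF f] g h] by simp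
  have "br p f (L (g * h)) = br p f (L g * h) + (-1) ^ q *\<^sub>R br p f (g * L h) + br p f (br q g h)"
    by (simp add: L_mult[of g h q] br_add br_scale C)
  also have "br p f (L g * h) = br p f (L g) * h + (-1) ^ ((p + 1) * (q + 1)) *\<^sub>R (L g * br p f h)"
    by (rule br_mult[OF f L_H[OF g] h])
  also have "br p f (g * L h) = br p f g * L h + (-1) ^ ((p + 1) * q) *\<^sub>R (g * br p f (L h))"
    by (rule br_mult[OF f g L_C[OF h]])
  finally have 3: "br p f (L (g * h)) = br p f (L g) * h
      + (-1) ^ ((p + 1) * (q + 1)) *\<^sub>R (L g * br p f h)
      + (-1) ^ q *\<^sub>R (br p f g * L h + (-1) ^ ((p + 1) * q) *\<^sub>R (g * br p f (L h)))
      + br p f (br q g h)" .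
  show ?thesis
    unfolding triple_def E_eq[OF fC gC, of p] E_eq[OF fC h, of p] E_eq[OF fC C_mult[OF gC h], of p] 1 2 3
    by (cases "even p"; cases "even q") (auto simp: algebra_simps)
qed

definition jac :: "nat \<Rightarrow> nat \<Rightarrow> nat \<Rightarrow> 'a \<Rightarrow> 'a \<Rightarrow> 'a \<Rightarrow> 'a" where
  "jac p q r f g h = br (p + q + 1) (br p f g) h
    + (-1) ^ (q * r) *\<^sub>R br (p + r + 1) (br p f h) g
    + (-1) ^ (p * (q + r)) *\<^sub>R br (q + r + 1) (br q g h) f"

text \<open>Symmetry of the bracket moves each inner bracket to the first slot, turning the
  derivation form of the Jacobi identity into the cyclic one.\<close>

lemma jac_eq_triple:
  assumes f: "f \<in> H p" and g: "g \<in> H q" and h: "h \<in> H r"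
  shows "jac p q r f g h = triple p q f g h"
proof -
  have "br q g (br p f h) = (-1) ^ (q * (p + r + 1)) *\<^sub>R br (p + r + 1) (br p f h) g"
    by (rule br_sym[OF g br_H[OF f h]])
  moreover have "br p f (br q g h) = (-1) ^ (p * (q + r + 1)) *\<^sub>R br (q + r + 1) (br q g h) f"
    by (rule br_sym[OF f br_H[OF g h]])
  ultimately show ?thesis
    unfolding jac_def triple_eq[OF f g H_C[OF h]]
    by (cases "even p"; cases "even q"; cases "even r") auto
qed

lemma triple_add: "f \<in> C \<Longrightarrow> g \<in> C \<Longrightarrow> h \<in> C \<Longrightarrow> k \<in> C \<Longrightarrow>
    triple p q f g (h + k) = triple p q f g h + triple p q f g k"
  unfolding triple_def by (simp add: distrib_left E_add C_mult algebra_simps)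

text \<open>\<open>s\<close> is the parity of the operator \<open>Q\<close> and \<open>p\<close>
  that of \<open>f\<close>; nesting it reproduces the recursion of
  \<open>order_less\<close>.\<close>

definition supercomm :: "nat \<Rightarrow> nat \<Rightarrow> ('a \<Rightarrow> 'a) \<Rightarrow> 'a \<Rightarrow> 'a \<Rightarrow> 'a" where
  "supercomm s p Q f g = Q (f * g) - (-1) ^ (s * p) *\<^sub>R (f * Q g)"

text \<open>As an operator in \<open>u\<close> the double commutator is multiplication by
  \<open>E f g\<close> plus the remainder \<open>triple\<close>. The multiplication drops out of the
  next commutator, so the third one depends on \<open>triple\<close> alone.\<close>

lemma supercomm_supercomm_eq:
  assumes f: "f \<in> H p" and g: "g \<in> H q" and u: "u \<in> C"
  shows "supercomm p q (supercomm 0 p (\<lambda>v. L (L v)) f) g u = triple p q f g u + E f g * u"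
proof -
  have *: "L (L f) \<in> H p"
    by (rule H_cong[OF L_H[OF L_H[OF f]]]) simp
  have "L (L f) * (g * u) = (-1) ^ (p * q) *\<^sub>R (g * (L (L f) * u))"
    by (rule skew_comm_left[OF H_comm[OF * g]])
  then show ?thesis
    unfolding supercomm_def triple_def E_def by (simp add: algebra_simps)
qed

lemma supercomm_supercomm_supercomm_eq:
  assumes f: "f \<in> H p" and g: "g \<in> H q" and h: "h \<in> H r" and u: "u \<in> C"
  shows "supercomm (p + q) r (supercomm p q (supercomm 0 p (\<lambda>v. L (L v)) f) g) h u =
    triple p q f g (h * u) - (-1) ^ ((p + q) * r) *\<^sub>R (h * triple p q f g u)"
proof -
  have "E f g * (h * u) = (-1) ^ ((p + q) * r) *\<^sub>R (h * (E f g * u))"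
    by (rule skew_comm_left[OF H_comm[OF E_H[OF f g] h]])
  then show ?thesis
    unfolding supercomm_def[of "p + q" r]
    by (simp add: supercomm_supercomm_eq[OF f g] u H_C[OF h] C_mult algebra_simps)
qed

end

section \<open>Differential operators in normal form on a superdomain\<close>

locale superdomain = second_order H C I par D S T
  for H :: "nat \<Rightarrow> 'a::real_algebra_1 set" and C :: "'a set"
    and I :: "'i set" and par :: "'i \<Rightarrow> nat" and D :: "'i \<Rightarrow> 'a \<Rightarrow> 'a"
    and S :: "'i \<Rightarrow> 'i \<Rightarrow> 'a" and T :: "'i \<Rightarrow> 'a" +
  fixes e :: 'a and x :: "'i \<Rightarrow> 'a"
  assumes e_H: "e \<in> H 0"
    and e_mult: "f \<in> C \<Longrightarrow> e * f = f"
    and x_H: "a \<in> I \<Longrightarrow> x a \<in> H (par a)"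
    and D_x: "a \<in> I \<Longrightarrow> b \<in> I \<Longrightarrow> D a (x b) = (if a = b then e else 0)"
begin

lemma e_C: "e \<in> C" and x_C: "a \<in> I \<Longrightarrow> x a \<in> C"
  by (blast intro: H_C e_H x_H)+

lemma mult_e: "f \<in> C \<Longrightarrow> f * e = f"
proof -
  assume f: "f \<in> C"
  then obtain u v where uv: "u \<in> H 0" "v \<in> H 1" "f = u + v"
    using C_split by blast
  have "u * e = u" "v * e = v"
    using H_comm[OF uv(1) e_H] H_comm[OF uv(2) e_H] uv by (simp_all add: e_mult H_C)
  then show ?thesis
    by (simp add: uv(3) distrib_right)
qed

lemma D_e: "a \<in> I \<Longrightarrow> D a e = 0"
  using D_mult[of a e 0 e] e_H by (simp add: e_C e_mult mult_e D_C)

lemma L_e: "L e = 0"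
  unfolding L_def by (simp add: D_e D_zero)

lemma D_x_mult: "a \<in> I \<Longrightarrow> b \<in> I \<Longrightarrow> g \<in> C \<Longrightarrow>
    D a (x b * g) = (if a = b then g else 0) + (-1) ^ (par a * par b) *\<^sub>R (x b * D a g)"
  by (simp add: D_mult[OF _ x_H] D_x e_mult)

lemma E_e: "f \<in> C \<Longrightarrow> E f e = 0"
  unfolding E_def by (simp add: L_e L_zero mult_e L_C)

lemma triple_e: "f \<in> C \<Longrightarrow> g \<in> C \<Longrightarrow> triple p q f g e = 0"
  unfolding triple_def by (simp add: E_e mult_e E_C)

text \<open>
  Operators in normal form, homogeneous of order \<open>k\<close> in the derivatives. The Euler-type identity
  \<open>normal_op_euler\<close> recovers the order of such an operator from its commutators with the coordinates.
\<close>

inductive normal_op :: "nat \<Rightarrow> nat \<Rightarrow> ('a \<Rightarrow> 'a) \<Rightarrow> bool" where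
  normal_op_zero: "normal_op s k (\<lambda>g. 0)"
| normal_op_mult: "c \<in> H s \<Longrightarrow> normal_op s 0 (\<lambda>g. c * g)"
| normal_op_D: "normal_op s k Q \<Longrightarrow> a \<in> I \<Longrightarrow> even t = even (s + par a) \<Longrightarrow> normal_op t (Suc k) (\<lambda>g. Q (D a g))"
| normal_op_add: "normal_op s k Q \<Longrightarrow> normal_op s k R \<Longrightarrow> normal_op s k (\<lambda>g. Q g + R g)"
| normal_op_scale: "normal_op s k Q \<Longrightarrow> normal_op s k (\<lambda>g. r *\<^sub>R Q g)"

lemma normal_op_C: "normal_op s k Q \<Longrightarrow> f \<in> C \<Longrightarrow> Q f \<in> C"
  by (induction arbitrary: f rule: normal_op.induct) (auto intro: C_intros)

lemma normal_op_linear: "normal_op s k Q \<Longrightarrow> f \<in> C \<Longrightarrow> g \<in> C \<Longrightarrow>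
    Q (f + g) = Q f + Q g \<and> Q (r *\<^sub>R f) = r *\<^sub>R Q f"
  by (induction arbitrary: f g r rule: normal_op.induct)
    (auto simp: distrib_left D_add D_scale D_C scaleR_add_right algebra_simps)

lemma normal_op_apply_add: "normal_op s k Q \<Longrightarrow> f \<in> C \<Longrightarrow> g \<in> C \<Longrightarrow> Q (f + g) = Q f + Q g"
  and normal_op_apply_scale: "normal_op s k Q \<Longrightarrow> f \<in> C \<Longrightarrow> Q (r *\<^sub>R f) = r *\<^sub>R Q f"
  using normal_op_linear by blast+

lemma normal_op_apply_zero: "normal_op s k Q \<Longrightarrow> Q 0 = 0"
  using normal_op_apply_scale[of s k Q 0 0] C_zero by simp

lemma normal_op_parity: "normal_op s k Q \<Longrightarrow> even s = even t \<Longrightarrow> normal_op t k Q"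
proof (induction arbitrary: t rule: normal_op.induct)
  case (normal_op_mult c s)
  then show ?case by (blast intro: normal_op.normal_op_mult H_cong)
next
  case (normal_op_D s k Q a t')
  then show ?case by (intro normal_op.normal_op_D[OF normal_op_D.hyps(1,2)]) auto
qed (auto intro: normal_op.intros)

lemma normal_op_left_mult: "normal_op s k Q \<Longrightarrow> c \<in> H t \<Longrightarrow> normal_op (t + s) k (\<lambda>g. c * Q g)"
proof (induction rule: normal_op.induct)
  case (normal_op_zero s k)
  then show ?case by (simp add: normal_op.normal_op_zero)
next
  case (normal_op_mult d s)
  then show ?case using normal_op.normal_op_mult[OF H_mult[of c t d s]] by (simp add: mult.assoc)
next
  case (normal_op_D s k Q a u)
  then show ?case by (auto intro: normal_op.normal_op_D[of "t + s"])
next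
  case (normal_op_add s k Q R)
  then show ?case by (simp add: distrib_left normal_op.normal_op_add)
next
  case (normal_op_scale s k Q r)
  then show ?case by (simp add: normal_op.normal_op_scale)
qed

text \<open>Each derivative in the normal form contributes the commutator of \<open>D a\<close> with
  \<open>x b\<close>, which is 0 or the identity. The truncated \<open>k - 1\<close> is 0 both for
  \<open>k = 0\<close> and for \<open>k = 1\<close>; the clause for \<open>k = 0\<close> separates
  the two cases, and in the derivative case it is what makes \<open>Q'\<close> composed with
  \<open>D a\<close> an operator of order 0.\<close>

lemma normal_op_supercomm_x:
  assumes "normal_op s k Q" and b: "b \<in> I"
  shows "\<exists>Q'. normal_op (s + par b) (k - 1) Q' \<and> (k = 0 \<longrightarrow> Q' = (\<lambda>g. 0)) \<and>
    (\<forall>g\<in>C. supercomm s (par b) Q (x b) g = Q' g)"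
  using assms(1)
proof (induction rule: normal_op.induct)
  case (normal_op_zero s k)
  then show ?case by (auto simp: supercomm_def intro!: exI[of _ "\<lambda>g. 0"] normal_op.normal_op_zero)
next
  case (normal_op_mult c s)
  have "c * (x b * g) = (- 1) ^ (s * par b) *\<^sub>R (x b * (c * g))" for g
    by (rule skew_comm_left[OF H_comm[OF normal_op_mult x_H[OF b]]])
  then show ?case by (auto simp: supercomm_def intro!: exI[of _ "\<lambda>g. 0"] normal_op.normal_op_zero)
next
  case (normal_op_D s k Q a t)
  then obtain Q' where Q': "normal_op (s + par b) (k - 1) Q'" "k = 0 \<longrightarrow> Q' = (\<lambda>g. 0)"
    "\<And>g. g \<in> C \<Longrightarrow> supercomm s (par b) Q (x b) g = Q' g" by blast
  let ?R = "\<lambda>g. (if a = b then Q g else 0) + (-1) ^ (par a * par b) *\<^sub>R Q' (D a g)"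
  have par: "even (t + par b) = even (s + par b + par a)" "a = b \<Longrightarrow> even s = even (t + par b)"
    using normal_op_D.hyps(3) by auto
  have "normal_op (t + par b) k (\<lambda>g. Q' (D a g))"
  proof (cases "k = 0")
    case True
    then show ?thesis using Q'(2) by (simp add: normal_op.normal_op_zero)
  next
    case False
    then show ?thesis using normal_op.normal_op_D[OF Q'(1) normal_op_D.hyps(2) par(1)] by simp
  qed
  moreover have "normal_op (t + par b) k (\<lambda>g. if a = b then Q g else 0)"
    using normal_op_parity[OF normal_op_D.hyps(1) par(2)] by (cases "a = b") (auto intro: normal_op.normal_op_zero)
  ultimately have "normal_op (t + par b) k ?R"
    by (intro normal_op.normal_op_add normal_op.normal_op_scale)
  moreover have "supercomm t (par b) (\<lambda>g. Q (D a g)) (x b) g = ?R g" if g: "g \<in> C" for g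
  proof -
    have sg: "(-1::real) ^ (par a * par b + s * par b) = (-1) ^ (t * par b)"
      by (rule minus_one_power_cong) (use normal_op_D.hyps(3) in auto)
    have lin: "Q ((if a = b then g else 0) + (-1) ^ (par a * par b) *\<^sub>R (x b * D a g)) =
      (if a = b then Q g else 0) + (-1) ^ (par a * par b) *\<^sub>R Q (x b * D a g)"
      by (simp add: normal_op_apply_add[OF normal_op_D.hyps(1)] normal_op_apply_scale[OF normal_op_D.hyps(1)]
          normal_op_apply_zero[OF normal_op_D.hyps(1)] g C_intros x_C normal_op_D.hyps(2) b)
    have "Q' (D a g) = supercomm s (par b) Q (x b) (D a g)"
      using Q'(3) D_C normal_op_D.hyps(2) g by simp
    then show ?thesis
      unfolding supercomm_def by (simp add: D_x_mult normal_op_D.hyps(2) b g lin scaleR_diff_right sg flip: power_add)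
  qed
  ultimately show ?case by (intro exI[of _ ?R]) auto
next
  case (normal_op_add s k Q R)
  then obtain Q' R' where "normal_op (s + par b) (k - 1) Q'" "k = 0 \<longrightarrow> Q' = (\<lambda>g. 0)"
    "\<forall>g\<in>C. supercomm s (par b) Q (x b) g = Q' g" "normal_op (s + par b) (k - 1) R'" "k = 0 \<longrightarrow> R' = (\<lambda>g. 0)"
    "\<forall>g\<in>C. supercomm s (par b) R (x b) g = R' g" by blast
  then show ?case
    by (intro exI[of _ "\<lambda>g. Q' g + R' g"]) (auto intro: normal_op.normal_op_add simp: supercomm_def algebra_simps)
next
  case (normal_op_scale s k Q r)
  then obtain Q' where "normal_op (s + par b) (k - 1) Q'" "k = 0 \<longrightarrow> Q' = (\<lambda>g. 0)"
    "\<forall>g\<in>C. supercomm s (par b) Q (x b) g = Q' g" by blast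
  then show ?case
    by (intro exI[of _ "\<lambda>g. r *\<^sub>R Q' g"]) (auto intro: normal_op.normal_op_scale simp: supercomm_def algebra_simps)
qed

text \<open>Commutation with \<open>x a\<close> strips one derivative \<open>D a\<close> and
  composition with \<open>D a\<close> restores it, so each of the \<open>k\<close> derivatives
  reproduces the operator once.\<close>

lemma normal_op_euler: "normal_op s k Q \<Longrightarrow> g \<in> C \<Longrightarrow>
    (\<Sum>a\<in>I. supercomm s (par a) Q (x a) (D a g)) = real k *\<^sub>R Q g"
proof (induction arbitrary: g rule: normal_op.induct)
  case (normal_op_zero s k)
  then show ?case by (simp add: supercomm_def)
next
  case (normal_op_mult c s)
  have "c * (x b * g) = (- 1) ^ (s * par b) *\<^sub>R (x b * (c * g))" if "b \<in> I" for g b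
    by (rule skew_comm_left[OF H_comm[OF normal_op_mult(1) x_H[OF that]]])
  then show ?case by (simp add: supercomm_def)
next
  case (normal_op_D s k Q a t)
  have a: "a \<in> I" and g: "g \<in> C" by fact+
  have eq: "supercomm t (par b) (\<lambda>g. Q (D a g)) (x b) (D b g) =
     (if a = b then Q (D a g) else 0) + supercomm s (par b) Q (x b) (D b (D a g))" if b: "b \<in> I" for b
  proof -
    have sg: "(-1::real) ^ (t * par b + par a * par b) = (-1) ^ (s * par b)"
      by (rule minus_one_power_cong) (use normal_op_D.hyps(3) in auto)
    have lin: "Q ((if a = b then D b g else 0) + (-1) ^ (par a * par b) *\<^sub>R (x b * D a (D b g))) =
      (if a = b then Q (D b g) else 0) + (-1) ^ (par a * par b) *\<^sub>R Q (x b * D a (D b g))"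
      by (simp add: normal_op_apply_add[OF normal_op_D.hyps(1)] normal_op_apply_scale[OF normal_op_D.hyps(1)]
          normal_op_apply_zero[OF normal_op_D.hyps(1)] g C_intros x_C a b)
    have sw: "D a (D b g) = (-1) ^ (par a * par b) *\<^sub>R D b (D a g)"
      by (rule D_comm[OF a b g])
    have "Q (x b * D a (D b g)) = (-1) ^ (par a * par b) *\<^sub>R Q (x b * D b (D a g))"
      "Q (D a (D b g)) = (-1) ^ (par a * par b) *\<^sub>R Q (D b (D a g))"
      by (simp_all add: sw normal_op_apply_scale[OF normal_op_D.hyps(1)] g C_intros x_C a b)
    then show ?thesis
      unfolding supercomm_def using a b g
      by (simp add: D_x_mult D_C lin flip: power_add sg)
  qed
  have "(\<Sum>b\<in>I. supercomm t (par b) (\<lambda>g. Q (D a g)) (x b) (D b g)) =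
     Q (D a g) + (\<Sum>b\<in>I. supercomm s (par b) Q (x b) (D b (D a g)))"
    using a finite_I by (simp add: eq sum.distrib cong: sum.cong)
  also have "\<dots> = real (Suc k) *\<^sub>R Q (D a g)"
    by (simp add: normal_op_D.IH D_C a g scaleR_add_left)
  finally show ?case .
next
  case (normal_op_add s k Q R)
  then have "(\<Sum>a\<in>I. supercomm s (par a) Q (x a) (D a g)) + (\<Sum>a\<in>I. supercomm s (par a) R (x a) (D a g)) =
    real k *\<^sub>R (Q g + R g)" by (simp add: scaleR_add_right)
  then show ?case by (simp add: supercomm_def algebra_simps flip: sum.distrib)
next
  case (normal_op_scale s k Q r)
  then have "r *\<^sub>R (\<Sum>a\<in>I. supercomm s (par a) Q (x a) (D a g)) = real k *\<^sub>R (r *\<^sub>R Q g)" by simp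
  then show ?case by (simp add: supercomm_def scaleR_sum_right scaleR_diff_right mult.commute)
qed

text \<open>The Euler identity multiplies the summand of order \<open>j\<close> by \<open>j\<close>, which eliminates the top summand.\<close>

lemma normal_op_sum_zero:
  assumes "\<And>j. j \<le> k \<Longrightarrow> normal_op s j (Q j)" and "\<And>g. g \<in> C \<Longrightarrow> (\<Sum>j\<le>k. Q j g) = 0"
    and "j \<le> k" "g \<in> C"
  shows "Q j g = 0"
  using assms
proof (induction k arbitrary: Q j g)
  case 0
  then show ?case by simp
next
  case (Suc k)
  have euler: "(\<Sum>j\<le>Suc k. real j *\<^sub>R Q j g) = 0" if g: "g \<in> C" for g
  proof -
    have "(\<Sum>j\<le>Suc k. real j *\<^sub>R Q j g) = (\<Sum>j\<le>Suc k. \<Sum>a\<in>I. supercomm s (par a) (Q j) (x a) (D a g))"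
      by (intro sum.cong refl normal_op_euler[symmetric] g Suc.prems(1)) simp
    also have "\<dots> = (\<Sum>a\<in>I. supercomm s (par a) (\<lambda>g. \<Sum>j\<le>Suc k. Q j g) (x a) (D a g))"
      by (subst sum.swap) (simp only: supercomm_def sum_subtractf sum_distrib_left scaleR_sum_right)
    also have "\<dots> = 0"
      using Suc.prems(2) by (simp add: supercomm_def C_mult x_C D_C g del: sum.atMost_Suc)
    finally show ?thesis .
  qed
  \<comment> \<open>Subtracting \<open>Suc k\<close> times the sum itself leaves the coefficients
    \<open>j - Suc k\<close>, which are nonzero for all \<open>j \<le> k\<close>.\<close>
  have lower: "Q j g = 0" if "j \<le> k" "g \<in> C" for j g
  proof -
    have "(real j - real (Suc k)) *\<^sub>R Q j g = 0"
    proof (rule Suc.IH[of "\<lambda>j g. (real j - real (Suc k)) *\<^sub>R Q j g"])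
      fix g assume g: "g \<in> C"
      have "(\<Sum>j\<le>k. (real j - real (Suc k)) *\<^sub>R Q j g) =
          (\<Sum>j\<le>Suc k. real j *\<^sub>R Q j g) - real (Suc k) *\<^sub>R (\<Sum>j\<le>Suc k. Q j g)"
        by (simp add: scaleR_diff_left sum_subtractf scaleR_sum_right scaleR_add_right)
      also have "\<dots> = 0"
        using euler[OF g] Suc.prems(2)[OF g] by simp
      finally show "(\<Sum>j\<le>k. (real j - real (Suc k)) *\<^sub>R Q j g) = 0" .
    qed (use that Suc.prems(1) in \<open>auto intro: normal_op_scale\<close>)
    then show ?thesis using that by simp
  qed
  show ?case
  proof (cases "j \<le> k")
    case True
    then show ?thesis using lower Suc.prems(4) by blast
  next
    case False
    then have "j = Suc k" using Suc.prems(3) by simp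
    then show ?thesis
      using Suc.prems(2)[OF Suc.prems(4)] lower[OF _ Suc.prems(4)] by simp
  qed
qed

text \<open>\<open>k\<close> is only an upper bound, since the zero operator is normal of every
  order; sums are padded accordingly. Equality is asked on \<open>C\<close> alone, because the
  derivations are controlled only there.\<close>

definition diff_op :: "nat \<Rightarrow> ('a \<Rightarrow> 'a) \<Rightarrow> bool" where
  "diff_op s Q \<longleftrightarrow> (\<exists>k R. (\<forall>j\<le>k. normal_op s j (R j)) \<and> (\<forall>g\<in>C. Q g = (\<Sum>j\<le>k. R j g)))"

lemma diff_op_cong: "diff_op s Q \<Longrightarrow> (\<And>g. g \<in> C \<Longrightarrow> Q g = Q' g) \<Longrightarrow> diff_op s Q'"
  unfolding diff_op_def by auto

lemma diff_op_parity: "diff_op s Q \<Longrightarrow> even s = even t \<Longrightarrow> diff_op t Q"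
proof -
  assume "diff_op s Q" and st: "even s = even t"
  then obtain k R where R: "\<And>j. j \<le> k \<Longrightarrow> normal_op s j (R j)" "\<forall>g\<in>C. Q g = (\<Sum>j\<le>k. R j g)"
    unfolding diff_op_def by blast
  then show "diff_op t Q"
    unfolding diff_op_def by (intro exI[of _ k] exI[of _ R]) (auto intro: normal_op_parity[OF R(1) st])
qed

lemma diff_op_normal_op: "normal_op s k Q \<Longrightarrow> diff_op s Q"
  unfolding diff_op_def
  by (rule exI[of _ k], rule exI[of _ "\<lambda>j. if j = k then Q else (\<lambda>g. 0)"])
    (auto intro: normal_op_zero simp: if_distrib[of "\<lambda>h. h _"] cong: if_cong)

lemma diff_op_zero: "diff_op s (\<lambda>g. 0)"
  by (rule diff_op_normal_op[OF normal_op_zero])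

lemma diff_op_add:
  assumes "diff_op s Q" "diff_op s R" shows "diff_op s (\<lambda>g. Q g + R g)"
proof -
  obtain k Q' where Q': "\<And>j. j \<le> k \<Longrightarrow> normal_op s j (Q' j)" "\<And>g. g \<in> C \<Longrightarrow> Q g = (\<Sum>j\<le>k. Q' j g)"
    using assms(1) unfolding diff_op_def by blast
  obtain l R' where R': "\<And>j. j \<le> l \<Longrightarrow> normal_op s j (R' j)" "\<And>g. g \<in> C \<Longrightarrow> R g = (\<Sum>j\<le>l. R' j g)"
    using assms(2) unfolding diff_op_def by blast
  define Q2 where "Q2 = (\<lambda>j g. if j \<le> k then Q' j g else 0)"
  define R2 where "R2 = (\<lambda>j g. if j \<le> l then R' j g else 0)"
  have "normal_op s j (Q2 j)" "normal_op s j (R2 j)" for j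
    unfolding Q2_def R2_def using Q'(1)[of j] R'(1)[of j] normal_op_zero[of s j]
    by (cases "j \<le> k"; cases "j \<le> l"; simp)+
  moreover have "(\<Sum>j\<le>max k l. Q2 j g) = (\<Sum>j\<le>k. Q' j g)" "(\<Sum>j\<le>max k l. R2 j g) = (\<Sum>j\<le>l. R' j g)" for g
    unfolding Q2_def R2_def by (rule sum.mono_neutral_cong_right; auto)+
  ultimately show ?thesis
    unfolding diff_op_def
    by (intro exI[of _ "max k l"] exI[of _ "\<lambda>j g. Q2 j g + R2 j g"])
      (auto intro: normal_op_add simp: sum.distrib Q'(2) R'(2))
qed

lemma diff_op_scale:
  assumes "diff_op s Q" shows "diff_op s (\<lambda>g. r *\<^sub>R Q g)"
proof -
  obtain k R where R: "\<And>j. j \<le> k \<Longrightarrow> normal_op s j (R j)" "\<And>g. g \<in> C \<Longrightarrow> Q g = (\<Sum>j\<le>k. R j g)"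
    using assms unfolding diff_op_def by blast
  show ?thesis
    unfolding diff_op_def
    by (intro exI[of _ k] exI[of _ "\<lambda>j g. r *\<^sub>R R j g"])
      (auto intro: normal_op_scale R(1) simp: R(2) scaleR_sum_right)
qed

lemma diff_op_sum: "(\<And>i. i \<in> J \<Longrightarrow> diff_op s (Q i)) \<Longrightarrow> diff_op s (\<lambda>g. \<Sum>i\<in>J. Q i g)"
  by (induction J rule: infinite_finite_induct) (auto intro: diff_op_zero diff_op_add)

lemma diff_op_left_mult:
  assumes "diff_op s Q" "c \<in> H t" shows "diff_op (t + s) (\<lambda>g. c * Q g)"
proof -
  obtain k R where R: "\<And>j. j \<le> k \<Longrightarrow> normal_op s j (R j)" "\<And>g. g \<in> C \<Longrightarrow> Q g = (\<Sum>j\<le>k. R j g)"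
    using assms(1) unfolding diff_op_def by blast
  show ?thesis
    unfolding diff_op_def
    by (intro exI[of _ k] exI[of _ "\<lambda>j g. c * R j g"])
      (auto intro: normal_op_left_mult R(1) assms(2) simp: R(2) sum_distrib_left)
qed

text \<open>A derivative from the left also hits the coefficient, so the orders \<open>k\<close> and
  \<open>k + 1\<close> mix and only a sum of different orders can be expected.\<close>

lemma normal_op_left_D: "normal_op s k Q \<Longrightarrow> a \<in> I \<Longrightarrow> diff_op (par a + s) (\<lambda>g. D a (Q g))"
proof (induction rule: normal_op.induct)
  case (normal_op_zero s k)
  then show ?case by (simp add: D_zero diff_op_zero)
next
  case (normal_op_mult c s)
  have "normal_op (par a + s) 1 (\<lambda>g. c * D a g)"
    using normal_op.normal_op_D[OF normal_op.normal_op_mult[OF normal_op_mult.hyps] normal_op_mult.prems, of "par a + s"]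
    by (simp add: add.commute)
  then have "diff_op (par a + s) (\<lambda>g. D a c * g + (-1) ^ (par a * s) *\<^sub>R (c * D a g))"
    by (intro diff_op_add diff_op_scale diff_op_normal_op[OF normal_op.normal_op_mult] D_H normal_op_mult) (rule diff_op_normal_op)
  then show ?case
    by (rule diff_op_cong) (simp add: D_mult[OF normal_op_mult.prems normal_op_mult.hyps])
next
  case (normal_op_D s k Q b t)
  obtain l R where R: "\<And>j. j \<le> l \<Longrightarrow> normal_op (par a + s) j (R j)"
      "\<And>g. g \<in> C \<Longrightarrow> D a (Q g) = (\<Sum>j\<le>l. R j g)"
    using normal_op_D.IH[OF normal_op_D.prems] unfolding diff_op_def by blast
  have "diff_op (par a + t) (\<lambda>g. \<Sum>j\<le>l. R j (D b g))"
    using normal_op_D.hyps by (intro diff_op_sum diff_op_normal_op[OF normal_op.normal_op_D[OF R(1)]]) auto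
  then show ?case
    by (rule diff_op_cong) (simp add: R(2) D_C normal_op_D.hyps)
next
  case (normal_op_add s k Q R)
  then have "diff_op (par a + s) (\<lambda>g. D a (Q g) + D a (R g))"
    by (intro diff_op_add) auto
  then show ?case
    by (rule diff_op_cong) (simp add: D_add normal_op_add normal_op_C[OF normal_op_add.hyps(1)] normal_op_C[OF normal_op_add.hyps(2)])
next
  case (normal_op_scale s k Q r)
  then have "diff_op (par a + s) (\<lambda>g. r *\<^sub>R D a (Q g))"
    by (intro diff_op_scale) auto
  then show ?case
    by (rule diff_op_cong) (simp add: D_scale normal_op_scale normal_op_C[OF normal_op_scale.hyps(1)])
qed

lemma diff_op_left_D:
  assumes "diff_op s Q" "a \<in> I" shows "diff_op (par a + s) (\<lambda>g. D a (Q g))"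
proof -
  obtain k R where R: "\<And>j. j \<le> k \<Longrightarrow> normal_op s j (R j)" "\<And>g. g \<in> C \<Longrightarrow> Q g = (\<Sum>j\<le>k. R j g)"
    using assms(1) unfolding diff_op_def by blast
  have R_C: "R j g \<in> C" if "j \<le> k" "g \<in> C" for j g
    using normal_op_C R(1) that by blast
  have "diff_op (par a + s) (\<lambda>g. \<Sum>j\<le>k. D a (R j g))"
    by (rule diff_op_sum) (rule normal_op_left_D[OF R(1) assms(2)], simp)
  then show ?thesis
    by (rule diff_op_cong) (subst R(2), assumption, subst D_sum[OF assms(2)], auto intro: R_C)
qed

lemma diff_op_L:
  assumes Q: "diff_op s Q" shows "diff_op (s + 1) (\<lambda>g. L (Q g))"
  unfolding L_def
proof (intro diff_op_add diff_op_scale diff_op_sum)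
  fix a assume a: "a \<in> I"
  show "diff_op (s + 1) (\<lambda>g. T a * D a (Q g))"
    by (rule diff_op_parity[OF diff_op_left_mult[OF diff_op_left_D[OF Q a] T_H[OF a]]]) presburger
  fix b assume b: "b \<in> I"
  show "diff_op (s + 1) (\<lambda>g. S a b * D b (D a (Q g)))"
    by (rule diff_op_parity[OF diff_op_left_mult[OF diff_op_left_D[OF diff_op_left_D[OF Q a] b] S_H[OF a b]]])
      presburger
qed

lemma diff_op_LL: "diff_op 0 (\<lambda>g. L (L g))"
proof -
  have "diff_op 0 (\<lambda>g. e * g)"
    by (rule diff_op_normal_op[OF normal_op_mult[OF e_H]])
  then have "diff_op 0 (\<lambda>g. g)"
    by (rule diff_op_cong) (simp add: e_mult)
  from diff_op_L[OF diff_op_L[OF this]] show ?thesis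
    by (rule diff_op_parity) simp
qed

lemma diff_op_supercomm_x:
  assumes "diff_op s Q" and b: "b \<in> I" shows "diff_op (s + par b) (supercomm s (par b) Q (x b))"
proof -
  obtain k R where R: "\<And>j. j \<le> k \<Longrightarrow> normal_op s j (R j)" "\<And>g. g \<in> C \<Longrightarrow> Q g = (\<Sum>j\<le>k. R j g)"
    using assms(1) unfolding diff_op_def by blast
  have "diff_op (s + par b) (supercomm s (par b) (R j) (x b))" if j: "j \<le> k" for j
  proof -
    obtain Q' where "normal_op (s + par b) (j - 1) Q'" "\<forall>g\<in>C. supercomm s (par b) (R j) (x b) g = Q' g"
      using normal_op_supercomm_x[OF R(1)[OF j] b] by blast
    then show ?thesis
      by (auto intro: diff_op_cong[OF diff_op_normal_op])
  qed
  then have "diff_op (s + par b) (\<lambda>g. \<Sum>j\<le>k. supercomm s (par b) (R j) (x b) g)"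
    by (intro diff_op_sum) auto
  then show ?thesis
    by (rule diff_op_cong)
      (simp add: supercomm_def R(2) C_mult x_C b sum_subtractf sum_distrib_left scaleR_sum_right)
qed

text \<open>Summing the Euler identities over all orders turns vanishing commutators into the
  vanishing of each \<open>real j *\<^sub>R R j\<close>. Only the part of order 0 remains, a
  multiplication, and its coefficient is read off at the unit \<open>e\<close>.\<close>

lemma diff_op_mult_op:
  assumes "diff_op s Q" and comm: "\<And>b g. b \<in> I \<Longrightarrow> g \<in> C \<Longrightarrow> supercomm s (par b) Q (x b) g = 0"
    and g: "g \<in> C"
  shows "Q g = Q e * g"
proof -
  obtain k R where R: "\<And>j. j \<le> k \<Longrightarrow> normal_op s j (R j)" "\<And>g. g \<in> C \<Longrightarrow> Q g = (\<Sum>j\<le>k. R j g)"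
    using assms(1) unfolding diff_op_def by blast
  have zero: "real j *\<^sub>R R j g = 0" if "j \<le> k" "g \<in> C" for j g
  proof (rule normal_op_sum_zero[of k s "\<lambda>j g. real j *\<^sub>R R j g"])
    fix g assume g: "g \<in> C"
    have "(\<Sum>j\<le>k. real j *\<^sub>R R j g) = (\<Sum>j\<le>k. \<Sum>a\<in>I. supercomm s (par a) (R j) (x a) (D a g))"
      by (intro sum.cong refl normal_op_euler[symmetric] g R(1)) simp
    also have "\<dots> = (\<Sum>a\<in>I. supercomm s (par a) Q (x a) (D a g))"
      by (subst sum.swap)
        (simp add: supercomm_def sum_subtractf sum_distrib_left scaleR_sum_right R(2) C_mult D_C x_C g)
    also have "\<dots> = 0"
      by (simp add: comm D_C g)
    finally show "(\<Sum>j\<le>k. real j *\<^sub>R R j g) = 0" .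
  qed (use that R(1) in \<open>auto intro: normal_op_scale\<close>)
  have Q0: "Q g = R 0 g" if "g \<in> C" for g
  proof -
    have "(\<Sum>j\<le>k. R j g) = (\<Sum>j\<le>k. if j = 0 then R 0 g else 0)"
      using zero[OF _ that] by (intro sum.cong) auto
    then show ?thesis by (simp add: R(2) that)
  qed
  \<comment> \<open>Order 0 excludes the derivative case, so the induction sees only multiplications
    and their linear combinations.\<close>
  have "\<exists>c\<in>C. \<forall>g\<in>C. Q g = c * g" if "normal_op s k Q" "k = 0" for k Q
    using that
  proof (induction rule: normal_op.induct)
    case (normal_op_zero s k)
    then show ?case by (intro bexI[of _ 0]) (auto simp: C_zero)
  next
    case (normal_op_add s k Q R)
    then obtain c d where "c \<in> C" "\<forall>g\<in>C. Q g = c * g" "d \<in> C" "\<forall>g\<in>C. R g = d * g" by blast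
    then show ?case by (intro bexI[of _ "c + d"]) (auto simp: distrib_right C_add)
  next
    case (normal_op_scale s k Q r)
    then obtain c where "c \<in> C" "\<forall>g\<in>C. Q g = c * g" by blast
    then show ?case by (intro bexI[of _ "r *\<^sub>R c"]) (auto simp: C_scale)
  qed (auto intro: H_C)
  then obtain c where c: "c \<in> C" "\<And>g. g \<in> C \<Longrightarrow> R 0 g = c * g"
    using R(1)[of 0] by blast
  then show ?thesis
    by (simp add: Q0 g e_C mult_e)
qed

text \<open>\<open>diff_op_mult_op\<close> is applied twice: to the commutator of the square with
  one coordinate, and to the square minus a vector field. The outcome is that the square is this
  vector field, and for a vector field \<open>E\<close> vanishes by the Leibniz rule.\<close>

theorem E_eq_zero:
  assumes E0: "\<And>a b. a \<in> I \<Longrightarrow> b \<in> I \<Longrightarrow> E (x a) (x b) = 0"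
    and P0: "\<And>a b r g. a \<in> I \<Longrightarrow> b \<in> I \<Longrightarrow> g \<in> H r \<Longrightarrow> triple (par a) (par b) (x a) (x b) g = 0"
    and f: "f \<in> H p" and g: "g \<in> C"
  shows "E f g = 0"
proof -
  let ?F = "\<lambda>v. L (L v)"
  have FC: "?F v \<in> C" if "v \<in> C" for v
    by (intro L_C that)
  have FH: "?F v \<in> H r" if "v \<in> H r" for v r
    by (rule H_cong[OF L_H[OF L_H[OF that]]]) simp
  have P0': "triple (par a) (par b) (x a) (x b) v = 0" if ab: "a \<in> I" "b \<in> I" and "v \<in> C" for a b v
  proof -
    obtain u w where "u \<in> H 0" "w \<in> H 1" "v = u + w"
      using C_split \<open>v \<in> C\<close> by blast
    then show ?thesis
      using P0[OF ab] ab by (simp add: triple_add x_C H_C)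
  qed
  \<comment> \<open>The commutators of this operator with the coordinates vanish, so it is
    multiplication by its value at \<open>e\<close>, which is \<open>?F (x a)\<close> because
    \<open>L e = 0\<close>.\<close>
  have G: "supercomm 0 (par a) ?F (x a) v = ?F (x a) * v" if a: "a \<in> I" and v: "v \<in> C" for a v
  proof -
    have "supercomm 0 (par a) ?F (x a) v = supercomm 0 (par a) ?F (x a) e * v"
    proof (rule diff_op_mult_op[OF _ _ v])
      show "diff_op (par a) (supercomm 0 (par a) ?F (x a))"
        using diff_op_supercomm_x[OF diff_op_LL a] by simp
      show "supercomm (par a) (par b) (supercomm 0 (par a) ?F (x a)) (x b) g = 0" if "b \<in> I" "g \<in> C" for b g
        using supercomm_supercomm_eq[OF x_H[OF a] x_H[OF that(1)] that(2)] P0'[OF a that] E0[OF a that(1)]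
        by simp
    qed
    also have "supercomm 0 (par a) ?F (x a) e = ?F (x a)"
      by (simp add: supercomm_def L_e L_zero mult_e x_C a)
    finally show ?thesis .
  qed
  \<comment> \<open>The subtracted vector field agrees with the square on every coordinate. By
    \<open>G\<close> the difference commutes with the coordinates, and it kills the unit.\<close>
  let ?R = "\<lambda>v. ?F v - (\<Sum>a\<in>I. ?F (x a) * D a v)"
  have R: "?R v = ?R e * v" if v: "v \<in> C" for v
  proof (rule diff_op_mult_op[OF _ _ v])
    have "diff_op 0 (\<lambda>v. \<Sum>a\<in>I. ?F (x a) * D a v)"
      by (rule diff_op_sum) (rule diff_op_normal_op[OF normal_op_D[OF normal_op_mult[OF FH[OF x_H]]]], auto)
    from diff_op_add[OF diff_op_LL diff_op_scale[OF this, of "-1"]] show "diff_op 0 ?R"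
      by simp
    fix b g assume b: "b \<in> I" and g: "g \<in> C"
    have "(\<Sum>a\<in>I. ?F (x a) * D a (x b * g)) = ?F (x b) * g + x b * (\<Sum>a\<in>I. ?F (x a) * D a g)"
    proof -
      have "?F (x a) * D a (x b * g) = (if a = b then ?F (x b) * g else 0) + x b * (?F (x a) * D a g)"
        if a: "a \<in> I" for a
        using skew_comm_left[OF H_comm[OF FH[OF x_H[OF a]] x_H[OF b]], of "D a g"]
        by (simp add: D_x_mult a b g distrib_left flip: power_add)
      then show ?thesis
        using b finite_I by (simp add: sum.distrib sum_distrib_left cong: sum.cong)
    qed
    then show "supercomm 0 (par b) ?R (x b) g = 0"
      using G[OF b g] unfolding supercomm_def by (simp add: algebra_simps)
  qed
  have F: "?F v = (\<Sum>a\<in>I. ?F (x a) * D a v)" if "v \<in> C" for v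
    using R[OF that] by (simp add: L_e L_zero D_e)
  have "?F (x a) * D a (f * g) = ?F (x a) * D a f * g + f * (?F (x a) * D a g)" if a: "a \<in> I" for a
    using skew_comm_left[OF H_comm[OF FH[OF x_H[OF a]] f], of "D a g"]
    by (simp add: D_mult[OF a f g] distrib_left mult.assoc flip: power_add)
  then show ?thesis
    unfolding E_def F[OF C_mult[OF H_C[OF f] g]] F[OF H_C[OF f]] F[OF g]
    by (simp add: sum.distrib sum_distrib_left sum_distrib_right)
qed

end

section \<open>The symbol calculus on the cotangent algebra\<close>

lemma eq_minus_self_imp_zero:
  fixes v :: "'a::real_vector"
  assumes "v = - v" shows "v = 0"
proof -
  have "2 *\<^sub>R v = 0"
    unfolding scaleR_2 using assms by (simp add: add_eq_0_iff)
  then show ?thesis by simp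
qed

text \<open>All functions live on the cotangent bundle: \<open>D\<close> are the position
  derivatives, \<open>P\<close> the momentum derivatives, \<open>y\<close> the momenta.
  \<open>S\<close>, \<open>T\<close> and \<open>x\<close> come from the base, whence
  \<open>P_S\<close>, \<open>P_T\<close> and \<open>P_x\<close>. The operator \<open>L\<close> of
  this instance treats the momenta as constants.\<close>

locale cotangent_superdomain =
  superdomain H C I par D S T e x + P: super_differential H C I par P
  for H :: "nat \<Rightarrow> 'a::real_algebra_1 set" and C :: "'a set"
    and I :: "'i set" and par :: "'i \<Rightarrow> nat" and D :: "'i \<Rightarrow> 'a \<Rightarrow> 'a"
    and S :: "'i \<Rightarrow> 'i \<Rightarrow> 'a" and T :: "'i \<Rightarrow> 'a" and e :: 'a and x :: "'i \<Rightarrow> 'a"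
    and P :: "'i \<Rightarrow> 'a \<Rightarrow> 'a" +
  fixes y :: "'i \<Rightarrow> 'a"
  assumes PD_comm: "a \<in> I \<Longrightarrow> b \<in> I \<Longrightarrow> f \<in> C \<Longrightarrow>
      P a (D b f) = (-1) ^ (par a * par b) *\<^sub>R D b (P a f)"
    and y_H: "a \<in> I \<Longrightarrow> y a \<in> H (par a)"
    and P_y: "a \<in> I \<Longrightarrow> b \<in> I \<Longrightarrow> P a (y b) = (if a = b then e else 0)"
    and D_y: "a \<in> I \<Longrightarrow> b \<in> I \<Longrightarrow> D a (y b) = 0"
    and P_x: "a \<in> I \<Longrightarrow> b \<in> I \<Longrightarrow> P a (x b) = 0"
    and P_S: "a \<in> I \<Longrightarrow> b \<in> I \<Longrightarrow> c \<in> I \<Longrightarrow> P c (S a b) = 0"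
    and P_T: "a \<in> I \<Longrightarrow> c \<in> I \<Longrightarrow> P c (T a) = 0"
begin

lemma y_C: "a \<in> I \<Longrightarrow> y a \<in> C"
  by (blast intro: H_C y_H)

lemma P_y_mult: "a \<in> I \<Longrightarrow> b \<in> I \<Longrightarrow> g \<in> C \<Longrightarrow>
    P a (y b * g) = (if a = b then g else 0) + (-1) ^ (par a * par b) *\<^sub>R (y b * P a g)"
  by (simp add: P.D_mult[OF _ y_H] P_y e_mult)

lemma y_comm: "a \<in> I \<Longrightarrow> f \<in> H r \<Longrightarrow> y a * f = (-1) ^ (par a * r) *\<^sub>R (f * y a)"
  by (rule H_comm[OF y_H])

lemma D_mult_y: "a \<in> I \<Longrightarrow> b \<in> I \<Longrightarrow> f \<in> H r \<Longrightarrow> D a (f * y b) = D a f * y b"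
  by (simp add: D_mult y_C D_y)

lemma D_yy: "a \<in> I \<Longrightarrow> b \<in> I \<Longrightarrow> c \<in> I \<Longrightarrow> D a (y b * y c) = 0"
  by (simp add: D_mult_y[OF _ _ y_H] D_y)

lemma D_mult_yy: "a \<in> I \<Longrightarrow> b \<in> I \<Longrightarrow> c \<in> I \<Longrightarrow> f \<in> H r \<Longrightarrow>
    D a (f * (y b * y c)) = D a f * (y b * y c)"
  by (simp add: D_mult y_C C_mult D_yy)

definition quad :: "('i \<Rightarrow> 'i \<Rightarrow> 'a) \<Rightarrow> 'a" where
  "quad F = (\<Sum>a\<in>I. \<Sum>b\<in>I. F a b * (y b * y a))"

definition lin :: "('i \<Rightarrow> 'a) \<Rightarrow> 'a" where
  "lin F = (\<Sum>a\<in>I. F a * y a)"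

lemma yy_H: "a \<in> I \<Longrightarrow> b \<in> I \<Longrightarrow> y b * y a \<in> H (par b + par a)"
  by (intro H_mult y_H)

lemma quad_H:
  assumes "\<And>a b. a \<in> I \<Longrightarrow> b \<in> I \<Longrightarrow> F a b \<in> H (par a + par b + s)"
  shows "quad F \<in> H s"
  unfolding quad_def
proof (intro H_sum)
  fix a b assume ab: "a \<in> I" "b \<in> I"
  show "F a b * (y b * y a) \<in> H s"
    by (rule H_cong[OF H_mult[OF assms[OF ab] yy_H[OF ab]]]) presburger
qed

lemma lin_H:
  assumes "\<And>a. a \<in> I \<Longrightarrow> F a \<in> H (par a + s)"
  shows "lin F \<in> H s"
  unfolding lin_def
proof (intro H_sum)
  fix a assume a: "a \<in> I"
  show "F a * y a \<in> H s"
    by (rule H_cong[OF H_mult[OF assms[OF a] y_H[OF a]]]) presburger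
qed

lemma P_lin:
  assumes F: "\<And>a. a \<in> I \<Longrightarrow> F a \<in> H (r a)" and PF: "\<And>a. a \<in> I \<Longrightarrow> P c (F a) = 0"
    and c: "c \<in> I"
  shows "P c (lin F) = (-1) ^ (par c * r c) *\<^sub>R F c"
proof -
  have FC: "F a \<in> C" if "a \<in> I" for a using F that by (blast intro: H_C)
  have "P c (F a * y a) = (if c = a then (-1) ^ (par c * r c) *\<^sub>R F c else 0)" if a: "a \<in> I" for a
    using a c by (simp add: P.D_mult[OF c F[OF a] y_C[OF a]] PF P_y mult_e FC)
  then show ?thesis
    unfolding lin_def using c finite_I
    by (simp add: P.D_sum C_mult FC y_C cong: sum.cong)
qed

text \<open>The derivative may hit either momentum, and graded symmetry makes both contributions
  equal, hence the 2. The sign comes from passing the coefficient; it reduces to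
  \<open>par c * (s + 1)\<close> because \<open>par c * par c\<close> has the parity of
  \<open>par c\<close>.\<close>

lemma P_quad:
  assumes F: "\<And>a b. a \<in> I \<Longrightarrow> b \<in> I \<Longrightarrow> F a b \<in> H (par a + par b + s)"
    and sym: "\<And>a b. a \<in> I \<Longrightarrow> b \<in> I \<Longrightarrow> F a b = (-1) ^ (par a * par b) *\<^sub>R F b a"
    and PF: "\<And>a b. a \<in> I \<Longrightarrow> b \<in> I \<Longrightarrow> P c (F a b) = 0"
    and c: "c \<in> I"
  shows "P c (quad F) = (2 * (-1) ^ (par c * (s + 1))) *\<^sub>R lin (F c)"
proof -
  have FC: "F a b \<in> C" if "a \<in> I" "b \<in> I" for a b using F that by (blast intro: H_C)
  let ?s = "(-1::real) ^ (par c * (s + 1))"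
  have *: "P c (F a b * (y b * y a)) =
     (if c = b then ?s *\<^sub>R (F c a * y a) else 0) + (if c = a then ?s *\<^sub>R (F c b * y b) else 0)"
    if ab: "a \<in> I" "b \<in> I" for a b
  proof -
    have "P c (y b * y a) = (if c = b then y a else 0) + (-1) ^ (par c * par b) *\<^sub>R (if c = a then y b else 0)"
      using ab c by (simp add: P_y_mult y_C P_y mult_e)
    then have eq: "P c (F a b * (y b * y a)) = (-1) ^ (par c * (par a + par b + s)) *\<^sub>R
      (F a b * ((if c = b then y a else 0) + (-1) ^ (par c * par b) *\<^sub>R (if c = a then y b else 0)))"
      by (simp add: P.D_mult[OF c F[OF ab]] C_mult y_C ab PF)
    have s1: "(-1::real) ^ (par c * (par a + par c + s)) * (-1) ^ (par a * par c) = ?s"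
      unfolding power_add[symmetric] by (rule minus_one_power_cong) auto
    have s2: "(-1::real) ^ (par c * (par c + par b + s)) * (-1) ^ (par c * par b) = ?s"
      unfolding power_add[symmetric] by (rule minus_one_power_cong) auto
    have A1: "(-1) ^ (par c * (par a + par c + s)) *\<^sub>R (F a c * v) = ?s *\<^sub>R (F c a * v)" for v
      by (simp only: sym[OF ab(1) c] mult_scaleR_left scaleR_scaleR s1)
    have "(-1) ^ (par c * (par c + par b + s)) *\<^sub>R ((-1) ^ (par c * par b) *\<^sub>R v) = ?s *\<^sub>R v" for v :: 'a
      by (simp only: scaleR_scaleR s2)
    then have "(-1) ^ (par c * (par a + par b + s)) *\<^sub>R
        (F a b * ((-1) ^ (par c * par b) *\<^sub>R (if c = a then y b else 0))) =
        (if c = a then ?s *\<^sub>R (F c b * y b) else 0)"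
      by (cases "c = a") simp_all
    moreover have "(-1) ^ (par c * (par a + par b + s)) *\<^sub>R (F a b * (if c = b then y a else 0)) =
        (if c = b then ?s *\<^sub>R (F c a * y a) else 0)"
      using A1[of "y a"] by (cases "c = b") auto
    ultimately show ?thesis
      unfolding eq distrib_left scaleR_add_right by (rule arg_cong2[of _ _ _ _ "(+)", rotated])
  qed
  have "P c (quad F) = (\<Sum>a\<in>I. \<Sum>b\<in>I. P c (F a b * (y b * y a)))"
    unfolding quad_def by (simp add: P.D_sum C_sum C_mult FC y_C c)
  also have "\<dots> = (\<Sum>a\<in>I. ?s *\<^sub>R (F c a * y a)) + (\<Sum>b\<in>I. ?s *\<^sub>R (F c b * y b))"
  proof -
    have "(\<Sum>a\<in>I. \<Sum>b\<in>I. if c = a then ?s *\<^sub>R (F c b * y b) else 0) = (\<Sum>b\<in>I. ?s *\<^sub>R (F c b * y b))"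
      using c finite_I by (subst sum.swap) simp
    then show ?thesis
      using c finite_I by (simp add: * sum.distrib cong: sum.cong)
  qed
  also have "\<dots> = (2 * ?s) *\<^sub>R lin (F c)"
    unfolding lin_def by (simp add: scaleR_sum_right flip: scaleR_2)
  finally show ?thesis .
qed

text \<open>Two momentum derivatives recover each coefficient. Graded symmetry enters because a
  quadratic form determines only the symmetric part of its coefficients.\<close>

lemma quad_eq_zero:
  assumes F: "\<And>a b. a \<in> I \<Longrightarrow> b \<in> I \<Longrightarrow> F a b \<in> H (par a + par b + s)"
    and sym: "\<And>a b. a \<in> I \<Longrightarrow> b \<in> I \<Longrightarrow> F a b = (-1) ^ (par a * par b) *\<^sub>R F b a"
    and PF: "\<And>a b c. a \<in> I \<Longrightarrow> b \<in> I \<Longrightarrow> c \<in> I \<Longrightarrow> P c (F a b) = 0"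
    and zero: "quad F = 0" and c: "c \<in> I" and d: "d \<in> I"
  shows "F c d = 0"
proof -
  have "(2 * (-1) ^ (par c * (s + 1))) *\<^sub>R lin (F c) = 0"
    using P_quad[OF F sym PF c] zero c by (simp add: P.D_zero)
  then have "lin (F c) = 0" by simp
  then show ?thesis
    using P_lin[of "F c" "\<lambda>a. par c + par a + s" d] F PF c d by (simp add: P.D_zero)
qed

lemma D_quad:
  assumes "\<And>a b. a \<in> I \<Longrightarrow> b \<in> I \<Longrightarrow> F a b \<in> H (r a b)" and "c \<in> I"
  shows "D c (quad F) = quad (\<lambda>a b. D c (F a b))"
  unfolding quad_def using assms
  by (simp add: D_sum C_sum C_mult y_C H_C[OF assms(1)] D_mult_yy[OF _ _ _ assms(1)])

lemma D_lin:
  assumes "\<And>a. a \<in> I \<Longrightarrow> F a \<in> H (r a)" and "c \<in> I"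
  shows "D c (lin F) = lin (\<lambda>a. D c (F a))"
  unfolding lin_def using assms
  by (simp add: D_sum C_mult y_C H_C[OF assms(1)] D_mult_y[OF _ _ assms(1)])

definition symb :: 'a where "symb = (1/2) *\<^sub>R quad S"
definition first_symb :: 'a where "first_symb = lin T"
definition conn :: 'a where "conn = lin (\<lambda>a. (\<Sum>b\<in>I. D b (S b a)) - 2 *\<^sub>R T a)"
text \<open>The signs of the canonical bracket evaluated for an odd first argument: for
  \<open>q = 1\<close> the sign \<open>(-1) ^ (par a * (q + 1))\<close> is 1 and
  \<open>(-1) ^ (par a * q)\<close> is \<open>(-1) ^ par a\<close>.\<close>

definition pois :: "'a \<Rightarrow> 'a \<Rightarrow> 'a" where
  "pois f g = (\<Sum>a\<in>I. P a f * D a g) - (\<Sum>a\<in>I. (-1) ^ par a *\<^sub>R (D a f * P a g))"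

lemma symb_H: "symb \<in> H 1"
  unfolding symb_def by (intro H_scale quad_H S_H)

lemma first_symb_H: "first_symb \<in> H 1"
  unfolding first_symb_def by (intro lin_H T_H)

lemma P_symb: "c \<in> I \<Longrightarrow> P c symb = lin (S c)"
  unfolding symb_def using P_quad[OF S_H S_sym P_S]
  by (simp add: P.D_scale H_C[OF quad_H[OF S_H]])

lemma P_first_symb: "c \<in> I \<Longrightarrow> P c first_symb = T c"
  unfolding first_symb_def by (subst P_lin[OF T_H P_T]) auto

lemma linS_H: "c \<in> I \<Longrightarrow> lin (S c) \<in> H (par c + 1)"
  by (intro lin_H H_cong[OF S_H]) auto

lemma P_linS:
  assumes c: "c \<in> I" and b: "b \<in> I" shows "P b (lin (S c)) = S b c"
proof -
  have "P b (lin (S c)) = (-1) ^ (par b * (par c + par b + 1)) *\<^sub>R S c b"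
    by (rule P_lin) (use S_H P_S b c in auto)
  also have "(-1::real) ^ (par b * (par c + par b + 1)) = (-1) ^ (par b * par c)"
    by (rule minus_one_power_cong) auto
  finally show ?thesis
    using S_sym[OF b c] by simp
qed

text \<open>The divergence of \<open>symb\<close>: by \<open>P_symb\<close> this is the sum of
  \<open>D b (P b symb)\<close>. It is the part of the connection that comes from
  \<open>S\<close>.\<close>

definition del :: 'a where "del = (\<Sum>b\<in>I. D b (lin (S b)))"

lemma del_H: "del \<in> H 1"
  unfolding del_def by (intro H_sum H_cong[OF D_H[OF _ linS_H]]) auto

lemma conn_eq: "conn = del - 2 *\<^sub>R first_symb"
proof -
  have "del = (\<Sum>b\<in>I. \<Sum>a\<in>I. D b (S b a) * y a)"
    unfolding del_def by (rule sum.cong[OF refl]) (simp add: D_lin[OF S_H], simp add: lin_def)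
  also have "\<dots> = lin (\<lambda>a. \<Sum>b\<in>I. D b (S b a))"
    unfolding lin_def by (subst sum.swap) (simp add: sum_distrib_right)
  finally show ?thesis
    unfolding conn_def first_symb_def lin_def by (simp add: left_diff_distrib sum_subtractf scaleR_sum_right)
qed

lemma P_del: "c \<in> I \<Longrightarrow> P c del = (\<Sum>b\<in>I. D b (S b c))"
proof -
  assume c: "c \<in> I"
  have "P c (D b (lin (S b))) = D b (S b c)" if b: "b \<in> I" for b
  proof -
    have "P c (D b (lin (S b))) = (-1) ^ (par c * par b) *\<^sub>R D b (S c b)"
      using b c by (simp add: PD_comm H_C[OF linS_H] P_linS)
    also have "D b (S c b) = (-1) ^ (par c * par b) *\<^sub>R D b (S b c)"
      using b c by (simp add: S_sym[of c b] D_scale S_C)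
    finally show ?thesis by (simp flip: power_add)
  qed
  then show ?thesis
    unfolding del_def by (simp add: P.D_sum D_C H_C[OF linS_H] c)
qed

text \<open>For odd \<open>f\<close> the factors \<open>P a f\<close> and \<open>D a symb\<close>
  both have parity \<open>par a + 1\<close>, so exchanging them absorbs the sign of the second sum.
  For \<open>f = symb\<close> the two sums on the right coincide.\<close>

lemma pois_symb:
  assumes "f \<in> H 1"
  shows "pois symb f = (\<Sum>a\<in>I. lin (S a) * D a f) + (\<Sum>a\<in>I. P a f * D a symb)"
proof -
  have "P a f * D a symb = - ((-1) ^ par a *\<^sub>R (D a symb * P a f))" if a: "a \<in> I" for a
  proof -
    have "P a f * D a symb = (-1) ^ ((par a + 1) * (par a + 1)) *\<^sub>R (D a symb * P a f)"
      by (rule H_comm[OF P.D_H[OF a assms] D_H[OF a symb_H]])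
    then show ?thesis by (cases "even (par a)") auto
  qed
  then show ?thesis
    unfolding pois_def by (simp add: P_symb sum_negf cong: sum.cong)
qed

text \<open>
  \<open>master\<close> is half of \<open>(S, S)\<close>; the second order part of the square of the operator appears when the
  divergence operator \<open>\<Sum>\<^sub>b D\<^sub>b P\<^sub>b\<close> is applied to it.
\<close>

definition master :: 'a where "master = (\<Sum>a\<in>I. lin (S a) * D a symb)"

text \<open>Both derivatives on the first factor, or both on the second, add up to
  \<open>pois symb del\<close>; \<open>P b\<close> on the first and \<open>D b\<close> on the second
  give the second order sum; the remaining mixed term \<open>?X\<close> cancels in itself.\<close>

lemma divergence_master:
  "(\<Sum>b\<in>I. D b (P b master)) = (\<Sum>a\<in>I. \<Sum>b\<in>I. S a b * D b (D a symb)) + pois symb del"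
proof -
  have SyC: "symb \<in> C" by (rule H_C[OF symb_H])
  have lC: "lin (S a) \<in> C" if "a \<in> I" for a by (rule H_C[OF linS_H[OF that]])
  have eq: "D b (P b (lin (S a) * D a symb)) =
      D b (S b a) * D a symb + S a b * D b (D a symb)
      + (-1) ^ par b *\<^sub>R (D b (lin (S a)) * D a (lin (S b))) + lin (S a) * D a (D b (lin (S b)))"
    if a: "a \<in> I" and b: "b \<in> I" for a b
  proof -
    have 1: "P b (lin (S a) * D a symb) = S b a * D a symb
        + (-1) ^ (par b * (par a + 1) + par b * par a) *\<^sub>R (lin (S a) * D a (lin (S b)))"
      by (simp add: P.D_mult[OF b linS_H[OF a]] D_C SyC a b P_linS PD_comm P_symb power_add)
    have 2: "(-1::real) ^ (par b * (par a + 1) + par b * par a) = (-1) ^ par b"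
      by (rule minus_one_power_cong) auto
    have 3: "D b (S b a * D a symb) = D b (S b a) * D a symb + S a b * D b (D a symb)"
      using S_sym[OF a b] D_mult[OF b S_H[OF b a] D_C[OF a SyC]]
      by (auto simp: minus_one_power_iff)
    have 4: "D b (lin (S a) * D a (lin (S b))) = D b (lin (S a)) * D a (lin (S b))
        + (-1) ^ (par b * (par a + 1)) *\<^sub>R (lin (S a) * D b (D a (lin (S b))))"
      by (rule D_mult[OF b linS_H[OF a] D_C[OF a lC[OF b]]])
    have 5: "D b (D a (lin (S b))) = (-1) ^ (par b * par a) *\<^sub>R D a (D b (lin (S b)))"
      by (rule D_comm[OF b a lC[OF b]])
    show ?thesis
      unfolding 1 2 using a b
      by (simp add: D_add D_scale C_mult C_scale S_C D_C SyC lC 3 4 5)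
        (auto simp: minus_one_power_iff)
  qed
  let ?X = "\<Sum>a\<in>I. \<Sum>b\<in>I. (-1) ^ par b *\<^sub>R (D b (lin (S a)) * D a (lin (S b)))"
  \<comment> \<open>Both factors have parity \<open>par a + par b + 1\<close>. Exchanging them
    replaces the weight \<open>(-1) ^ par b\<close> by minus \<open>(-1) ^ par a\<close>, and
    renaming the indices gives back the negative of the sum.\<close>
  have "?X = - ?X"
  proof -
    have "(-1) ^ par b *\<^sub>R (D b (lin (S a)) * D a (lin (S b))) =
        - ((-1) ^ par a *\<^sub>R (D a (lin (S b)) * D b (lin (S a))))" if a: "a \<in> I" and b: "b \<in> I" for a b
    proof -
      have "D b (lin (S a)) * D a (lin (S b)) =
          (-1) ^ ((par b + (par a + 1)) * (par a + (par b + 1))) *\<^sub>R (D a (lin (S b)) * D b (lin (S a)))"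
        by (rule H_comm[OF D_H[OF b linS_H[OF a]] D_H[OF a linS_H[OF b]]])
      then show ?thesis by (auto simp: minus_one_power_iff)
    qed
    then have "?X = (\<Sum>a\<in>I. \<Sum>b\<in>I. - ((-1) ^ par a *\<^sub>R (D a (lin (S b)) * D b (lin (S a)))))"
      by (intro sum.cong refl)
    also have "\<dots> = - ?X"
      by (subst sum.swap) (simp add: sum_negf)
    finally show ?thesis .
  qed
  then have X0: "?X = 0" by (rule eq_minus_self_imp_zero)
  have D_del: "D a del = (\<Sum>b\<in>I. D a (D b (lin (S b))))" if "a \<in> I" for a
    unfolding del_def by (simp add: D_sum D_C lC that)
  have "(\<Sum>b\<in>I. D b (P b master)) = (\<Sum>b\<in>I. \<Sum>a\<in>I. D b (P b (lin (S a) * D a symb)))"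
    unfolding master_def
    by (intro sum.cong refl) (simp add: P.D_sum D_sum P.D_C C_mult lC D_C SyC)
  also have "\<dots> = (\<Sum>a\<in>I. \<Sum>b\<in>I. D b (P b (lin (S a) * D a symb)))"
    by (rule sum.swap)
  also have "\<dots> = (\<Sum>a\<in>I. P a del * D a symb) + (\<Sum>a\<in>I. \<Sum>b\<in>I. S a b * D b (D a symb)) + ?X
      + (\<Sum>a\<in>I. lin (S a) * D a del)"
    by (simp add: eq sum.distrib P_del D_del sum_distrib_right sum_distrib_left cong: sum.cong)
  finally show ?thesis
    unfolding pois_symb[OF del_H] X0 by simp
qed

section \<open>Contracting brackets of coordinates with momenta\<close>

lemma br_x:
  assumes c: "c \<in> I" and f: "f \<in> H r"
  shows "br r f (x c) = (\<Sum>d\<in>I. (-1) ^ (par c * r) *\<^sub>R (S c d * D d f))"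
proof -
  have "(-1) ^ (par a * r) *\<^sub>R (S a b * D b f * D a (x c)) =
     (if a = c then (-1) ^ (par c * r) *\<^sub>R (S c b * D b f) else 0)" if "a \<in> I" "b \<in> I" for a b
    using that c f by (simp add: D_x mult_e C_mult S_C D_C H_C[OF f])
  then show ?thesis
    unfolding br_eq[OF f x_C[OF c]]
    using c finite_I by (subst sum.swap) (simp cong: sum.cong)
qed

lemma br_x_x: "a \<in> I \<Longrightarrow> b \<in> I \<Longrightarrow> br (par a) (x a) (x b) = S a b"
proof -
  assume ab: "a \<in> I" "b \<in> I"
  have "br (par a) (x a) (x b) = (\<Sum>d\<in>I. if d = a then (-1) ^ (par b * par a) *\<^sub>R S b a else 0)"
    unfolding br_x[OF ab(2) x_H[OF ab(1)]]
    by (intro sum.cong refl) (simp add: D_x ab mult_e S_C)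
  also have "\<dots> = S a b"
    using ab finite_I S_sym[OF ab] by (simp add: mult.commute)
  finally show ?thesis .
qed

lemma L_x: "a \<in> I \<Longrightarrow> L (x a) = T a"
proof -
  assume a: "a \<in> I"
  have "D b (D c (x a)) = 0" if "b \<in> I" "c \<in> I" for b c
    using that a by (simp add: D_x D_e D_zero)
  moreover have "T c * D c (x a) = (if c = a then T a else 0)" if "c \<in> I" for c
    using that a by (simp add: D_x mult_e T_C)
  ultimately show ?thesis
    unfolding L_def using a finite_I by (simp cong: sum.cong)
qed

lemma y_swap: "a \<in> I \<Longrightarrow> b \<in> I \<Longrightarrow> (-1) ^ (par a * par b) *\<^sub>R (y b * y a) = y a * y b"
  using y_comm[OF _ y_H, of a b] by simp

text \<open>Summed over \<open>c\<close>, the right-hand side becomes the sum of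
  \<open>lin (S d) * (D d f * z)\<close>: \<open>f\<close> is differentiated along the position part
  of the Hamiltonian vector field of \<open>symb\<close>. The factor \<open>z\<close> carries the
  momenta contracted with the indices of \<open>f\<close>.\<close>

lemma contract_br:
  assumes c: "c \<in> I" and f: "f \<in> H r" and z: "z \<in> C"
  shows "br r f (x c) * (y c * z) = (\<Sum>d\<in>I. S d c * (y c * (D d f * z)))"
  unfolding br_x[OF c f] sum_distrib_right
proof (intro sum.cong refl)
  fix d assume d: "d \<in> I"
  have "y c * (D d f * z) = (-1) ^ (par c * (par d + r)) *\<^sub>R (D d f * (y c * z))"
    by (rule skew_comm_left[OF y_comm[OF c D_H[OF d f]]])
  then show "(- 1) ^ (par c * r) *\<^sub>R (S c d * D d f) * (y c * z) = S d c * (y c * (D d f * z))"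
    using S_sym[OF d c] by (auto simp: mult.assoc minus_one_power_iff)
qed

text \<open>The signs of the cyclic terms are those of permuting the momenta, so after renaming
  indices the three terms agree. Each is the sum of \<open>lin (S d) * D d (quad S)\<close>, and
  \<open>quad S\<close> is twice \<open>symb\<close>; hence 6 as 3 times 2.\<close>

lemma jac_contract:
  "(\<Sum>a\<in>I. \<Sum>b\<in>I. \<Sum>c\<in>I.
      jac (par a) (par b) (par c) (x a) (x b) (x c) * (y c * (y b * y a))) = 6 *\<^sub>R master"
proof -
  define t where "t a b c = br (par a + par b + 1) (S a b) (x c) * (y c * (y b * y a))" for a b c
  have "jac (par a) (par b) (par c) (x a) (x b) (x c) * (y c * (y b * y a)) = t a b c + t a c b + t b c a"
    if abc: "a \<in> I" "b \<in> I" "c \<in> I" for a b c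
  proof -
    have 1: "(-1) ^ (par b * par c) *\<^sub>R (y c * (y b * y a)) = y b * (y c * y a)"
      using y_swap[OF abc(2,3)] by (metis mult.assoc mult_scaleR_left)
    have "(y c * y b) * y a = (-1) ^ ((par c + par b) * par a) *\<^sub>R (y a * (y c * y b))"
      by (rule H_comm[OF yy_H[OF abc(2,3)] y_H[OF abc(1)]])
    then have 2: "(-1) ^ (par a * (par b + par c)) *\<^sub>R (y c * (y b * y a)) = y a * (y c * y b)"
      by (auto simp: mult.assoc minus_one_power_iff)
    show ?thesis
      unfolding jac_def t_def using abc
      by (simp add: br_x_x distrib_right 1[symmetric] 2[symmetric])
  qed
  then have "(\<Sum>a\<in>I. \<Sum>b\<in>I. \<Sum>c\<in>I.
      jac (par a) (par b) (par c) (x a) (x b) (x c) * (y c * (y b * y a))) =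
      (\<Sum>a\<in>I. \<Sum>b\<in>I. \<Sum>c\<in>I. t a b c) + (\<Sum>a\<in>I. \<Sum>b\<in>I. \<Sum>c\<in>I. t a c b)
      + (\<Sum>a\<in>I. \<Sum>b\<in>I. \<Sum>c\<in>I. t b c a)"
    by (simp add: sum.distrib cong: sum.cong)
  moreover have "(\<Sum>a\<in>I. \<Sum>b\<in>I. \<Sum>c\<in>I. t a c b) = (\<Sum>a\<in>I. \<Sum>b\<in>I. \<Sum>c\<in>I. t a b c)"
    by (rule sum.cong[OF refl], rule sum.swap)
  moreover have "(\<Sum>a\<in>I. \<Sum>b\<in>I. \<Sum>c\<in>I. t b c a) = (\<Sum>a\<in>I. \<Sum>b\<in>I. \<Sum>c\<in>I. t a b c)"
    proof -
    have "(\<Sum>a\<in>I. \<Sum>b\<in>I. \<Sum>c\<in>I. t b c a) = (\<Sum>b\<in>I. \<Sum>a\<in>I. \<Sum>c\<in>I. t b c a)"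
      by (rule sum.swap)
    also have "\<dots> = (\<Sum>a\<in>I. \<Sum>b\<in>I. \<Sum>c\<in>I. t a b c)"
      by (rule sum.cong[OF refl], rule sum.swap)
    finally show ?thesis .
  qed
  ultimately have "(\<Sum>a\<in>I. \<Sum>b\<in>I. \<Sum>c\<in>I.
      jac (par a) (par b) (par c) (x a) (x b) (x c) * (y c * (y b * y a))) =
      3 *\<^sub>R (\<Sum>a\<in>I. \<Sum>b\<in>I. \<Sum>c\<in>I. t a b c)"
    by (simp add: scaleR_left.add[of 2 1, simplified] scaleR_2)
  also have "(\<Sum>a\<in>I. \<Sum>b\<in>I. \<Sum>c\<in>I. t a b c) =
      (\<Sum>a\<in>I. \<Sum>b\<in>I. \<Sum>c\<in>I. \<Sum>d\<in>I. S d c * (y c * (D d (S a b) * (y b * y a))))"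
    unfolding t_def by (intro sum.cong refl contract_br S_H C_mult y_C)
  also have "\<dots> = (\<Sum>a\<in>I. \<Sum>b\<in>I. \<Sum>d\<in>I. lin (S d) * (D d (S a b) * (y b * y a)))"
    unfolding lin_def sum_distrib_right mult.assoc by (rule sum.cong[OF refl], rule sum.cong[OF refl], rule sum.swap)
  also have "\<dots> = (\<Sum>a\<in>I. \<Sum>d\<in>I. \<Sum>b\<in>I. lin (S d) * (D d (S a b) * (y b * y a)))"
    by (rule sum.cong[OF refl], rule sum.swap)
  also have "\<dots> = (\<Sum>d\<in>I. \<Sum>a\<in>I. \<Sum>b\<in>I. lin (S d) * (D d (S a b) * (y b * y a)))"
    by (rule sum.swap)
  also have "\<dots> = (\<Sum>d\<in>I. lin (S d) * D d (quad S))"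
    by (rule sum.cong[OF refl]) (simp add: D_quad[OF S_H], simp add: quad_def sum_distrib_left)
  also have "\<dots> = 2 *\<^sub>R master"
    unfolding master_def symb_def
    by (simp add: D_scale H_C[OF quad_H[OF S_H]] scaleR_sum_right cong: sum.cong)
  finally show ?thesis by simp
qed

text \<open>On coordinates \<open>E_eq\<close> gives \<open>L (S a b)\<close> plus two brackets with
  \<open>T\<close>. The momenta are constants for \<open>L\<close>, so the first term sums to
  \<open>L (quad S)\<close>. The two brackets agree after renaming and differentiate
  \<open>first_symb\<close> along the vector field of \<open>symb\<close>.\<close>

lemma E_contract:
  "quad (\<lambda>a b. E (x a) (x b)) =
    (\<Sum>a\<in>I. \<Sum>b\<in>I. S a b * D b (D a symb)) + 2 *\<^sub>R (\<Sum>a\<in>I. T a * D a symb)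
    + 2 *\<^sub>R (\<Sum>a\<in>I. lin (S a) * D a first_symb)"
proof -
  define t where "t a b = br (par a + 1) (T a) (x b) * (y b * y a)" for a b
  have "E (x a) (x b) * (y b * y a) = L (S a b * (y b * y a)) + t a b + t b a"
    if ab: "a \<in> I" "b \<in> I" for a b
  proof -
    have "L (S a b * (y b * y a)) = L (S a b) * (y b * y a)"
      unfolding L_def using ab
      by (simp add: D_mult_yy[OF _ _ _ S_H] D_mult_yy[OF _ _ _ D_H[OF _ S_H]] distrib_right
          sum_distrib_right mult.assoc)
    moreover have "(-1) ^ par a *\<^sub>R br (par a) (x a) (T b) * (y b * y a) = t b a"
    proof -
      have "br (par a) (x a) (T b) = (-1) ^ (par a * (par b + 1)) *\<^sub>R br (par b + 1) (T b) (x a)"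
        by (rule br_sym[OF x_H[OF ab(1)] T_H[OF ab(2)]])
      then show ?thesis
        unfolding t_def y_swap[OF ab, symmetric] by (auto simp: minus_one_power_iff)
    qed
    ultimately show ?thesis
      using ab by (simp add: E_eq[of "x a" "x b" "par a"] x_C L_x br_x_x distrib_right t_def)
  qed
  then have "quad (\<lambda>a b. E (x a) (x b)) = (\<Sum>a\<in>I. \<Sum>b\<in>I. L (S a b * (y b * y a)))
      + (\<Sum>a\<in>I. \<Sum>b\<in>I. t a b) + (\<Sum>a\<in>I. \<Sum>b\<in>I. t b a)"
    unfolding quad_def by (simp add: sum.distrib cong: sum.cong)
  also have "(\<Sum>a\<in>I. \<Sum>b\<in>I. t b a) = (\<Sum>a\<in>I. \<Sum>b\<in>I. t a b)"
    by (rule sum.swap)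
  also have "(\<Sum>a\<in>I. \<Sum>b\<in>I. t a b) = (\<Sum>a\<in>I. \<Sum>b\<in>I. \<Sum>d\<in>I. S d b * (y b * (D d (T a) * y a)))"
    unfolding t_def by (intro sum.cong refl contract_br T_H y_C)
  also have "\<dots> = (\<Sum>a\<in>I. \<Sum>d\<in>I. lin (S d) * (D d (T a) * y a))"
    unfolding lin_def sum_distrib_right mult.assoc by (rule sum.cong[OF refl], rule sum.swap)
  also have "\<dots> = (\<Sum>d\<in>I. \<Sum>a\<in>I. lin (S d) * (D d (T a) * y a))"
    by (rule sum.swap)
  also have "\<dots> = (\<Sum>d\<in>I. lin (S d) * D d first_symb)"
    unfolding first_symb_def by (intro sum.cong refl) (simp add: D_lin[OF T_H] lin_def[of "\<lambda>a. D _ (T a)"] sum_distrib_left)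
  also have "(\<Sum>a\<in>I. \<Sum>b\<in>I. L (S a b * (y b * y a))) = L (quad S)"
  proof -
    have L_sum: "L (sum f J) = (\<Sum>i\<in>J. L (f i))" if "\<And>i. i \<in> J \<Longrightarrow> f i \<in> C" for f and J :: "'i set"
      using that by (induction J rule: infinite_finite_induct) (auto simp: L_zero L_add C_sum)
    show ?thesis
      unfolding quad_def by (simp add: L_sum C_sum C_mult S_C y_C)
  qed
  also have "L (quad S) = 2 *\<^sub>R L symb"
    unfolding symb_def by (simp add: L_scale H_C[OF quad_H[OF S_H]])
  finally show ?thesis
    unfolding L_def by (simp add: scaleR_add_right scaleR_2 add.assoc)
qed

theorem pois_symb_conn:
  assumes "\<And>a b c. a \<in> I \<Longrightarrow> b \<in> I \<Longrightarrow> c \<in> I \<Longrightarrow>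
    jac (par a) (par b) (par c) (x a) (x b) (x c) = 0"
  shows "pois symb conn = - quad (\<lambda>a b. E (x a) (x b))"
proof -
  have "6 *\<^sub>R master = 0"
    unfolding jac_contract[symmetric] by (simp add: assms)
  then have "master = 0" by simp
  then have "(\<Sum>a\<in>I. \<Sum>b\<in>I. S a b * D b (D a symb)) = - pois symb del"
    using divergence_master by (simp add: P.D_zero D_zero eq_neg_iff_add_eq_0)
  moreover have "pois symb conn = pois symb del - 2 *\<^sub>R pois symb first_symb"
    unfolding pois_def conn_eq
    by (simp add: D_diff P.D_diff D_scale P.D_scale H_C[OF del_H] H_C[OF first_symb_H] C_scale
        right_diff_distrib sum_subtractf scaleR_diff_right scaleR_sum_right algebra_simps)
  ultimately show ?thesis
    unfolding E_contract pois_symb[OF first_symb_H] by (simp add: P_first_symb scaleR_add_right)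
qed

text \<open>It serves to show that \<open>E (x a) (x b)\<close> does not depend on the momenta, as
  \<open>quad_eq_zero\<close> requires of its coefficients.\<close>

lemma P_L:
  assumes "c \<in> I" "f \<in> C" "P c f = 0"
  shows "P c (L f) = 0"
proof -
  have PD: "P c (D a g) = 0" if "P c g = 0" "a \<in> I" "g \<in> C" for a g
    using that assms(1) by (simp add: PD_comm D_zero)
  have "P c (S a b * D b (D a f)) = 0" if "a \<in> I" "b \<in> I" for a b
    using that assms PD by (simp add: P.D_mult[OF _ S_H] P_S D_C)
  moreover have "P c (T a * D a f) = 0" if "a \<in> I" for a
    using that assms PD by (simp add: P.D_mult[OF _ T_H] P_T D_C)
  ultimately show ?thesis
    unfolding L_def using assms
    by (simp add: P.D_add P.D_scale P.D_sum C_scale C_sum C_mult S_C T_C D_C cong: sum.cong)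
qed

corollary pois_symb_conn_eq_zero:
  assumes "\<And>a b c. a \<in> I \<Longrightarrow> b \<in> I \<Longrightarrow> c \<in> I \<Longrightarrow>
    jac (par a) (par b) (par c) (x a) (x b) (x c) = 0"
  shows "pois symb conn = 0 \<longleftrightarrow> (\<forall>a\<in>I. \<forall>b\<in>I. E (x a) (x b) = 0)"
proof -
  have PE: "P c (E (x a) (x b)) = 0" if "a \<in> I" "b \<in> I" "c \<in> I" for a b c
  proof -
    have LLH: "L (L (x a)) \<in> H (par a + 1 + 1)" by (intro L_H x_H that)
    show ?thesis
      unfolding E_def using that
      by (simp add: P.D_diff C_mult C_diff L_C x_C P.D_mult[OF _ LLH] P.D_mult[OF _ x_H] P_L P_x)
  qed
  have "(\<forall>a\<in>I. \<forall>b\<in>I. E (x a) (x b) = 0)" if "quad (\<lambda>a b. E (x a) (x b)) = 0"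
  proof (intro ballI, rule quad_eq_zero[of "\<lambda>a b. E (x a) (x b)" 0])
    show "E (x a) (x b) \<in> H (par a + par b + 0)" if "a \<in> I" "b \<in> I" for a b
      using E_H[OF x_H x_H] that by simp
    show "E (x a) (x b) = (-1) ^ (par a * par b) *\<^sub>R E (x b) (x a)" if "a \<in> I" "b \<in> I" for a b
      using that by (intro E_sym x_H)
  qed (use that PE in auto)
  moreover have "quad (\<lambda>a b. E (x a) (x b)) = 0" if "\<forall>a\<in>I. \<forall>b\<in>I. E (x a) (x b) = 0"
    using that by (simp add: quad_def)
  moreover have "pois symb conn = - quad (\<lambda>a b. E (x a) (x b))"
    by (rule pois_symb_conn) (rule assms)
  ultimately show ?thesis
    by (metis neg_equal_0_iff_equal)
qed

end

section \<open>The ring of superfunctions\<close>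

lemma shuffle_sign_Un_left:
  assumes "finite A" "finite B" "finite C" "A \<inter> B = {}"
  shows "shuffle_sign (A \<union> B) C = shuffle_sign A C * shuffle_sign B C"
proof -
  have "{(a, c). a \<in> A \<union> B \<and> c \<in> C \<and> c < a} =
      {(a, c). a \<in> A \<and> c \<in> C \<and> c < a} \<union> {(a, c). a \<in> B \<and> c \<in> C \<and> c < a}"
    by auto
  moreover have "finite {(a, c). a \<in> A \<and> c \<in> C \<and> c < a}"
    by (rule finite_subset[of _ "A \<times> C"]) (use assms in auto)
  moreover have "finite {(a, c). a \<in> B \<and> c \<in> C \<and> c < a}"
    by (rule finite_subset[of _ "B \<times> C"]) (use assms in auto)
  moreover have "{(a, c). a \<in> A \<and> c \<in> C \<and> c < a} \<inter> {(a, c). a \<in> B \<and> c \<in> C \<and> c < a} = {}"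
    using assms(4) by auto
  ultimately show ?thesis
    unfolding shuffle_sign_def by (simp add: card_Un_disjoint power_add)
qed

lemma shuffle_sign_Un_right:
  assumes "finite A" "finite B" "finite C" "B \<inter> C = {}"
  shows "shuffle_sign A (B \<union> C) = shuffle_sign A B * shuffle_sign A C"
proof -
  have "{(a, c). a \<in> A \<and> c \<in> B \<union> C \<and> c < a} =
      {(a, c). a \<in> A \<and> c \<in> B \<and> c < a} \<union> {(a, c). a \<in> A \<and> c \<in> C \<and> c < a}"
    by auto
  moreover have "finite {(a, c). a \<in> A \<and> c \<in> B \<and> c < a}"
    by (rule finite_subset[of _ "A \<times> B"]) (use assms in auto)
  moreover have "finite {(a, c). a \<in> A \<and> c \<in> C \<and> c < a}"
    by (rule finite_subset[of _ "A \<times> C"]) (use assms in auto)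
  moreover have "{(a, c). a \<in> A \<and> c \<in> B \<and> c < a} \<inter> {(a, c). a \<in> A \<and> c \<in> C \<and> c < a} = {}"
    using assms(4) by auto
  ultimately show ?thesis
    unfolding shuffle_sign_def by (simp add: card_Un_disjoint power_add)
qed

lemma shuffle_sign_empty [simp]: "shuffle_sign {} A = 1" "shuffle_sign A {} = 1"
  unfolding shuffle_sign_def by auto

text \<open>Every pair in \<open>A \<times> B\<close> is an inversion for exactly one of the two
  orders, as disjointness excludes equal entries; so the two inversion numbers add up to the product
  of the cardinalities.\<close>

lemma shuffle_sign_swap:
  assumes "finite A" "finite B" "A \<inter> B = {}"
  shows "shuffle_sign B A = (-1) ^ (card A * card B) * shuffle_sign A B"
proof -
  let ?u = "{(a, b). a \<in> A \<and> b \<in> B \<and> b < a}" and ?v = "{(b, a). b \<in> B \<and> a \<in> A \<and> a < b}"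
  have fin: "finite ?u" "finite ?v"
    by (rule finite_subset[of _ "A \<times> B"], use assms in auto)
      (rule finite_subset[of _ "B \<times> A"], use assms in auto)
  have AB: "A \<times> B = ?u \<union> prod.swap ` ?v"
    using assms(3) by (auto simp: image_iff)
  have disj: "?u \<inter> prod.swap ` ?v = {}"
    by auto
  have "card A * card B = card ?u + card (prod.swap ` ?v)"
    unfolding card_cartesian_product[symmetric] AB
    by (rule card_Un_disjoint[OF fin(1) finite_imageI[OF fin(2)] disj])
  also have "card (prod.swap ` ?v) = card ?v"
    by (rule card_image) simp
  finally have "card A * card B + card ?u = card ?v + 2 * card ?u"
    by simp
  then have "(-1::real) ^ (card A * card B + card ?u) = (-1) ^ (card ?v + 2 * card ?u)"
    by (rule arg_cong)
  then show ?thesis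
    unfolding shuffle_sign_def by (simp add: power_add power_mult)
qed

text \<open>
  Superfunctions form a type, so that the class of real algebras applies to them. Coefficients at
  infinite sets are \<open>0\<close> because the sum over \<open>Pow A\<close> in the product is \<open>0\<close> for infinite \<open>A\<close>.
\<close>

typedef sfn = "{f :: sfun. \<forall>A. infinite A \<longrightarrow> f A = (\<lambda>x. 0)}"
  morphisms coef Sfn
  by (rule exI[of _ "\<lambda>A x. 0"]) simp

lemma coeff_infinite [simp]: "infinite A \<Longrightarrow> coef F A = (\<lambda>x. 0)"
  using coef[of F] by simp

lemma sfn_eqI: "(\<And>A x. finite A \<Longrightarrow> coef F A x = coef G A x) \<Longrightarrow> F = G"
proof -
  assume eq: "\<And>A x. finite A \<Longrightarrow> coef F A x = coef G A x"
  have "coef F = coef G"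
  proof (intro ext)
    show "coef F A x = coef G A x" for A x
      by (cases "finite A") (simp_all add: eq)
  qed
  then show "F = G" by (simp add: coef_inject)
qed

lemma coeff_Sfn: "(\<And>A. infinite A \<Longrightarrow> f A = (\<lambda>x. 0)) \<Longrightarrow> coef (Sfn f) = f"
  by (simp add: Sfn_inverse)

text \<open>Smoothness, the domain and the number of odd coordinates are not part of the type. In
  particular 1 is constant on all points, whereas the unit of a domain is cut off outside it
  (\<open>unit_sfn\<close>).\<close>

instantiation sfn :: real_algebra_1
begin

definition "0 = Sfn (\<lambda>A x. 0)"
definition "1 = Sfn (\<lambda>A x. if A = {} then 1 else 0)"
definition "F + G = Sfn (\<lambda>A x. coef F A x + coef G A x)"
definition "F - G = Sfn (\<lambda>A x. coef F A x - coef G A x)"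
definition "- F = Sfn (\<lambda>A x. - coef F A x)"
definition "r *\<^sub>R F = Sfn (\<lambda>A x. r * coef F A x)"
definition "F * G = Sfn (\<lambda>A x. \<Sum>B\<in>Pow A. shuffle_sign B (A - B) * coef F B x * coef G (A - B) x)"

lemma coeff_simps:
  "coef 0 A x = 0"
  "coef 1 A x = (if A = {} then 1 else 0)"
  "coef (F + G) A x = coef F A x + coef G A x"
  "coef (F - G) A x = coef F A x - coef G A x"
  "coef (- F) A x = - coef F A x"
  "coef (r *\<^sub>R F) A x = r * coef F A x"
  unfolding zero_sfn_def one_sfn_def plus_sfn_def minus_sfn_def uminus_sfn_def scaleR_sfn_def
  by (subst coeff_Sfn; auto)+

lemma coeff_mult:
  "coef (F * G) A x = (\<Sum>B\<in>Pow A. shuffle_sign B (A - B) * coef F B x * coef G (A - B) x)"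
  unfolding times_sfn_def by (subst coeff_Sfn) auto

lemma sfn_mult_assoc: "(F * G) * K = F * (G * (K :: sfn))"
proof (rule sfn_eqI)
  fix A :: "nat set" and x assume A: "finite A"
  let ?t = "\<lambda>C E. shuffle_sign C (A - C) * coef F C x *
      (shuffle_sign E (A - C - E) * coef G E x * coef K (A - C - E) x)"
  \<comment> \<open>Both sides are the sign that sorts the concatenation of the three blocks
    \<open>C\<close>, \<open>B - C\<close>, \<open>A - B\<close>.\<close>
  have sign: "shuffle_sign B (A - B) * shuffle_sign C (B - C) =
      shuffle_sign C (A - C) * shuffle_sign (B - C) (A - B)" if "C \<subseteq> B" "B \<subseteq> A" for B C
  proof -
    have fin: "finite C" "finite (B - C)" "finite (A - B)"
      using A that by (auto intro: finite_subset)
    have eqs: "B = C \<union> (B - C)" "A - C = (B - C) \<union> (A - B)" using that by auto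
    have "shuffle_sign (C \<union> (B - C)) (A - B) = shuffle_sign C (A - B) * shuffle_sign (B - C) (A - B)"
      by (rule shuffle_sign_Un_left) (use fin in auto)
    moreover have "shuffle_sign C ((B - C) \<union> (A - B)) = shuffle_sign C (B - C) * shuffle_sign C (A - B)"
      by (rule shuffle_sign_Un_right) (use fin in auto)
    ultimately show ?thesis
      using eqs by simp
  qed
  have "coef ((F * G) * K) A x = (\<Sum>B\<in>Pow A. \<Sum>C\<in>Pow B.
      shuffle_sign B (A - B) * (shuffle_sign C (B - C) * coef F C x * coef G (B - C) x) * coef K (A - B) x)"
    by (simp add: coeff_mult sum_distrib_left sum_distrib_right)
  also have "\<dots> = (\<Sum>(B, C)\<in>(SIGMA B:Pow A. Pow B). ?t C (B - C))"
  proof (subst sum.Sigma)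
    show "(\<Sum>(B, C)\<in>(SIGMA B:Pow A. Pow B). shuffle_sign B (A - B) *
          (shuffle_sign C (B - C) * coef F C x * coef G (B - C) x) * coef K (A - B) x) =
        (\<Sum>(B, C)\<in>(SIGMA B:Pow A. Pow B). ?t C (B - C))"
    proof (rule sum.cong[OF refl], clarify)
      fix B C assume BC: "B \<subseteq> A" "C \<subseteq> B"
      have "A - C - (B - C) = A - B" using BC by auto
      then show "shuffle_sign B (A - B) *
          (shuffle_sign C (B - C) * coef F C x * coef G (B - C) x) * coef K (A - B) x = ?t C (B - C)"
        using sign[OF BC(2,1)] by (simp add: mult.assoc[symmetric])
    qed
  qed (use A in \<open>auto intro: finite_subset\<close>)
  \<comment> \<open>A chain \<open>C \<subseteq> B \<subseteq> A\<close> is the same as a pair of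
    disjoint blocks \<open>C\<close> and \<open>E = B - C\<close>.\<close>
  also have "\<dots> = (\<Sum>(C, E)\<in>(SIGMA C:Pow A. Pow (A - C)). ?t C E)"
  proof (rule sum.reindex_bij_witness[of _ "\<lambda>(C, E). (C \<union> E, C)" "\<lambda>(B, C). (C, B - C)"])
  qed (auto simp: Diff_Un Int_Diff)
  also have "\<dots> = coef (F * (G * K)) A x"
    unfolding coeff_mult sum_distrib_left by (rule sum.Sigma[symmetric]) (use A in auto)
  finally show "coef ((F * G) * K) A x = coef (F * (G * K)) A x" .
qed

instance
proof
  fix F G K :: sfn and r s :: real
  show "F + G + K = F + (G + K)" "F + G = G + F" "0 + F = F" "- F + F = 0" "F - G = F + - G"
    "r *\<^sub>R (F + G) = r *\<^sub>R F + r *\<^sub>R G" "(r + s) *\<^sub>R F = r *\<^sub>R F + s *\<^sub>R F"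
    "r *\<^sub>R s *\<^sub>R F = (r * s) *\<^sub>R F" "1 *\<^sub>R F = F"
    by (rule sfn_eqI; simp add: coeff_simps algebra_simps)+
  show "F * G * K = F * (G * K)" by (rule sfn_mult_assoc)
  show "(F + G) * K = F * K + G * K" "F * (G + K) = F * G + F * K"
    "r *\<^sub>R F * G = r *\<^sub>R (F * G)" "F * r *\<^sub>R G = r *\<^sub>R (F * G)"
    by (rule sfn_eqI; simp add: coeff_simps coeff_mult algebra_simps sum.distrib sum_distrib_left)+
  show "(0::sfn) \<noteq> 1"
    by (metis coeff_simps(1,2) zero_neq_one)
  show "1 * F = F"
  proof (rule sfn_eqI)
    fix A :: "nat set" and x assume "finite A"
    have "coef (1 * F) A x = (\<Sum>B\<in>Pow A. if B = {} then coef F A x else 0)"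
      unfolding coeff_mult by (rule sum.cong) (auto simp: coeff_simps)
    then show "coef (1 * F) A x = coef F A x" using \<open>finite A\<close> by simp
  qed
  show "F * 1 = F"
  proof (rule sfn_eqI)
    fix A :: "nat set" and x assume "finite A"
    have "coef (F * 1) A x = (\<Sum>B\<in>Pow A. if B = A then coef F A x else 0)"
      unfolding coeff_mult by (rule sum.cong) (auto simp: coeff_simps)
    then show "coef (F * 1) A x = coef F A x" using \<open>finite A\<close> by simp
  qed
qed

end

section \<open>Smooth functions on coordinate domains\<close>

lemma Euclidean_space_eq: "Euclidean_space n = top_of_set {x. \<forall>i\<ge>n. x i = 0}"
  by (simp add: Euclidean_space_def euclidean_product_topology)

text \<open>A relation, because \<open>partial\<close> is total and by itself does not say that the
  derivative exists.\<close>

definition has_partial :: "nat \<Rightarrow> ((nat \<Rightarrow> real) \<Rightarrow> real) \<Rightarrow> (nat \<Rightarrow> real) \<Rightarrow> real \<Rightarrow> bool" where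
  "has_partial i f x d \<longleftrightarrow> ((\<lambda>t. f (x(i := t))) has_real_derivative d) (at (x i))"

lemma has_partial_imp: "has_partial i f x d \<Longrightarrow> partial i f x = d"
  unfolding has_partial_def partial_def by (rule DERIV_imp_deriv)

lemma has_partial_differentiable:
  "has_partial i f x (partial i f x) \<longleftrightarrow> (\<lambda>t. f (x(i := t))) differentiable (at (x i))"
  unfolding has_partial_def partial_def by (rule DERIV_deriv_iff_real_differentiable)

lemma has_partial_const: "has_partial i (\<lambda>x. c) x 0"
  unfolding has_partial_def by simp

lemma has_partial_add:
  "has_partial i f x d \<Longrightarrow> has_partial i g x d' \<Longrightarrow> has_partial i (\<lambda>x. f x + g x) x (d + d')"
  unfolding has_partial_def by (rule DERIV_add)

lemma has_partial_mult:
  "has_partial i f x d \<Longrightarrow> has_partial i g x d' \<Longrightarrow>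
    has_partial i (\<lambda>x. f x * g x) x (d * g x + f x * d')"
  unfolding has_partial_def
  by (drule (1) DERIV_mult) (simp add: mult.commute)

locale coordinate_domain =
  fixes n :: nat and V :: "(nat \<Rightarrow> real) set"
  assumes open_V: "openin (Euclidean_space n) V"
begin

lemma open_V': "openin (top_of_set {x. \<forall>i\<ge>n. x i = 0}) V"
  using open_V by (simp add: Euclidean_space_eq)

lemma V_zero: "x \<in> V \<Longrightarrow> i \<ge> n \<Longrightarrow> x i = 0"
  using openin_imp_subset[OF open_V'] by blast

lemma subtopology_V: "subtopology (Euclidean_space n) V = top_of_set V"
  unfolding Euclidean_space_eq subtopology_subtopology
  using openin_imp_subset[OF open_V'] by (simp add: inf.absorb2)

text \<open>A basic open set of the product topology restricts each coordinate separately. Those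
  with index at least \<open>n\<close> are pinned to 0, so finitely many radii matter and they have
  a positive minimum.\<close>

lemma box_aux:
  fixes x :: "nat \<Rightarrow> real"
  assumes "openin (top_of_set {x. \<forall>i\<ge>n. x i = 0}) W" "x \<in> W"
  shows "\<exists>r>0. \<forall>y. (\<forall>i\<ge>n. y i = 0) \<longrightarrow> (\<forall>i<n. \<bar>y i - x i\<bar> \<le> r) \<longrightarrow> y \<in> W"
proof -
  obtain T where T: "open T" "W = {x. \<forall>i\<ge>n. x i = 0} \<inter> T"
    using assms(1) by (auto simp: openin_open)
  then have "openin (product_topology (\<lambda>i. euclidean) UNIV) T"
    by (simp add: open_fun_def)
  then obtain U where U: "\<And>i. open (U i)" "\<And>i. x i \<in> U i" "Pi\<^sub>E UNIV U \<subseteq> T"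
    using assms(2) T(2) unfolding openin_product_topology_alt by (fastforce simp: PiE_iff)
  have "\<exists>r>0. cball (x i) r \<subseteq> U i" for i
    using U(1,2) open_contains_cball by blast
  then obtain r where r: "\<And>i. r i > 0" "\<And>i. cball (x i) (r i) \<subseteq> U i"
    by metis
  \<comment> \<open>The inserted 1 keeps the minimum defined for \<open>n = 0\<close>.\<close>
  define R where "R = Min (insert 1 (r ` {..<n}))"
  have R: "R > 0" "\<And>i. i < n \<Longrightarrow> R \<le> r i"
    unfolding R_def using r(1) by auto
  show ?thesis
  proof (intro exI[of _ R] conjI allI impI R(1))
    fix y assume y: "\<forall>i\<ge>n. y i = 0" "\<forall>i<n. \<bar>y i - x i\<bar> \<le> R"
    have "y i \<in> U i" for i
    proof (cases "i < n")
      case True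
      then have "y i \<in> cball (x i) (r i)"
        using y(2) R(2)[of i] by (force simp: dist_real_def)
      then show ?thesis using r(2) by blast
    next
      case False
      then have "y i = x i" using y(1) assms(2) T(2) by auto
      then show ?thesis using U(2) by simp
    qed
    then show "y \<in> W"
      using y(1) U(3) T(2) by (auto simp: PiE_iff)
  qed
qed

lemma box:
  assumes "x \<in> V"
  obtains r where "r > 0" "\<And>y. (\<And>i. i \<ge> n \<Longrightarrow> y i = 0) \<Longrightarrow> (\<And>i. i < n \<Longrightarrow> \<bar>y i - x i\<bar> \<le> r) \<Longrightarrow> y \<in> V"
  using box_aux[OF open_V' assms] by blast

text \<open>The bound \<open>i < n\<close> keeps the updated point in the Euclidean space. This is
  what makes partial derivatives on \<open>V\<close> depend only on values in
  \<open>V\<close>.\<close>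

lemma upd_in_V:
  assumes "x \<in> V" "i < n" shows "\<forall>\<^sub>F t in nhds (x i). x(i := t) \<in> V"
proof -
  obtain r where r: "r > 0" "\<And>y. (\<And>i. i \<ge> n \<Longrightarrow> y i = 0) \<Longrightarrow> (\<And>i. i < n \<Longrightarrow> \<bar>y i - x i\<bar> \<le> r) \<Longrightarrow> y \<in> V"
    using box[OF assms(1)] by blast
  have "x(i := t) \<in> V" if "dist t (x i) < r" for t
    using that r assms V_zero[OF assms(1)] by (intro r(2)) (auto simp: dist_real_def)
  then show ?thesis
    unfolding eventually_nhds_metric using r(1) by blast
qed

lemma continuous_box:
  assumes h: "continuous_on V h" and x: "x \<in> V" and e: "(e::real) > 0"
  obtains r where "r > 0"
    "\<And>y. (\<And>i. i \<ge> n \<Longrightarrow> y i = 0) \<Longrightarrow> (\<And>i. i < n \<Longrightarrow> \<bar>y i - x i\<bar> \<le> r) \<Longrightarrow> y \<in> V \<and> \<bar>h y - h x\<bar> < e"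
proof -
  have "openin (top_of_set V) (V \<inter> h -` ball (h x) e)"
    by (rule continuous_openin_preimage_gen[OF h open_ball])
  then have "openin (top_of_set {x. \<forall>i\<ge>n. x i = 0}) (V \<inter> h -` ball (h x) e)"
    using open_V' by (rule openin_trans)
  from box_aux[OF this, of x] show ?thesis
    using that x e by (auto simp: dist_real_def abs_minus_commute)
qed

lemma has_partial_cong:
  assumes "\<And>y. y \<in> V \<Longrightarrow> f y = g y" "x \<in> V" "i < n"
  shows "has_partial i f x d \<longleftrightarrow> has_partial i g x d"
  unfolding has_partial_def
  by (rule DERIV_cong_ev) (use eventually_mono[OF upd_in_V[OF assms(2,3)]] assms(1) in auto)

lemma partial_cong:
  assumes "\<And>y. y \<in> V \<Longrightarrow> f y = g y" "x \<in> V" "i < n"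
  shows "partial i f x = partial i g x"
  unfolding partial_def
  by (rule deriv_cong_ev) (use eventually_mono[OF upd_in_V[OF assms(2,3)]] assms(1) in auto)

lemma smooth_fun_iff:
  "smooth_fun n V f \<longleftrightarrow> (\<forall>is. set is \<subseteq> {..<n} \<longrightarrow> continuous_on V (foldr partial is f) \<and>
    (\<forall>x\<in>V. \<forall>i<n. has_partial i (foldr partial is f) x (partial i (foldr partial is f) x)))"
  unfolding smooth_fun_def subtopology_V continuous_map_iff_continuous has_partial_differentiable ..

lemma smooth_continuous: "smooth_fun n V f \<Longrightarrow> continuous_on V f"
  unfolding smooth_fun_iff by (drule spec[of _ "[]"]) simp

lemma smooth_has_partial: "smooth_fun n V f \<Longrightarrow> x \<in> V \<Longrightarrow> i < n \<Longrightarrow> has_partial i f x (partial i f x)"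
  unfolding smooth_fun_iff by (drule spec[of _ "[]"]) simp

lemma smooth_partial: "smooth_fun n V f \<Longrightarrow> i < n \<Longrightarrow> smooth_fun n V (partial i f)"
  unfolding smooth_fun_iff
proof (intro allI impI)
  fix "is" assume *: "\<forall>is. set is \<subseteq> {..<n} \<longrightarrow> continuous_on V (foldr partial is f) \<and>
      (\<forall>x\<in>V. \<forall>i<n. has_partial i (foldr partial is f) x (partial i (foldr partial is f) x))"
    and "i < n" "set is \<subseteq> {..<n}"
  then show "continuous_on V (foldr partial is (partial i f)) \<and>
      (\<forall>x\<in>V. \<forall>k<n. has_partial k (foldr partial is (partial i f)) x (partial k (foldr partial is (partial i f)) x))"
    using *[rule_format, of "is @ [i]"] by simp
qed

text \<open>\<open>smooth_fun\<close> speaks of iterates of the total operator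
  \<open>partial\<close>, about which nothing is known outside \<open>V\<close>. It is enough to
  stay in a class of continuous functions that provides, on \<open>V\<close>, a derivative of each
  of its members; the iterates themselves are never computed.\<close>

lemma smooth_coinduct:
  assumes "f \<in> P" and cont: "\<And>h. h \<in> P \<Longrightarrow> continuous_on V h"
    and step: "\<And>h i. h \<in> P \<Longrightarrow> i < n \<Longrightarrow> \<exists>h'\<in>P. \<forall>x\<in>V. has_partial i h x (h' x)"
  shows "smooth_fun n V f"
proof -
  have *: "\<exists>h\<in>P. \<forall>x\<in>V. foldr partial is f x = h x" if "set is \<subseteq> {..<n}" for "is"
    using that
  proof (induction "is")
    case Nil
    then show ?case using assms(1) by auto
  next
    case (Cons i "is")
    then obtain h where h: "h \<in> P" "\<And>x. x \<in> V \<Longrightarrow> foldr partial is f x = h x" by auto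
    obtain h' where h': "h' \<in> P" "\<forall>x\<in>V. has_partial i h x (h' x)"
      using step[OF h(1), of i] Cons.prems by auto
    have "foldr partial (i # is) f x = h' x" if "x \<in> V" for x
      using partial_cong[OF h(2) that] has_partial_imp[OF h'(2)[rule_format, OF that]] Cons.prems by simp
    then show ?case using h'(1) by blast
  qed
  show ?thesis
    unfolding smooth_fun_iff
  proof (intro allI impI conjI ballI)
    fix "is" assume "set is \<subseteq> {..<n}"
    then obtain h where h: "h \<in> P" "\<And>x. x \<in> V \<Longrightarrow> foldr partial is f x = h x" using * by blast
    show "continuous_on V (foldr partial is f)"
      using cont[OF h(1)] h(2) by (simp cong: continuous_on_cong)
    fix x i assume "x \<in> V" "i < n"
    then obtain d where "has_partial i h x d" using step[OF h(1)] by blast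
    then have "has_partial i (foldr partial is f) x d"
      using has_partial_cong[OF h(2) \<open>x \<in> V\<close> \<open>i < n\<close>] by simp
    then show "has_partial i (foldr partial is f) x (partial i (foldr partial is f) x)"
      using has_partial_imp by metis
  qed
qed

lemma smooth_cong:
  assumes "smooth_fun n V f" "\<And>x. x \<in> V \<Longrightarrow> f x = g x"
  shows "smooth_fun n V g"
proof (rule smooth_coinduct[of g "{h. \<exists>k. smooth_fun n V k \<and> (\<forall>x\<in>V. h x = k x)}"])
  fix h i assume "h \<in> {h. \<exists>k. smooth_fun n V k \<and> (\<forall>x\<in>V. h x = k x)}" and i: "i < n"
  then obtain k where k: "smooth_fun n V k" "\<And>x. x \<in> V \<Longrightarrow> h x = k x" by auto
  have "has_partial i h x (partial i k x)" if "x \<in> V" for x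
    using has_partial_cong[OF k(2) that i] smooth_has_partial[OF k(1) that i] by simp
  then show "\<exists>h'\<in>{h. \<exists>k. smooth_fun n V k \<and> (\<forall>x\<in>V. h x = k x)}. \<forall>x\<in>V. has_partial i h x (h' x)"
    using smooth_partial[OF k(1) i] by blast
next
  fix h assume "h \<in> {h. \<exists>k. smooth_fun n V k \<and> (\<forall>x\<in>V. h x = k x)}"
  then show "continuous_on V h"
    using smooth_continuous by (auto cong: continuous_on_cong)
qed (use assms in auto)

text \<open>The derivative of a product is a sum of products, so the class for the coinduction has
  to be closed under both operations.\<close>

inductive_set smooth_alg :: "((nat \<Rightarrow> real) \<Rightarrow> real) set" where
  base: "smooth_fun n V f \<Longrightarrow> f \<in> smooth_alg"
| const: "(\<lambda>x. c) \<in> smooth_alg"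
| add: "f \<in> smooth_alg \<Longrightarrow> g \<in> smooth_alg \<Longrightarrow> (\<lambda>x. f x + g x) \<in> smooth_alg"
| mult: "f \<in> smooth_alg \<Longrightarrow> g \<in> smooth_alg \<Longrightarrow> (\<lambda>x. f x * g x) \<in> smooth_alg"

lemma smooth_alg_smooth: "f \<in> smooth_alg \<Longrightarrow> smooth_fun n V f"
proof (rule smooth_coinduct[of f smooth_alg])
  fix h assume "h \<in> smooth_alg"
  then show "continuous_on V h"
    by (induction rule: smooth_alg.induct) (auto intro: smooth_continuous continuous_intros)
next
  fix h i assume "h \<in> smooth_alg" and i: "i < n"
  then show "\<exists>h'\<in>smooth_alg. \<forall>x\<in>V. has_partial i h x (h' x)"
  proof (induction rule: smooth_alg.induct)
    case (base f)
    then show ?case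
      using smooth_has_partial smooth_partial i smooth_alg.base by blast
  next
    case (const c)
    show ?case
      by (rule bexI[of _ "\<lambda>x. 0"]) (auto intro: has_partial_const smooth_alg.const)
  next
    case (add f g)
    then obtain f' g' where *: "f' \<in> smooth_alg" "\<forall>x\<in>V. has_partial i f x (f' x)"
      "g' \<in> smooth_alg" "\<forall>x\<in>V. has_partial i g x (g' x)" using i by blast
    then show ?case
      by (intro bexI[of _ "\<lambda>x. f' x + g' x"]) (auto intro: has_partial_add smooth_alg.add)
  next
    case (mult f g)
    then obtain f' g' where *: "f' \<in> smooth_alg" "\<forall>x\<in>V. has_partial i f x (f' x)"
      "g' \<in> smooth_alg" "\<forall>x\<in>V. has_partial i g x (g' x)" using i by blast
    then show ?case
      by (intro bexI[of _ "\<lambda>x. f' x * g x + f x * g' x"] ballI has_partial_mult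
          smooth_alg.add[OF smooth_alg.mult[OF *(1) mult.hyps(2)] smooth_alg.mult[OF mult.hyps(1) *(3)]]) auto
  qed
qed

lemma smooth_const: "smooth_fun n V (\<lambda>x. c)"
  by (rule smooth_alg_smooth[OF smooth_alg.const])

lemma smooth_add: "smooth_fun n V f \<Longrightarrow> smooth_fun n V g \<Longrightarrow> smooth_fun n V (\<lambda>x. f x + g x)"
  by (rule smooth_alg_smooth[OF smooth_alg.add[OF smooth_alg.base smooth_alg.base]])

lemma smooth_mult: "smooth_fun n V f \<Longrightarrow> smooth_fun n V g \<Longrightarrow> smooth_fun n V (\<lambda>x. f x * g x)"
  by (rule smooth_alg_smooth[OF smooth_alg.mult[OF smooth_alg.base smooth_alg.base]])

lemma smooth_scale: "smooth_fun n V f \<Longrightarrow> smooth_fun n V (\<lambda>x. c * f x)"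
  by (rule smooth_alg_smooth[OF smooth_alg.mult[OF smooth_alg.const smooth_alg.base]])

lemma smooth_sum: "(\<And>j. j \<in> J \<Longrightarrow> smooth_fun n V (f j)) \<Longrightarrow> smooth_fun n V (\<lambda>x. \<Sum>j\<in>J. f j x)"
  by (induction J rule: infinite_finite_induct) (auto intro: smooth_const smooth_add)

lemma smooth_coord: "smooth_fun n V (\<lambda>x. x i)"
proof (rule smooth_coinduct[of _ "insert (\<lambda>x. x i) (range (\<lambda>c x. c))"])
  fix h :: "(nat \<Rightarrow> real) \<Rightarrow> real" assume "h \<in> insert (\<lambda>x. x i) (range (\<lambda>c x. c))"
  then show "continuous_on V h"
    by (auto intro!: continuous_on_const continuous_on_subset[OF continuous_on_product_coordinates])
  fix j
  have "has_partial j (\<lambda>x. x i) x (if i = j then 1 else 0)" for x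
    unfolding has_partial_def by auto
  then show "\<exists>h'\<in>insert (\<lambda>x. x i) (range (\<lambda>c x. c)). \<forall>x\<in>V. has_partial j h x (h' x)"
    using \<open>h \<in> _\<close> has_partial_const by (auto intro: exI[of _ "if i = j then 1 else 0"] exI[of _ 0])
qed simp

text \<open>Both mixed second derivatives are limits of the same second difference quotient.\<close>

lemma second_difference:
  assumes f: "smooth_fun n V f" and x: "x \<in> V" and ij: "i < n" "j < n" "i \<noteq> j" and h: "h > 0"
    and box: "\<And>s t. x i \<le> s \<Longrightarrow> s \<le> x i + h \<Longrightarrow> x j \<le> t \<Longrightarrow> t \<le> x j + h \<Longrightarrow> x(i := s, j := t) \<in> V"
  shows "\<exists>s t. x i \<le> s \<and> s \<le> x i + h \<and> x j \<le> t \<and> t \<le> x j + h \<and>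
    f (x(i := x i + h, j := x j + h)) - f (x(i := x i + h, j := x j)) -
    f (x(i := x i, j := x j + h)) + f (x(i := x i, j := x j)) =
    h * h * partial j (partial i f) (x(i := s, j := t))"
proof -
  have di: "((\<lambda>s. g (x(i := s, j := t))) has_real_derivative partial i g (x(i := s, j := t))) (at s)"
    if "smooth_fun n V g" "x i \<le> s" "s \<le> x i + h" "x j \<le> t" "t \<le> x j + h" for g s t
    using smooth_has_partial[OF that(1) box[OF that(2-5)] ij(1)] ij(3)
    unfolding has_partial_def by (simp add: fun_upd_twist)
  have dj: "((\<lambda>t. g (x(i := s, j := t))) has_real_derivative partial j g (x(i := s, j := t))) (at t)"
    if "smooth_fun n V g" "x i \<le> s" "s \<le> x i + h" "x j \<le> t" "t \<le> x j + h" for g s t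
    using smooth_has_partial[OF that(1) box[OF that(2-5)] ij(2)]
    unfolding has_partial_def by simp
  let ?\<phi> = "\<lambda>s. f (x(i := s, j := x j + h)) - f (x(i := s, j := x j))"
  have "\<exists>s>x i. s < x i + h \<and> ?\<phi> (x i + h) - ?\<phi> (x i) = (x i + h - x i) *
      (partial i f (x(i := s, j := x j + h)) - partial i f (x(i := s, j := x j)))"
  proof (rule MVT2)
    fix s assume "x i \<le> s" "s \<le> x i + h"
    then show "(?\<phi> has_real_derivative
        partial i f (x(i := s, j := x j + h)) - partial i f (x(i := s, j := x j))) (at s)"
      using h by (intro DERIV_diff di[OF f]) auto
  qed (use h in simp)
  then obtain s where s: "x i < s" "s < x i + h" "?\<phi> (x i + h) - ?\<phi> (x i) = h *
      (partial i f (x(i := s, j := x j + h)) - partial i f (x(i := s, j := x j)))" by auto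
  let ?\<psi> = "\<lambda>t. partial i f (x(i := s, j := t))"
  have "\<exists>t>x j. t < x j + h \<and> ?\<psi> (x j + h) - ?\<psi> (x j) = (x j + h - x j) *
      partial j (partial i f) (x(i := s, j := t))"
  proof (rule MVT2)
    fix t assume "x j \<le> t" "t \<le> x j + h"
    then show "(?\<psi> has_real_derivative partial j (partial i f) (x(i := s, j := t))) (at t)"
      using s by (intro dj smooth_partial f ij) auto
  qed (use h in simp)
  then obtain t where t: "x j < t" "t < x j + h"
      "?\<psi> (x j + h) - ?\<psi> (x j) = h * partial j (partial i f) (x(i := s, j := t))" by auto
  show ?thesis
    by (intro exI[of _ s] exI[of _ t]) (use s t in \<open>auto simp: algebra_simps\<close>)
qed

text \<open>The second difference over a square of side \<open>h\<close> is symmetric in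
  \<open>i\<close> and \<open>j\<close>. It is \<open>h * h\<close> times one mixed derivative at
  some point of the square, and \<open>h * h\<close> times the other at another point; continuity
  brings both values close to those at \<open>x\<close>.\<close>

lemma partial_commute:
  assumes f: "smooth_fun n V f" and x: "x \<in> V" and ij: "i < n" "j < n"
  shows "partial i (partial j f) x = partial j (partial i f) x"
proof (cases "i = j")
  case False
  let ?u = "partial i (partial j f)" and ?v = "partial j (partial i f)"
  have "\<bar>?u x - ?v x\<bar> \<le> e" if e: "e > 0" for e
  proof -
    obtain r where r: "r > 0" "\<And>y. (\<And>i. i \<ge> n \<Longrightarrow> y i = 0) \<Longrightarrow> (\<And>i. i < n \<Longrightarrow> \<bar>y i - x i\<bar> \<le> r) \<Longrightarrow>
        y \<in> V \<and> \<bar>?u y - ?u x\<bar> < e/2"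
      using continuous_box[OF smooth_continuous[OF smooth_partial[OF smooth_partial[OF f ij(2)] ij(1)]] x, of "e/2"] e
      by auto
    obtain r' where r': "r' > 0" "\<And>y. (\<And>i. i \<ge> n \<Longrightarrow> y i = 0) \<Longrightarrow> (\<And>i. i < n \<Longrightarrow> \<bar>y i - x i\<bar> \<le> r') \<Longrightarrow>
        y \<in> V \<and> \<bar>?v y - ?v x\<bar> < e/2"
      using continuous_box[OF smooth_continuous[OF smooth_partial[OF smooth_partial[OF f ij(1)] ij(2)]] x, of "e/2"] e
      by auto
    define h where "h = min r r'"
    have h: "h > 0" "h \<le> r" "h \<le> r'" unfolding h_def using r r' by auto
    have near: "x(i := s, j := t) \<in> V \<and> \<bar>?u (x(i := s, j := t)) - ?u x\<bar> < e/2 \<and>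
        \<bar>?v (x(i := s, j := t)) - ?v x\<bar> < e/2"
      if "x i \<le> s" "s \<le> x i + h" "x j \<le> t" "t \<le> x j + h" for s t
    proof -
      have "(x(i := s, j := t)) k = 0" if "k \<ge> n" for k using that V_zero[OF x] ij by auto
      moreover have "\<bar>(x(i := s, j := t)) k - x k\<bar> \<le> h" for k using that h(1) by auto
      ultimately show ?thesis
        using r(2)[of "x(i := s, j := t)"] r'(2)[of "x(i := s, j := t)"] h(2,3) by (meson order_trans)
    qed
    obtain s t where st: "x i \<le> s" "s \<le> x i + h" "x j \<le> t" "t \<le> x j + h"
      "f (x(i := x i + h, j := x j + h)) - f (x(i := x i + h, j := x j)) -
       f (x(i := x i, j := x j + h)) + f (x(i := x i, j := x j)) = h * h * ?v (x(i := s, j := t))"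
      using second_difference[OF f x ij False h(1)] near by blast
    obtain t' s' where st': "x j \<le> t'" "t' \<le> x j + h" "x i \<le> s'" "s' \<le> x i + h"
      "f (x(j := x j + h, i := x i + h)) - f (x(j := x j + h, i := x i)) -
       f (x(j := x j, i := x i + h)) + f (x(j := x j, i := x i)) = h * h * ?u (x(j := t', i := s'))"
      using second_difference[OF f x ij(2,1) False[symmetric] h(1)] near fun_upd_twist[OF False, of x]
      by metis
    have "h * h * ?v (x(i := s, j := t)) = h * h * ?u (x(i := s', j := t'))"
    proof -
      have eq: "x(i := x i + h, j := x j) = x(i := x i + h)" using False by auto
      show ?thesis
        using st(5) st'(5) unfolding fun_upd_twist[OF False[symmetric]] fun_upd_triv eq by linarith
    qed
    then have "?v (x(i := s, j := t)) = ?u (x(i := s', j := t'))"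
      using h(1) by (metis mult_cancel_left mult_eq_0_iff less_irrefl)
    moreover have "\<bar>?v (x(i := s, j := t)) - ?v x\<bar> < e/2" using near st by blast
    moreover have "\<bar>?u (x(i := s', j := t')) - ?u x\<bar> < e/2" using near st' by blast
    ultimately show ?thesis by linarith
  qed
  then have "\<bar>?u x - ?v x\<bar> \<le> 0" by (rule field_le_epsilon) simp
  then show ?thesis by simp
qed simp

end

section \<open>Bump functions and pull-backs\<close>

text \<open>Infinite differentiability as a greatest fixed point, in the style of
  \<open>smooth_coinduct\<close>; higher derivatives never have to be named.\<close>

definition real_smooth :: "(real \<Rightarrow> real) \<Rightarrow> bool" where
  "real_smooth f \<longleftrightarrow> (\<exists>P. f \<in> P \<and> (\<forall>u\<in>P. \<exists>u'\<in>P. \<forall>t. (u has_real_derivative u' t) (at t)))"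

lemma real_smoothI:
  "f \<in> P \<Longrightarrow> (\<And>u. u \<in> P \<Longrightarrow> \<exists>u'\<in>P. \<forall>t. (u has_real_derivative u' t) (at t)) \<Longrightarrow> real_smooth f"
  unfolding real_smooth_def by blast

lemma real_smooth_deriv:
  assumes "real_smooth f"
  obtains f' where "real_smooth f'" "\<And>t. (f has_real_derivative f' t) (at t)"
  using assms unfolding real_smooth_def by blast

inductive_set real_smooth_alg :: "(real \<Rightarrow> real) set" where
  base: "real_smooth f \<Longrightarrow> f \<in> real_smooth_alg"
| const: "(\<lambda>t. c) \<in> real_smooth_alg"
| ident: "(\<lambda>t. t) \<in> real_smooth_alg"
| add: "f \<in> real_smooth_alg \<Longrightarrow> g \<in> real_smooth_alg \<Longrightarrow> (\<lambda>t. f t + g t) \<in> real_smooth_alg"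
| mult: "f \<in> real_smooth_alg \<Longrightarrow> g \<in> real_smooth_alg \<Longrightarrow> (\<lambda>t. f t * g t) \<in> real_smooth_alg"
| comp: "real_smooth f \<Longrightarrow> g \<in> real_smooth_alg \<Longrightarrow> (\<lambda>t. f (g t)) \<in> real_smooth_alg"

lemma real_smooth_alg_smooth: "f \<in> real_smooth_alg \<Longrightarrow> real_smooth f"
proof (rule real_smoothI[of f real_smooth_alg])
  fix u assume "u \<in> real_smooth_alg"
  then show "\<exists>u'\<in>real_smooth_alg. \<forall>t. (u has_real_derivative u' t) (at t)"
  proof (induction rule: real_smooth_alg.induct)
    case (base f)
    then show ?case by (metis real_smooth_alg.base real_smooth_deriv)
  next
    case (const c)
    show ?case by (rule bexI[of _ "\<lambda>t. 0"]) (auto intro: real_smooth_alg.const)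
  next
    case ident
    show ?case by (rule bexI[of _ "\<lambda>t. 1"]) (auto intro: real_smooth_alg.const)
  next
    case (add f g)
    then obtain f' g' where *: "f' \<in> real_smooth_alg" "\<forall>t. (f has_real_derivative f' t) (at t)"
      "g' \<in> real_smooth_alg" "\<forall>t. (g has_real_derivative g' t) (at t)" by blast
    show ?case
      by (rule bexI[OF _ real_smooth_alg.add[OF *(1,3)]]) (use * in \<open>auto intro: DERIV_add\<close>)
  next
    case (mult f g)
    then obtain f' g' where *: "f' \<in> real_smooth_alg" "\<forall>t. (f has_real_derivative f' t) (at t)"
      "g' \<in> real_smooth_alg" "\<forall>t. (g has_real_derivative g' t) (at t)" by blast
    show ?case
      by (rule bexI[OF _ real_smooth_alg.add[OF real_smooth_alg.mult[OF *(1) mult.hyps(2)]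
              real_smooth_alg.mult[OF *(3) mult.hyps(1)]]])
        (use * in \<open>auto intro: DERIV_mult\<close>)
  next
    case (comp f g)
    then obtain f' where f': "real_smooth f'" "\<And>t. (f has_real_derivative f' t) (at t)"
      by (metis real_smooth_deriv)
    obtain g' where g': "g' \<in> real_smooth_alg" "\<forall>t. (g has_real_derivative g' t) (at t)"
      using comp by blast
    show ?case
      by (rule bexI[OF _ real_smooth_alg.mult[OF real_smooth_alg.comp[OF f'(1) comp.hyps(2)] g'(1)]])
        (use f' g' in \<open>auto intro: DERIV_chain2\<close>)
  qed
qed

text \<open>The standard flat function \<open>exp (- (1 / t))\<close> times powers of
  \<open>1 / t\<close>: the functions its derivatives are made of.\<close>

definition flat :: "nat \<Rightarrow> real \<Rightarrow> real" where
  "flat k t = (if t \<le> 0 then 0 else (1 / t) ^ k * exp (- (1 / t)))"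

lemma flat_tendsto: "(flat k \<longlongrightarrow> 0) (at_right 0)"
proof -
  have "((\<lambda>t::real. (1 / t) ^ k / exp (1 / t)) \<longlongrightarrow> 0) (at_right 0)"
    by (rule filterlim_compose[OF tendsto_power_div_exp_0])
      (use filterlim_inverse_at_top_right in \<open>simp add: inverse_eq_divide\<close>)
  then show ?thesis
  proof (rule Lim_transform_eventually)
    show "\<forall>\<^sub>F t in at_right 0. (1 / t) ^ k / exp (1 / t) = flat k t"
      unfolding flat_def by (rule eventually_at_right_less[THEN eventually_mono]) (auto simp: exp_minus divide_inverse)
  qed
qed

lemma flat_deriv: "(flat k has_real_derivative (- real k * flat (k + 1) t + flat (k + 2) t)) (at t)"
proof -
  consider "t < 0" | "t = 0" | "t > 0" by linarith
  then show ?thesis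
  proof cases
    case 1
    have "((\<lambda>t. 0) has_real_derivative 0) (at t)" by simp
    then have "(flat k has_real_derivative 0) (at t)"
      by (rule has_field_derivative_transform_within_open[of _ _ _ "{..<0}"]) (use 1 in \<open>auto simp: flat_def\<close>)
    then show ?thesis using 1 by (simp add: flat_def)
  next
    case 3
    have "((\<lambda>t. (1 / t) ^ k * exp (- (1 / t))) has_real_derivative
        (- real k * flat (k + 1) t + flat (k + 2) t)) (at t)"
    proof -
      have pw: "k = 0 \<or> t ^ k = t * t ^ (k - Suc 0)"
        by (cases k) auto
      show ?thesis
        using 3 pw by (auto intro!: derivative_eq_intros simp: flat_def field_simps power2_eq_square)
    qed
    then show ?thesis
      by (rule has_field_derivative_transform_within_open[of _ _ _ "{0<..}"]) (use 3 in \<open>auto simp: flat_def\<close>)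
  next
    case 2
    \<comment> \<open>At 0 the right difference quotient of \<open>flat k\<close> is
      \<open>flat (k + 1)\<close>, which tends to 0; the left one is constantly 0.\<close>
    have r: "((\<lambda>h. (flat k (0 + h) - flat k 0) / h) \<longlongrightarrow> 0) (at_right 0)"
    proof (rule Lim_transform_eventually[OF flat_tendsto[of "k + 1"]])
      show "\<forall>\<^sub>F h in at_right 0. flat (k + 1) h = (flat k (0 + h) - flat k 0) / h"
        by (rule eventually_at_right_less[THEN eventually_mono]) (auto simp: flat_def)
    qed
    have "((\<lambda>h. 0) \<longlongrightarrow> (0::real)) (at_left (0::real))" by simp
    then have "((\<lambda>h. (flat k (0 + h) - flat k 0) / h) \<longlongrightarrow> 0) (at_left 0)"
    proof (rule Lim_transform_eventually)
      show "\<forall>\<^sub>F h in at_left (0::real). 0 = (flat k (0 + h) - flat k 0) / h"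
        by (rule eventually_at_left_real[of "-1" 0, THEN eventually_mono]) (auto simp: flat_def)
    qed
    then show ?thesis
      using r 2 by (simp add: DERIV_def filterlim_split_at flat_def)
  qed
qed

inductive_set flat_span :: "(real \<Rightarrow> real) set" where
  base: "flat k \<in> flat_span"
| add: "f \<in> flat_span \<Longrightarrow> g \<in> flat_span \<Longrightarrow> (\<lambda>t. f t + g t) \<in> flat_span"
| scale: "f \<in> flat_span \<Longrightarrow> (\<lambda>t. c * f t) \<in> flat_span"

lemma real_smooth_flat: "real_smooth (flat k)"
proof (rule real_smoothI[OF flat_span.base])
  fix u assume "u \<in> flat_span"
  then show "\<exists>u'\<in>flat_span. \<forall>t. (u has_real_derivative u' t) (at t)"
  proof (induction rule: flat_span.induct)
    case (base k)
    show ?case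
      by (rule bexI[OF _ flat_span.add[OF flat_span.scale[OF flat_span.base] flat_span.base]])
        (rule allI, rule flat_deriv)
  next
    case (add f g)
    then obtain f' g' where *: "f' \<in> flat_span" "\<forall>t. (f has_real_derivative f' t) (at t)"
      "g' \<in> flat_span" "\<forall>t. (g has_real_derivative g' t) (at t)" by blast
    show ?case
      by (rule bexI[OF _ flat_span.add[OF *(1,3)]]) (use * in \<open>auto intro: DERIV_add\<close>)
  next
    case (scale f c)
    then obtain f' where *: "f' \<in> flat_span" "\<forall>t. (f has_real_derivative f' t) (at t)" by blast
    show ?case
      by (rule bexI[OF _ flat_span.scale[OF *(1)]]) (use * in \<open>auto intro: DERIV_cmult\<close>)
  qed
qed

lemma flat_mono: "s \<le> t \<Longrightarrow> flat 0 s \<le> flat 0 t"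
  unfolding flat_def by (auto simp: frac_le)

lemma flat_pos: "t > 0 \<Longrightarrow> flat 0 t > 0" and flat_nonpos: "t \<le> 0 \<Longrightarrow> flat k t = 0"
  unfolding flat_def by auto

lemma real_bump:
  assumes "r > 0"
  shows "\<exists>w. real_smooth w \<and> (\<forall>t. \<bar>t - c\<bar> \<le> r / 2 \<longrightarrow> w t = 1) \<and> (\<forall>t. \<bar>t - c\<bar> \<ge> r \<longrightarrow> w t = 0)"
proof -
  \<comment> \<open>The inner \<open>flat\<close> is 0 for
    \<open>\<bar>t - c\<bar> \<le> r / 2\<close> and, by monotonicity, at least \<open>K\<close> for
    \<open>\<bar>t - c\<bar> \<ge> r\<close>. The outer one is therefore evaluated at
    \<open>K\<close> in the first case, whence the normalising constant, and at a nonpositive number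
    in the second.\<close>
  define K where "K = flat 0 (r\<^sup>2 - (r/2)\<^sup>2)"
  define w where "w t = inverse (flat 0 K) * flat 0 (K + - 1 * flat 0 ((t + - c) * (t + - c) + - ((r/2)\<^sup>2)))" for t
  have K: "K > 0"
    unfolding K_def using assms by (intro flat_pos) (simp add: power2_eq_square field_simps)
  have "w \<in> real_smooth_alg"
    unfolding w_def by (intro real_smooth_alg.comp[OF real_smooth_flat] real_smooth_alg.mult
        real_smooth_alg.add real_smooth_alg.const real_smooth_alg.ident)
  then have "real_smooth w" by (rule real_smooth_alg_smooth)
  moreover have "w t = 1" if "\<bar>t - c\<bar> \<le> r / 2" for t
  proof -
    have "(t - c)\<^sup>2 \<le> (r/2)\<^sup>2" using that by (metis abs_ge_zero power2_abs power_mono)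
    then have "flat 0 ((t + - c) * (t + - c) + - ((r/2)\<^sup>2)) = 0"
      by (intro flat_nonpos) (simp add: power2_eq_square)
    then show ?thesis using flat_pos[OF K] unfolding w_def by simp
  qed
  moreover have "w t = 0" if "\<bar>t - c\<bar> \<ge> r" for t
  proof -
    have "r\<^sup>2 \<le> (t - c)\<^sup>2" using that assms by (metis abs_ge_zero less_imp_le power2_abs power_mono)
    then have "K \<le> flat 0 ((t + - c) * (t + - c) + - ((r/2)\<^sup>2))"
      unfolding K_def by (intro flat_mono) (simp add: power2_eq_square)
    then show ?thesis unfolding w_def by (simp add: flat_nonpos)
  qed
  ultimately show ?thesis by blast
qed

context coordinate_domain
begin

text \<open>Differentiation in direction \<open>j\<close> replaces the factor \<open>w j\<close> by
  its derivative, so such products form a class for \<open>smooth_coinduct\<close>.\<close>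

lemma smooth_prod_real:
  assumes "\<And>i. real_smooth (w i)"
  shows "smooth_fun n V (\<lambda>x. \<Prod>i<n. w i (x i))"
proof (rule smooth_coinduct[of _ "{\<lambda>x. \<Prod>i<n. w i (x i) |w. \<forall>i. real_smooth (w i)}"])
  fix h assume "h \<in> {\<lambda>x. \<Prod>i<n. w i (x i) |w. \<forall>i. real_smooth (w i)}"
  then obtain w where w: "h = (\<lambda>x. \<Prod>i<n. w i (x i))" "\<And>i. real_smooth (w i)" by auto
  have cont: "continuous_on UNIV (w i)" for i
  proof -
    obtain w' where "\<And>t. (w i has_real_derivative w' t) (at t)"
      using real_smooth_deriv[OF w(2)] by blast
    then show ?thesis
      by (intro continuous_at_imp_continuous_on ballI DERIV_isCont)
  qed
  show "continuous_on V h"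
    unfolding w(1)
    by (intro continuous_on_prod continuous_on_compose2[OF cont]
        continuous_on_subset[OF continuous_on_product_coordinates]) auto
  fix j assume j: "j < n"
  obtain w' where w': "real_smooth w'" "\<And>t. (w j has_real_derivative w' t) (at t)"
    using real_smooth_deriv[OF w(2)] by blast
  have split: "(\<Prod>i<n. u i (x i)) = u j (x j) * (\<Prod>i\<in>{..<n} - {j}. u i (x i))" for u and x :: "nat \<Rightarrow> real"
    using j by (simp add: prod.remove)
  have "has_partial j h x (\<Prod>i<n. (w(j := w')) i (x i))" for x
  proof -
    have "((\<lambda>t. w j t * (\<Prod>i\<in>{..<n} - {j}. w i (x i))) has_real_derivative
        w' (x j) * (\<Prod>i\<in>{..<n} - {j}. w i (x i))) (at (x j))"
      by (intro DERIV_cmult_right w'(2))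
    moreover have "(\<Prod>i\<in>{..<n} - {j}. w i ((x(j := t)) i)) = (\<Prod>i\<in>{..<n} - {j}. w i (x i))" for t
      by (intro prod.cong) auto
    moreover have "(\<Prod>i\<in>{..<n} - {j}. (w(j := w')) i (x i)) = (\<Prod>i\<in>{..<n} - {j}. w i (x i))"
      by (intro prod.cong) auto
    ultimately show ?thesis
      unfolding has_partial_def w(1) split by simp
  qed
  then show "\<exists>h'\<in>{\<lambda>x. \<Prod>i<n. w i (x i) |w. \<forall>i. real_smooth (w i)}. \<forall>x\<in>V. has_partial j h x (h' x)"
    using w(2) w'(1) by (intro bexI[of _ "\<lambda>x. \<Prod>i<n. (w(j := w')) i (x i)"]) auto
qed (use assms in blast)

lemma bump:
  assumes "r > 0"
  shows "\<exists>\<phi>. smooth_fun n V \<phi> \<and> (\<forall>y. (\<forall>i<n. \<bar>y i - x i\<bar> \<le> r / 2) \<longrightarrow> \<phi> y = 1) \<and>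
    (\<forall>y. (\<exists>i<n. \<bar>y i - x i\<bar> \<ge> r) \<longrightarrow> \<phi> y = 0)"
proof -
  have "\<forall>i. \<exists>w. real_smooth w \<and> (\<forall>t. \<bar>t - x i\<bar> \<le> r / 2 \<longrightarrow> w t = 1) \<and>
      (\<forall>t. \<bar>t - x i\<bar> \<ge> r \<longrightarrow> w t = 0)"
    by (intro allI real_bump assms)
  from choice[OF this] obtain w where w: "\<And>i. real_smooth (w i)"
    "\<And>i t. \<bar>t - x i\<bar> \<le> r / 2 \<Longrightarrow> w i t = 1" "\<And>i t. \<bar>t - x i\<bar> \<ge> r \<Longrightarrow> w i t = 0"
    by blast
  show ?thesis
    by (intro exI[of _ "\<lambda>y. \<Prod>i<n. w i (y i)"] conjI smooth_prod_real w(1))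
      (auto simp: w(2), metis w(3) lessThan_iff)
qed

lemma base_point_continuous: "continuous_on UNIV (base_point n)"
  unfolding base_point_def
proof (rule continuous_on_coordinatewise_then_product)
  show "continuous_on UNIV (\<lambda>z::nat \<Rightarrow> real. if i < n then z i else 0)" for i
    by (cases "i < n") (simp_all add: continuous_on_product_coordinates)
qed

lemma base_point_V: "x \<in> V \<Longrightarrow> base_point n x = x"
  using V_zero by (auto simp: base_point_def)

text \<open>A point of \<open>V\<close> has zero entries from index \<open>n\<close> on, so it is a
  cotangent point with momentum 0: this is the zero section.\<close>

lemma V_subset_cotangent: "V \<subseteq> cotangent n V"
  using V_zero base_point_V by (auto simp: cotangent_def topspace_Euclidean_space)

lemma coordinate_domain_cotangent: "coordinate_domain (2 * n) (cotangent n V)"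
proof
  obtain T where T: "open T" "V = {x. \<forall>i\<ge>n. x i = 0} \<inter> T"
    using open_V' by (auto simp: openin_open)
  have "cotangent n V = {x. \<forall>i\<ge>2 * n. x i = 0} \<inter> base_point n -` T"
    unfolding cotangent_def T(2) topspace_Euclidean_space by (auto simp: base_point_def)
  moreover have "open (base_point n -` T)"
    using base_point_continuous T(1) by (simp add: continuous_on_open_vimage)
  ultimately show "openin (Euclidean_space (2 * n)) (cotangent n V)"
    unfolding Euclidean_space_eq openin_open by blast
qed

lemma base_point_upd: "base_point n (z(i := t)) = (if i < n then (base_point n z)(i := t) else base_point n z)"
  by (auto simp: base_point_def)

lemma has_partial_pull:
  assumes "z \<in> cotangent n V" "smooth_fun n V f"
  shows "has_partial i (\<lambda>z. f (base_point n z)) z (if i < n then partial i f (base_point n z) else 0)"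
proof (cases "i < n")
  case True
  have "base_point n z \<in> V" using assms(1) by (simp add: cotangent_def)
  from smooth_has_partial[OF assms(2) this True] show ?thesis
    using True unfolding has_partial_def base_point_upd by (simp add: base_point_def)
next
  case False
  then show ?thesis unfolding has_partial_def base_point_upd by simp
qed

lemma smooth_pull:
  assumes "smooth_fun n V f"
  shows "smooth_fun (2 * n) (cotangent n V) (\<lambda>z. f (base_point n z))"
proof (rule coordinate_domain.smooth_coinduct[OF coordinate_domain_cotangent,
      of _ "{\<lambda>z. f (base_point n z) |f. smooth_fun n V f}"])
  fix h assume "h \<in> {\<lambda>z. f (base_point n z) |f. smooth_fun n V f}"
  then obtain f where f: "h = (\<lambda>z. f (base_point n z))" "smooth_fun n V f" by auto
  show "continuous_on (cotangent n V) h"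
    unfolding f(1)
    by (rule continuous_on_compose2[OF smooth_continuous[OF f(2)]
          continuous_on_subset[OF base_point_continuous]]) (auto simp: cotangent_def)
  fix i
  show "\<exists>h'\<in>{\<lambda>z. f (base_point n z) |f. smooth_fun n V f}. \<forall>z\<in>cotangent n V. has_partial i h z (h' z)"
  proof (cases "i < n")
    case True
    then show ?thesis
      using has_partial_pull[OF _ f(2), of _ i] smooth_partial[OF f(2)] f(1)
      by (intro bexI[of _ "\<lambda>z. partial i f (base_point n z)"]) auto
  next
    case False
    then show ?thesis
      using has_partial_pull[OF _ f(2), of _ i] smooth_const[of 0] f(1)
      by (intro bexI[of _ "\<lambda>z. 0"]) auto
  qed
qed (use assms in blast)

end

section \<open>Derivations of superfunctions\<close>

lemma shuffle_sign_insert_left: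
  assumes "finite B" "finite C" "j \<notin> B"
  shows "shuffle_sign (insert j B) C = shuffle_sign B C * (-1) ^ card {c \<in> C. c < j}"
proof -
  have "{(a, c). a \<in> {j} \<and> c \<in> C \<and> c < a} = Pair j ` {c \<in> C. c < j}" by auto
  then have "shuffle_sign {j} C = (-1) ^ card {c \<in> C. c < j}"
    unfolding shuffle_sign_def by (simp add: card_image inj_on_def)
  then show ?thesis
    using shuffle_sign_Un_left[of B "{j}" C] assms by simp
qed

lemma shuffle_sign_insert_right:
  assumes "finite B" "finite C" "j \<notin> C"
  shows "shuffle_sign B (insert j C) = shuffle_sign B C * (-1) ^ card {b \<in> B. j < b}"
proof -
  have "{(a, c). a \<in> B \<and> c \<in> {j} \<and> c < a} = (\<lambda>b. (b, j)) ` {b \<in> B. j < b}" by auto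
  then have "shuffle_sign B {j} = (-1) ^ card {b \<in> B. j < b}"
    unfolding shuffle_sign_def by (simp add: card_image inj_on_def)
  then show ?thesis
    using shuffle_sign_Un_right[of B C "{j}"] assms by simp
qed

lemma card_less_greater:
  assumes "finite B" "j \<notin> B" shows "card {b \<in> B. b < (j::nat)} + card {b \<in> B. j < b} = card B"
proof -
  have "B = {b \<in> B. b < j} \<union> {b \<in> B. j < b}" using assms(2) by (auto, metis linorder_neqE_nat)
  moreover have "card ({b \<in> B. b < j} \<union> {b \<in> B. j < b}) = card {b \<in> B. b < j} + card {b \<in> B. j < b}"
    by (rule card_Un_disjoint) (use assms in auto)
  ultimately show ?thesis by simp
qed

lemma sum_Pow_insert:
  fixes f :: "'a set \<Rightarrow> 'b::comm_monoid_add"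
  assumes "finite A" "j \<notin> A"
  shows "(\<Sum>B\<in>Pow (insert j A). f B) = (\<Sum>B\<in>Pow A. f B) + (\<Sum>B\<in>Pow A. f (insert j B))"
proof -
  have "inj_on (insert j) (Pow A)"
    using assms(2) by (auto simp: inj_on_def)
  moreover have "Pow A \<inter> insert j ` Pow A = {}"
    using assms(2) by auto
  ultimately show ?thesis
    using assms(1) by (simp add: Pow_insert sum.union_disjoint sum.reindex)
qed

definition deriv_sfn :: "(nat \<Rightarrow> real) set \<Rightarrow> coord_index \<Rightarrow> sfn \<Rightarrow> sfn" where
  "deriv_sfn V a F = Sfn (sderiv V a (coef F))"

lemma coeff_deriv_sfn: "coef (deriv_sfn V a F) = sderiv V a (coef F)"
  unfolding deriv_sfn_def by (rule coeff_Sfn) (cases a; auto simp: partial_def fun_eq_iff)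

locale superdomain_alg = coordinate_domain n V for n V +
  fixes m :: nat
begin

abbreviation "R \<equiv> sfun_alg n m V"

definition Cs :: "sfn set" where "Cs = {F. coef F \<in> carrier R}"
definition Hs :: "nat \<Rightarrow> sfn set" where "Hs p = {F. coef F \<in> homog R p}"

lemma carrier_iff: "f \<in> carrier R \<longleftrightarrow> (\<forall>A. \<not> A \<subseteq> {..<m} \<longrightarrow> f A = (\<lambda>x. 0)) \<and>
    (\<forall>A x. x \<notin> V \<longrightarrow> f A x = 0) \<and> (\<forall>A. smooth_fun n V (f A))"
  unfolding sfun_alg_def Let_def by simp

lemma homog_iff: "f \<in> homog R p \<longleftrightarrow> f \<in> carrier R \<and> (\<forall>A. even (card A) \<noteq> even p \<longrightarrow> f A = (\<lambda>x. 0))"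
  unfolding homog_def sfun_alg_def Let_def by auto

lemma CsI:
  assumes "\<And>A x. \<not> A \<subseteq> {..<m} \<Longrightarrow> coef F A x = 0" "\<And>A x. x \<notin> V \<Longrightarrow> coef F A x = 0"
    "\<And>A. A \<subseteq> {..<m} \<Longrightarrow> smooth_fun n V (coef F A)"
  shows "F \<in> Cs"
proof -
  have "smooth_fun n V (coef F A)" for A
  proof (cases "A \<subseteq> {..<m}")
    case False
    then have "coef F A = (\<lambda>x. 0)" using assms(1) by blast
    then show ?thesis using smooth_const[of 0] by simp
  qed (rule assms(3))
  then show ?thesis
    unfolding Cs_def carrier_iff using assms(1,2) by (simp add: fun_eq_iff)
qed

lemma Cs_D:
  assumes "F \<in> Cs"
  shows "\<not> A \<subseteq> {..<m} \<Longrightarrow> coef F A x = 0" "x \<notin> V \<Longrightarrow> coef F A x = 0" "smooth_fun n V (coef F A)"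
  using assms unfolding Cs_def carrier_iff by auto

lemma Hs_iff: "F \<in> Hs p \<longleftrightarrow> F \<in> Cs \<and> (\<forall>A x. even (card A) \<noteq> even p \<longrightarrow> coef F A x = 0)"
  unfolding Hs_def Cs_def homog_iff by (auto simp: fun_eq_iff)

lemma Hs_Cs: "F \<in> Hs p \<Longrightarrow> F \<in> Cs"
  by (simp add: Hs_iff)

lemma Cs_zero: "0 \<in> Cs"
  by (rule CsI) (auto simp: coeff_simps[abs_def] smooth_const)

lemma Cs_add: "F \<in> Cs \<Longrightarrow> G \<in> Cs \<Longrightarrow> F + G \<in> Cs"
  by (rule CsI) (auto simp: coeff_simps[abs_def] Cs_D smooth_add)

lemma Cs_scale: "F \<in> Cs \<Longrightarrow> r *\<^sub>R F \<in> Cs"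
  by (rule CsI) (auto simp: coeff_simps[abs_def] Cs_D smooth_scale)

lemma Cs_mult:
  assumes F: "F \<in> Cs" and G: "G \<in> Cs" shows "F * G \<in> Cs"
proof (rule CsI)
  show "coef (F * G) A x = 0" if "\<not> A \<subseteq> {..<m}" for A x
    unfolding coeff_mult
  proof (intro sum.neutral ballI)
    fix B assume "B \<in> Pow A"
    then have "\<not> B \<subseteq> {..<m} \<or> \<not> A - B \<subseteq> {..<m}" using that by auto
    then show "shuffle_sign B (A - B) * coef F B x * coef G (A - B) x = 0"
      using Cs_D(1)[OF F, of B x] Cs_D(1)[OF G, of "A - B" x] by (elim disjE) simp_all
  qed
  show "coef (F * G) A x = 0" if "x \<notin> V" for A x
    unfolding coeff_mult using Cs_D(2)[OF F that] by simp
  show "smooth_fun n V (coef (F * G) A)" for A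
    unfolding coeff_mult[abs_def]
    by (intro smooth_sum smooth_mult smooth_scale Cs_D F G)
qed

lemma Hs_mult:
  assumes F: "F \<in> Hs p" and G: "G \<in> Hs q" shows "F * G \<in> Hs (p + q)"
  unfolding Hs_iff
proof (intro conjI allI impI)
  show "F * G \<in> Cs" using F G by (intro Cs_mult Hs_Cs)
  fix A :: "nat set" and x assume A: "even (card A) \<noteq> even (p + q)"
  show "coef (F * G) A x = 0"
  proof (cases "finite A")
    case True
    show ?thesis
      unfolding coeff_mult
    proof (intro sum.neutral ballI)
      fix B assume "B \<in> Pow A"
      then have "card A = card B + card (A - B)"
        using True by (metis Pow_iff card_Diff_subset card_mono finite_subset le_add_diff_inverse)
      then have "even (card B) \<noteq> even p \<or> even (card (A - B)) \<noteq> even q" using A by auto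
      then show "shuffle_sign B (A - B) * coef F B x * coef G (A - B) x = 0"
        using F G unfolding Hs_iff by auto
    qed
  qed simp
qed

text \<open>Passing from \<open>B\<close> to \<open>A - B\<close> exchanges the two factors at the
  cost of \<open>shuffle_sign_swap\<close>. In a nonzero term the cardinalities have parities
  \<open>p\<close> and \<open>q\<close>, which fixes the sign.\<close>

lemma Hs_comm:
  assumes F: "F \<in> Hs p" and G: "G \<in> Hs q" shows "F * G = (-1) ^ (p * q) *\<^sub>R (G * F)"
proof (rule sfn_eqI)
  fix A :: "nat set" and x assume A: "finite A"
  have "coef (F * G) A x = (\<Sum>B\<in>Pow A. (-1) ^ (p * q) * (shuffle_sign B (A - B) * coef G B x * coef F (A - B) x))"
    unfolding coeff_mult
  proof (rule sum.reindex_bij_witness[of _ "\<lambda>B. A - B" "\<lambda>B. A - B"])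
    fix B assume B: "B \<in> Pow A"
    then have BA: "A - (A - B) = B" by auto
    have sw: "shuffle_sign (A - B) B = (-1) ^ (card B * card (A - B)) * shuffle_sign B (A - B)"
      by (rule shuffle_sign_swap) (use A B in \<open>auto intro: finite_subset\<close>)
    show "(-1) ^ (p * q) * (shuffle_sign (A - B) (A - (A - B)) * coef G (A - B) x * coef F (A - (A - B)) x) =
        shuffle_sign B (A - B) * coef F B x * coef G (A - B) x"
    proof (cases "even (card B) = even p \<and> even (card (A - B)) = even q")
      case True
      then have "(-1::real) ^ (card B * card (A - B)) = (-1) ^ (p * q)"
        by (intro minus_one_power_cong) auto
      then show ?thesis unfolding BA sw by (simp add: mult.assoc[symmetric] flip: power_add)
    next
      case False
      then have "coef F B x = 0 \<or> coef G (A - B) x = 0"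
        using F G unfolding Hs_iff by auto
      then show ?thesis unfolding BA by auto
    qed
  qed auto
  then show "coef (F * G) A x = coef ((-1) ^ (p * q) *\<^sub>R (G * F)) A x"
    by (simp add: coeff_simps coeff_mult sum_distrib_left)
qed

lemma Cs_split:
  assumes F: "F \<in> Cs" shows "\<exists>U\<in>Hs 0. \<exists>W\<in>Hs 1. F = U + W"
proof -
  define U where "U = Sfn (\<lambda>A. if even (card A) then coef F A else (\<lambda>x. 0))"
  define W where "W = Sfn (\<lambda>A. if odd (card A) then coef F A else (\<lambda>x. 0))"
  have c: "coef U A = (if even (card A) then coef F A else (\<lambda>x. 0))"
    "coef W A = (if odd (card A) then coef F A else (\<lambda>x. 0))" for A
    unfolding U_def W_def by (subst coeff_Sfn; simp)+
  have "U \<in> Cs" "W \<in> Cs"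
    by (rule CsI; simp add: c Cs_D[OF F] smooth_const)+
  then have "U \<in> Hs 0" "W \<in> Hs 1"
    unfolding Hs_iff by (auto simp: c)
  moreover have "F = U + W"
    by (rule sfn_eqI) (auto simp: coeff_simps c)
  ultimately show ?thesis by blast
qed

text \<open>Set to 0 outside \<open>V\<close>, in line with the convention for coefficients, so that
  the rules below hold at every point.\<close>

definition pd :: "nat \<Rightarrow> ((nat \<Rightarrow> real) \<Rightarrow> real) \<Rightarrow> (nat \<Rightarrow> real) \<Rightarrow> real" where
  "pd i f x = (if x \<in> V then partial i f x else 0)"

lemma pd_smooth: "i < n \<Longrightarrow> smooth_fun n V f \<Longrightarrow> smooth_fun n V (pd i f)"
  by (rule smooth_cong[OF smooth_partial]) (auto simp: pd_def)

lemma pd_eqI: "(x \<in> V \<Longrightarrow> has_partial i f x d) \<Longrightarrow> (x \<notin> V \<Longrightarrow> d = 0) \<Longrightarrow> pd i f x = d"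
  unfolding pd_def using has_partial_imp by auto

lemma pd_has_partial: "smooth_fun n V f \<Longrightarrow> i < n \<Longrightarrow> x \<in> V \<Longrightarrow> has_partial i f x (pd i f x)"
  unfolding pd_def using smooth_has_partial by simp

lemma pd_zero: "pd i (\<lambda>x. 0) x = 0"
  by (rule pd_eqI) (auto intro: has_partial_const)

lemma pd_add: "i < n \<Longrightarrow> smooth_fun n V f \<Longrightarrow> smooth_fun n V g \<Longrightarrow>
    pd i (\<lambda>x. f x + g x) x = pd i f x + pd i g x"
  by (rule pd_eqI, intro has_partial_add pd_has_partial; assumption?) (simp add: pd_def)

lemma pd_scale: "i < n \<Longrightarrow> smooth_fun n V f \<Longrightarrow> pd i (\<lambda>x. c * f x) x = c * pd i f x"
  using has_partial_mult[OF has_partial_const pd_has_partial, of f i x c]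
  by (intro pd_eqI) (auto simp: pd_def[of _ _ x])

lemma pd_mult: "i < n \<Longrightarrow> smooth_fun n V f \<Longrightarrow> smooth_fun n V g \<Longrightarrow>
    pd i (\<lambda>x. f x * g x) x = pd i f x * g x + f x * pd i g x"
  by (rule pd_eqI, intro has_partial_mult pd_has_partial; assumption?) (simp add: pd_def)

lemma pd_sum: "i < n \<Longrightarrow> (\<And>j. j \<in> J \<Longrightarrow> smooth_fun n V (f j)) \<Longrightarrow>
    pd i (\<lambda>x. \<Sum>j\<in>J. f j x) x = (\<Sum>j\<in>J. pd i (f j) x)"
  by (induction J rule: infinite_finite_induct) (auto simp: pd_zero pd_add smooth_sum)

lemma pd_commute:
  assumes "i < n" "j < n" "smooth_fun n V f" shows "pd i (pd j f) x = pd j (pd i f) x"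
proof (cases "x \<in> V")
  case True
  have "partial i (pd j f) x = partial i (partial j f) x" "partial j (pd i f) x = partial j (partial i f) x"
    by (rule partial_cong; use True assms in \<open>simp add: pd_def\<close>)+
  then show ?thesis
    using partial_commute[OF assms(3) True assms(1,2)] by (simp add: pd_def[of _ _ x])
qed (simp add: pd_def[of _ _ x])

lemma coeff_Ev: "coef (deriv_sfn V (Ev i) F) A x = pd i (coef F A) x"
  unfolding coeff_deriv_sfn pd_def by simp

lemma coeff_Od: "coef (deriv_sfn V (Od j) F) A x =
    (if j \<in> A then 0 else (-1) ^ card {k \<in> A. k < j} * coef F (insert j A) x)"
  unfolding coeff_deriv_sfn by simp

lemma coords_cases:
  assumes "a \<in> coords n m"
  obtains i where "a = Ev i" "i < n" | j where "a = Od j" "j < m"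
  using assms unfolding coords_def by auto

lemma deriv_Cs:
  assumes a: "a \<in> coords n m" and F: "F \<in> Cs" shows "deriv_sfn V a F \<in> Cs"
  using a
proof (cases rule: coords_cases)
  case (1 i)
  show ?thesis
    unfolding 1
  proof (rule CsI)
    show "coef (deriv_sfn V (Ev i) F) A x = 0" if "\<not> A \<subseteq> {..<m}" for A x
      using Cs_D(1)[OF F that] unfolding coeff_Ev by (simp add: ext[of "coef F A" "\<lambda>x. 0"] pd_zero)
    show "coef (deriv_sfn V (Ev i) F) A x = 0" if "x \<notin> V" for A x
      using that by (simp add: coeff_Ev pd_def)
    show "smooth_fun n V (coef (deriv_sfn V (Ev i) F) A)" for A
      unfolding coeff_Ev[abs_def] using pd_smooth[OF 1(2) Cs_D(3)[OF F]] by simp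
  qed
next
  case (2 j)
  show ?thesis
    unfolding 2
  proof (rule CsI)
    show "coef (deriv_sfn V (Od j) F) A x = 0" if "\<not> A \<subseteq> {..<m}" for A x
      using Cs_D(1)[OF F, of "insert j A" x] that by (simp add: coeff_Od)
    show "coef (deriv_sfn V (Od j) F) A x = 0" if "x \<notin> V" for A x
      using Cs_D(2)[OF F that] by (simp add: coeff_Od)
    show "smooth_fun n V (coef (deriv_sfn V (Od j) F) A)" for A
      by (cases "j \<in> A")
        (simp_all add: coeff_Od[abs_def] smooth_const smooth_scale Cs_D[OF F])
  qed
qed

lemma deriv_Hs:
  assumes a: "a \<in> coords n m" and F: "F \<in> Hs p" shows "deriv_sfn V a F \<in> Hs (parity a + p)"
  unfolding Hs_iff
proof (intro conjI allI impI)
  show "deriv_sfn V a F \<in> Cs" using deriv_Cs a Hs_Cs[OF F] .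
  fix A :: "nat set" and x assume A: "even (card A) \<noteq> even (parity a + p)"
  show "coef (deriv_sfn V a F) A x = 0"
    using a
  proof (cases rule: coords_cases)
    case (1 i)
    then have "coef F A = (\<lambda>x. 0)" using F A unfolding Hs_iff by auto
    then show ?thesis by (simp add: 1 coeff_Ev pd_zero)
  next
    case (2 j)
    show ?thesis
    proof (cases "finite A \<and> j \<notin> A")
      case True
      then have "card (insert j A) = Suc (card A)" by simp
      then have "even (card (insert j A)) \<noteq> even p" using A 2 by simp
      then show ?thesis using F unfolding Hs_iff 2 by (simp add: coeff_Od)
    qed (auto simp: 2 coeff_Od)
  qed
qed

lemma deriv_add:
  "a \<in> coords n m \<Longrightarrow> F \<in> Cs \<Longrightarrow> G \<in> Cs \<Longrightarrow> deriv_sfn V a (F + G) = deriv_sfn V a F + deriv_sfn V a G"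
  by (rule sfn_eqI, erule coords_cases)
    (auto simp: coeff_Ev coeff_Od coeff_simps coeff_simps[abs_def] pd_add Cs_D algebra_simps)

lemma deriv_scale:
  "a \<in> coords n m \<Longrightarrow> F \<in> Cs \<Longrightarrow> deriv_sfn V a (r *\<^sub>R F) = r *\<^sub>R deriv_sfn V a F"
  by (rule sfn_eqI, erule coords_cases)
    (auto simp: coeff_Ev coeff_Od coeff_simps coeff_simps[abs_def] pd_scale Cs_D)

text \<open>For an odd variable the coefficient at \<open>A\<close> depends on whether
  \<open>j\<close> lies in \<open>A\<close>. If it does, the left side is 0 and on the right the
  contributions of \<open>B\<close> and \<open>insert j B\<close> cancel in pairs. If not, the
  subsets of \<open>insert j A\<close> with and without \<open>j\<close> yield the two terms of the
  rule.\<close>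

lemma deriv_mult:
  assumes a: "a \<in> coords n m" and F: "F \<in> Hs p" and G: "G \<in> Cs"
  shows "deriv_sfn V a (F * G) = deriv_sfn V a F * G + (-1) ^ (parity a * p) *\<^sub>R (F * deriv_sfn V a G)"
proof (rule sfn_eqI)
  fix A :: "nat set" and x assume A: "finite A"
  have FC: "F \<in> Cs" using F by (rule Hs_Cs)
  show "coef (deriv_sfn V a (F * G)) A x =
      coef (deriv_sfn V a F * G + (-1) ^ (parity a * p) *\<^sub>R (F * deriv_sfn V a G)) A x"
    using a
  proof (cases rule: coords_cases)
    case (1 i)
    have "pd i (\<lambda>x. shuffle_sign B (A - B) * coef F B x * coef G (A - B) x) x =
        shuffle_sign B (A - B) * pd i (coef F B) x * coef G (A - B) x +
        shuffle_sign B (A - B) * coef F B x * pd i (coef G (A - B)) x" for B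
      using 1 by (subst pd_mult) (auto simp: pd_scale Cs_D FC G smooth_scale)
    then show ?thesis
      using 1 by (simp add: coeff_Ev coeff_simps coeff_mult coeff_mult[abs_def] pd_sum smooth_mult smooth_scale
          Cs_D FC G sum.distrib)
  next
    case (2 j)
    \<comment> \<open>Wherever \<open>F\<close> has a nonzero coefficient, the number of odd
      variables passed has the parity of \<open>F\<close>.\<close>
    have Fp: "coef F B x * (-1) ^ card B = coef F B x * (-1) ^ p" for B
      using F unfolding Hs_iff by (cases "even (card B) = even p") (auto simp: minus_one_power_iff)
    have sq: "(-1::real) ^ k * (-1) ^ k = 1" for k
      by (simp flip: power_add)
    show ?thesis
    proof (cases "j \<in> A")
      case True
      define A0 where "A0 = A - {j}"
      have A0: "A = insert j A0" "j \<notin> A0" "finite A0" unfolding A0_def using True A by auto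
      have "shuffle_sign B (insert j (A0 - B)) * coef (deriv_sfn V (Od j) F) B x * coef G (insert j (A0 - B)) x +
          (-1) ^ p * (shuffle_sign (insert j B) (A0 - B) * coef F (insert j B) x * coef (deriv_sfn V (Od j) G) (A0 - B) x) = 0"
        if "B \<in> Pow A0" for B
      proof -
        have B: "j \<notin> B" "finite B" "finite (A0 - B)" "j \<notin> A0 - B"
          using that A0 finite_subset by auto
        have "(-1::real) ^ card {b \<in> B. j < b} * (-1) ^ card {b \<in> B. b < j} = (-1) ^ card B"
          using card_less_greater[OF B(2,1)] by (simp add: add.commute flip: power_add)
        moreover have "(-1) ^ p * coef F (insert j B) x = - ((-1) ^ card B * coef F (insert j B) x)"
          using Fp[of "insert j B"] B by (simp add: mult.commute)
        moreover have "shuffle_sign B (insert j (A0 - B)) * coef (deriv_sfn V (Od j) F) B x * coef G (insert j (A0 - B)) x +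
          (-1) ^ p * (shuffle_sign (insert j B) (A0 - B) * coef F (insert j B) x * coef (deriv_sfn V (Od j) G) (A0 - B) x) =
          shuffle_sign B (A0 - B) * coef G (insert j (A0 - B)) x *
            (((-1) ^ card {b \<in> B. j < b} * (-1) ^ card {b \<in> B. b < j}) * coef F (insert j B) x
             + ((-1) ^ card {c \<in> A0 - B. c < j} * (-1) ^ card {c \<in> A0 - B. c < j}) * ((-1) ^ p * coef F (insert j B) x))"
          using B by (simp add: coeff_Od shuffle_sign_insert_left shuffle_sign_insert_right distrib_left mult_ac)
        ultimately show ?thesis
          by (simp add: sq)
      qed
      note * = this
      have sets: "insert j A0 - B = insert j (A0 - B)" "A0 - insert j B = A0 - B" if "B \<in> Pow A0" for B
        using that A0 by auto
      have z: "coef (deriv_sfn V (Od j) H) (insert j B) x = 0" for H B by (simp add: coeff_Od)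
      have "coef (deriv_sfn V (Od j) F * G + (-1) ^ p *\<^sub>R (F * deriv_sfn V (Od j) G)) A x =
        (\<Sum>B\<in>Pow A0. shuffle_sign B (insert j (A0 - B)) * coef (deriv_sfn V (Od j) F) B x * coef G (insert j (A0 - B)) x +
          (-1) ^ p * (shuffle_sign (insert j B) (A0 - B) * coef F (insert j B) x * coef (deriv_sfn V (Od j) G) (A0 - B) x))"
        unfolding A0(1) coeff_simps coeff_mult sum_Pow_insert[OF A0(3,2)]
        by (simp add: sets z sum.distrib sum_distrib_left)
      also have "\<dots> = 0" by (simp add: * sum.neutral)
      finally show ?thesis using True by (simp add: 2 coeff_Od)
    next
      case False
      have *: "(-1) ^ card {k \<in> A. k < j} * (shuffle_sign B (insert j (A - B)) * coef F B x * coef G (insert j (A - B)) x) =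
          (-1) ^ p * (shuffle_sign B (A - B) * coef F B x * coef (deriv_sfn V (Od j) G) (A - B) x)"
        "(-1) ^ card {k \<in> A. k < j} * (shuffle_sign (insert j B) (A - B) * coef F (insert j B) x * coef G (A - B) x) =
          shuffle_sign B (A - B) * coef (deriv_sfn V (Od j) F) B x * coef G (A - B) x"
        if "B \<in> Pow A" for B
      proof -
        have B: "j \<notin> B" "finite B" "finite (A - B)" "j \<notin> A - B"
          using that A False finite_subset by auto
        have "card ({k \<in> B. k < j} \<union> {k \<in> A - B. k < j}) = card {k \<in> B. k < j} + card {k \<in> A - B. k < j}"
          by (rule card_Un_disjoint) (use B in auto)
        moreover have "{k \<in> A. k < j} = {k \<in> B. k < j} \<union> {k \<in> A - B. k < j}"
          using that by auto
        ultimately have split: "(-1::real) ^ card {k \<in> A. k < j} =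
            (-1) ^ card {k \<in> B. k < j} * (-1) ^ card {k \<in> A - B. k < j}"
          by (simp add: power_add)
        have "(-1::real) ^ card {b \<in> B. b < j} * (-1) ^ card {b \<in> B. j < b} = (-1) ^ card B"
          using card_less_greater[OF B(2,1)] by (simp flip: power_add)
        then have c: "(-1) ^ card {b \<in> B. b < j} * ((-1) ^ card {b \<in> B. j < b} * coef F B x) = (-1) ^ p * coef F B x"
          using Fp[of B] by (simp add: mult.assoc[symmetric])
        show "(-1) ^ card {k \<in> A. k < j} * (shuffle_sign B (insert j (A - B)) * coef F B x * coef G (insert j (A - B)) x) =
          (-1) ^ p * (shuffle_sign B (A - B) * coef F B x * coef (deriv_sfn V (Od j) G) (A - B) x)"
        proof -
          have "(-1) ^ card {k \<in> A. k < j} * (shuffle_sign B (insert j (A - B)) * coef F B x * coef G (insert j (A - B)) x) =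
            ((-1) ^ card {b \<in> B. b < j} * ((-1) ^ card {b \<in> B. j < b} * coef F B x)) * shuffle_sign B (A - B) *
            ((-1) ^ card {k \<in> A - B. k < j} * coef G (insert j (A - B)) x)"
            unfolding split shuffle_sign_insert_right[OF B(2,3,4)] by (simp add: mult_ac)
          then show ?thesis unfolding c using B by (simp add: coeff_Od mult_ac)
        qed
        show "(-1) ^ card {k \<in> A. k < j} * (shuffle_sign (insert j B) (A - B) * coef F (insert j B) x * coef G (A - B) x) =
          shuffle_sign B (A - B) * coef (deriv_sfn V (Od j) F) B x * coef G (A - B) x"
          unfolding split shuffle_sign_insert_left[OF B(2,3,1)]
          using B sq[of "card {k \<in> A - B. k < j}"] by (simp add: coeff_Od mult_ac)
      qed
      have sets: "insert j A - B = insert j (A - B)" "insert j A - insert j B = A - B" if "B \<in> Pow A" for B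
        using that False by auto
      have "coef (deriv_sfn V (Od j) (F * G)) A x =
        (\<Sum>B\<in>Pow A. (-1) ^ card {k \<in> A. k < j} * (shuffle_sign B (insert j (A - B)) * coef F B x * coef G (insert j (A - B)) x)) +
        (\<Sum>B\<in>Pow A. (-1) ^ card {k \<in> A. k < j} * (shuffle_sign (insert j B) (A - B) * coef F (insert j B) x * coef G (A - B) x))"
        unfolding coeff_Od coeff_mult sum_Pow_insert[OF A False]
        using False by (simp add: sets distrib_left sum_distrib_left)
      also have "\<dots> = coef (deriv_sfn V (Od j) F * G + (-1) ^ p *\<^sub>R (F * deriv_sfn V (Od j) G)) A x"
        by (simp add: * coeff_simps coeff_mult sum_distrib_left)
      finally show ?thesis by (simp add: 2)
    qed
  qed
qed

text \<open>For two distinct odd variables, in exactly one of the two orders the smaller index is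
  counted among the entries below the larger one, whence the minus sign. For even variables this is
  the symmetry of second derivatives.\<close>

lemma deriv_comm:
  assumes a: "a \<in> coords n m" and b: "b \<in> coords n m" and F: "F \<in> Cs"
  shows "deriv_sfn V a (deriv_sfn V b F) = (-1) ^ (parity a * parity b) *\<^sub>R deriv_sfn V b (deriv_sfn V a F)"
proof (rule sfn_eqI)
  have EO: "deriv_sfn V (Ev i) (deriv_sfn V (Od j) F) = deriv_sfn V (Od j) (deriv_sfn V (Ev i) F)"
    if "i < n" for i j
    by (rule sfn_eqI) (use that in \<open>auto simp: coeff_Ev coeff_Od coeff_Od[abs_def] pd_zero pd_scale Cs_D F\<close>)
  fix A :: "nat set" and x assume A: "finite A"
  show "coef (deriv_sfn V a (deriv_sfn V b F)) A x =
      coef ((-1) ^ (parity a * parity b) *\<^sub>R deriv_sfn V b (deriv_sfn V a F)) A x"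
    using a
  proof (cases rule: coords_cases)
    case (1 i)
    from b show ?thesis
    proof (cases rule: coords_cases)
      case b1: (1 j)
      then show ?thesis
        using 1 pd_commute[OF 1(2) b1(2) Cs_D(3)[OF F]] by (simp add: coeff_Ev coeff_Ev[abs_def])
    qed (use 1 EO in simp)
  next
    case (2 i)
    from b show ?thesis
    proof (cases rule: coords_cases)
      case b2: (2 j)
      have ins: "card {k \<in> insert u A. k < w} = (if u < w then Suc (card {k \<in> A. k < w}) else card {k \<in> A. k < w})"
        if "u \<notin> A" for u w :: nat
      proof (cases "u < w")
        case True
        then have "{k \<in> insert u A. k < w} = insert u {k \<in> A. k < w}" by auto
        then show ?thesis using True that A by simp
      next
        case False
        then have "{k \<in> insert u A. k < w} = {k \<in> A. k < w}" by auto
        then show ?thesis using False by simp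
      qed
      show ?thesis
        unfolding 2(1) b2(1) coeff_simps coeff_Od
        by (cases "i = j") (auto simp: ins[unfolded insert_iff] insert_commute neq_iff)
    qed (use 2 EO in simp)
  qed
qed

text \<open>The index map \<open>\<phi>\<close> lets one theorem cover the position derivatives,
  with the identity, and the momentum derivatives, with \<open>mom_index n m\<close>.\<close>

theorem super_differential_deriv:
  assumes "finite I" "\<And>a. a \<in> I \<Longrightarrow> \<phi> a \<in> coords n m" "\<And>a. a \<in> I \<Longrightarrow> par a = parity (\<phi> a)"
  shows "super_differential Hs Cs I par (\<lambda>a. deriv_sfn V (\<phi> a))"
proof
  show "f \<in> Hs q" if "f \<in> Hs p" "even p = even q" for f p q using that by (simp add: Hs_iff)
  show "0 \<in> Hs p" for p by (simp add: Hs_iff Cs_zero coeff_simps)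
  show "f + g \<in> Hs p" if "f \<in> Hs p" "g \<in> Hs p" for f g p
    using that by (simp add: Hs_iff Cs_add coeff_simps)
  show "r *\<^sub>R f \<in> Hs p" if "f \<in> Hs p" for f r p
    using that by (simp add: Hs_iff Cs_scale coeff_simps)
  show "\<exists>u\<in>Hs 0. \<exists>v\<in>Hs 1. f = u + v" if "f \<in> Cs" for f
    by (rule Cs_split[OF that])
qed (use assms in \<open>auto intro: Hs_Cs Hs_mult Hs_comm Cs_add Cs_scale Cs_mult deriv_Cs deriv_Hs
    deriv_add deriv_scale deriv_mult deriv_comm\<close>)

end

section \<open>Passing from records of functions to the type of superfunctions\<close>

context superdomain_alg
begin

text \<open>
  Finite sums and additive inverses in a record are meaningful only on its carrier, so passing from
  \<^const>\<open>sfun_alg\<close> to the type \<^typ>\<open>sfn\<close> is expressed by a relation that includes membership.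
\<close>

definition rep :: "sfun \<Rightarrow> sfn \<Rightarrow> bool" where
  "rep f F \<longleftrightarrow> f \<in> carrier R \<and> coef F = f"

lemma rep_Cs: "rep f F \<Longrightarrow> F \<in> Cs"
  unfolding rep_def Cs_def by auto

lemma rep_carrier: "rep f F \<Longrightarrow> f \<in> carrier R"
  unfolding rep_def by auto

lemma rep_coeff: "F \<in> Cs \<Longrightarrow> rep (coef F) F"
  unfolding rep_def Cs_def by auto

lemma carrier_coeff_Sfn: "f \<in> carrier R \<Longrightarrow> coef (Sfn f) = f"
proof (rule coeff_Sfn)
  fix A :: "nat set" assume "f \<in> carrier R" "infinite A"
  then show "f A = (\<lambda>x. 0)" unfolding carrier_iff by (meson finite_lessThan finite_subset)
qed

lemma rep_Sfn: "f \<in> carrier R \<Longrightarrow> rep f (Sfn f)"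
  unfolding rep_def by (simp add: carrier_coeff_Sfn)

lemma rep_cong: "rep f F \<Longrightarrow> f = g \<Longrightarrow> F = G \<Longrightarrow> rep g G"
  by simp

lemma rep_eq_iff: "rep f F \<Longrightarrow> rep g G \<Longrightarrow> f = g \<longleftrightarrow> F = G"
  unfolding rep_def by (metis coef_inject)

lemma rep_homog: "rep f F \<Longrightarrow> f \<in> homog R p \<longleftrightarrow> F \<in> Hs p"
  unfolding rep_def Hs_def by auto

lemma R_simps:
  "mult R = (\<lambda>f g A x. \<Sum>B\<in>Pow A. shuffle_sign B (A - B) * f B x * g (A - B) x)"
  "one R = (\<lambda>A x. if A = {} \<and> x \<in> V then 1 else 0)"
  "zero R = (\<lambda>A x. 0)"
  "add R = (\<lambda>f g A x. f A x + g A x)"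
  "smult R = (\<lambda>r f A x. r * f A x)"
  unfolding sfun_alg_def Let_def by simp_all

lemma repI: "F \<in> Cs \<Longrightarrow> coef F = f \<Longrightarrow> rep f F"
  unfolding rep_def Cs_def by auto

lemma rep_zero: "rep \<zero>\<^bsub>R\<^esub> 0"
  by (rule repI[OF Cs_zero]) (simp add: R_simps coeff_simps fun_eq_iff)

lemma rep_add: "rep f F \<Longrightarrow> rep g G \<Longrightarrow> rep (f \<oplus>\<^bsub>R\<^esub> g) (F + G)"
  by (rule repI, rule Cs_add, erule rep_Cs, erule rep_Cs) (auto simp: rep_def R_simps coeff_simps fun_eq_iff)

lemma rep_mult: "rep f F \<Longrightarrow> rep g G \<Longrightarrow> rep (f \<otimes>\<^bsub>R\<^esub> g) (F * G)"
  by (rule repI, rule Cs_mult, erule rep_Cs, erule rep_Cs) (auto simp: rep_def R_simps coeff_mult fun_eq_iff)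

lemma rep_smult: "rep f F \<Longrightarrow> rep (r \<odot>\<^bsub>R\<^esub> f) (r *\<^sub>R F)"
  by (rule repI[OF Cs_scale[OF rep_Cs]]) (auto simp: rep_def R_simps coeff_simps fun_eq_iff)

lemma rep_sderiv: "a \<in> coords n m \<Longrightarrow> rep f F \<Longrightarrow> rep (sderiv V a f) (deriv_sfn V a F)"
  by (rule repI[OF deriv_Cs[OF _ rep_Cs]]) (auto simp: rep_def coeff_deriv_sfn)

text \<open>Sums and additive inverses of the record obey their laws only in an abelian group; the
  transfer of differences and finite sums rests on this.\<close>

lemma abelian_group_R: "abelian_group R"
proof (rule abelian_groupI)
  fix f assume f: "f \<in> carrier R"
  have "rep ((-1) \<odot>\<^bsub>R\<^esub> f) ((-1) *\<^sub>R Sfn f)" by (intro rep_smult rep_Sfn f)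
  then show "\<exists>g\<in>carrier R. g \<oplus>\<^bsub>R\<^esub> f = \<zero>\<^bsub>R\<^esub>"
    by (intro bexI[of _ "(-1) \<odot>\<^bsub>R\<^esub> f"]) (auto simp: rep_carrier R_simps)
qed (auto simp: R_simps add_ac intro: rep_carrier[OF rep_add[OF rep_Sfn rep_Sfn], unfolded R_simps]
    rep_carrier[OF rep_zero, unfolded R_simps])

lemma rep_uminus: "rep f F \<Longrightarrow> rep (\<ominus>\<^bsub>R\<^esub> f) (- F)"
proof -
  assume f: "rep f F"
  have r: "rep ((-1) \<odot>\<^bsub>R\<^esub> f) ((-1) *\<^sub>R F)" by (intro rep_smult f)
  have "\<ominus>\<^bsub>R\<^esub> f = (-1) \<odot>\<^bsub>R\<^esub> f"
    by (rule abelian_group.minus_equality[OF abelian_group_R _ rep_carrier[OF f] rep_carrier[OF r]])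
      (simp add: R_simps)
  then show ?thesis using r by simp
qed

lemma rep_minus: "rep f F \<Longrightarrow> rep g G \<Longrightarrow> rep (f \<ominus>\<^bsub>R\<^esub> g) (F - G)"
  unfolding a_minus_def diff_conv_add_uminus by (intro rep_add rep_uminus)

lemma rep_finsum:
  assumes "finite J" "\<And>j. j \<in> J \<Longrightarrow> rep (f j) (F j)"
  shows "rep (finsum R f J) (sum F J)"
proof -
  interpret abelian_group R by (rule abelian_group_R)
  show ?thesis
    using assms
  proof (induction J rule: finite_induct)
    case empty
    then show ?case by (simp add: rep_zero)
  next
    case (insert j J)
    then have "finsum R f (insert j J) = f j \<oplus>\<^bsub>R\<^esub> finsum R f J"
      by (intro finsum_insert) (auto intro: rep_carrier)
    then show ?case using insert by (simp add: rep_add)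
  qed
qed

lemma finite_coords: "finite (coords n m)"
  unfolding coords_def by simp

definition unit_sfn :: sfn where "unit_sfn = Sfn \<one>\<^bsub>R\<^esub>"
definition coord_sfn :: "coord_index \<Rightarrow> sfn" where "coord_sfn a = Sfn (coord_fun V a)"

lemma coeff_unit_sfn: "coef unit_sfn A x = (if A = {} \<and> x \<in> V then 1 else 0)"
  unfolding unit_sfn_def R_simps by (subst coeff_Sfn) auto

lemma coeff_coord_sfn:
  "coef (coord_sfn (Ev i)) A x = (if A = {} \<and> x \<in> V then x i else 0)"
  "coef (coord_sfn (Od j)) A x = (if A = {j} \<and> x \<in> V then 1 else 0)"
  unfolding coord_sfn_def by (subst coeff_Sfn; auto)+

lemma smooth_indicator: "smooth_fun n V (\<lambda>x. if P \<and> x \<in> V then 1 else 0)"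
  by (rule smooth_cong[OF smooth_const[of "if P then 1 else 0"]]) auto

lemma unit_sfn_H: "unit_sfn \<in> Hs 0"
  unfolding Hs_iff by (auto intro!: CsI simp: coeff_unit_sfn coeff_unit_sfn[abs_def] smooth_indicator split: if_splits)

lemma rep_one: "rep \<one>\<^bsub>R\<^esub> unit_sfn"
  by (rule repI[OF Hs_Cs[OF unit_sfn_H]]) (auto simp: coeff_unit_sfn R_simps fun_eq_iff)

lemma unit_sfn_mult:
  assumes "F \<in> Cs" shows "unit_sfn * F = F"
proof (rule sfn_eqI)
  fix A :: "nat set" and x assume "finite A"
  have "coef (unit_sfn * F) A x = (\<Sum>B\<in>Pow A. if B = {} then coef F A x else 0)"
    unfolding coeff_mult using Cs_D(2)[OF assms]
    by (intro sum.cong) (auto simp: coeff_unit_sfn)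
  then show "coef (unit_sfn * F) A x = coef F A x" using \<open>finite A\<close> by simp
qed

lemma coord_sfn_H:
  assumes "a \<in> coords n m" shows "coord_sfn a \<in> Hs (parity a)"
  using assms
proof (cases rule: coords_cases)
  case (1 i)
  have "smooth_fun n V (\<lambda>x. if A = {} \<and> x \<in> V then x i else 0)" for A :: "nat set"
    by (rule smooth_cong[OF smooth_scale[OF smooth_coord, of "if A = {} then 1 else 0" i]]) auto
  then show ?thesis
    unfolding 1 Hs_iff by (auto intro!: CsI simp: coeff_coord_sfn coeff_coord_sfn[abs_def] split: if_splits)
next
  case (2 j)
  then show ?thesis
    unfolding Hs_iff by (auto intro!: CsI simp: coeff_coord_sfn coeff_coord_sfn[abs_def] smooth_indicator split: if_splits)
qed

lemma rep_coord_fun: "a \<in> coords n m \<Longrightarrow> rep (coord_fun V a) (coord_sfn a)"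
  by (rule repI[OF Hs_Cs[OF coord_sfn_H]]) (cases a; auto simp: coeff_coord_sfn fun_eq_iff)+

lemma deriv_coord_sfn:
  assumes "a \<in> coords n m" "b \<in> coords n m"
  shows "deriv_sfn V a (coord_sfn b) = (if a = b then unit_sfn else 0)"
proof (rule sfn_eqI)
  fix A :: "nat set" and x assume A: "finite A"
  have *: "pd i (\<lambda>x. if P \<and> x \<in> V then x k else 0) x = (if P \<and> k = i \<and> x \<in> V then 1 else 0)"
    if "i < n" for i k P
  proof (rule pd_eqI)
    assume x: "x \<in> V"
    have "has_partial i (\<lambda>x. if P then x k else 0) x (if P \<and> k = i then 1 else 0)"
      unfolding has_partial_def by (cases "k = i"; cases P) auto
    then show "has_partial i (\<lambda>x. if P \<and> x \<in> V then x k else 0) x (if P \<and> k = i \<and> x \<in> V then 1 else 0)"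
      using x by (subst has_partial_cong[OF _ x that, of _ "\<lambda>x. if P then x k else 0"]) auto
  qed simp
  have **: "pd i (\<lambda>x. if P \<and> x \<in> V then 1 else 0) x = 0" if "i < n" for i P
  proof (rule pd_eqI)
    assume x: "x \<in> V"
    show "has_partial i (\<lambda>x. if P \<and> x \<in> V then 1 else 0) x 0"
      using x has_partial_const by (subst has_partial_cong[OF _ x that, of _ "\<lambda>x. if P then 1 else 0"]) auto
  qed simp
  show "coef (deriv_sfn V a (coord_sfn b)) A x = coef (if a = b then unit_sfn else 0) A x"
    using assms(1)
  proof (cases rule: coords_cases)
    case (1 i)
    then show ?thesis
      by (cases b) (auto simp: coeff_Ev coeff_coord_sfn[abs_def] * ** coeff_unit_sfn coeff_simps)
  next
    case (2 j)
    have "insert j A = {k} \<longleftrightarrow> j = k \<and> A = {}" if "j \<notin> A" for k using that by auto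
    then show ?thesis
      unfolding 2 by (cases b) (auto simp: coeff_Od coeff_coord_sfn coeff_unit_sfn coeff_simps)
  qed
qed

theorem superdomain_coords:
  assumes "\<And>a b. a \<in> coords n m \<Longrightarrow> b \<in> coords n m \<Longrightarrow> S a b \<in> Hs (parity a + parity b + 1)"
    and "\<And>a b. a \<in> coords n m \<Longrightarrow> b \<in> coords n m \<Longrightarrow> S a b = (-1) ^ (parity a * parity b) *\<^sub>R S b a"
    and "\<And>a. a \<in> coords n m \<Longrightarrow> T a \<in> Hs (parity a + 1)"
  shows "superdomain Hs Cs (coords n m) parity (deriv_sfn V) S T unit_sfn coord_sfn"
proof -
  interpret super_differential Hs Cs "coords n m" parity "deriv_sfn V"
    by (rule super_differential_deriv[of _ "\<lambda>a. a"]) (auto simp: finite_coords)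
  show ?thesis
    by unfold_locales (rule assms unit_sfn_H unit_sfn_mult coord_sfn_H deriv_coord_sfn; assumption)+
qed

end

section \<open>The cotangent bundle of a coordinate domain\<close>

context superdomain_alg
begin

abbreviation "W \<equiv> cotangent n V"

interpretation B: superdomain_alg "2 * n" W "2 * m"
  by (intro superdomain_alg.intro coordinate_domain_cotangent)

definition pull_sfn :: "sfn \<Rightarrow> sfn" where "pull_sfn F = Sfn (pull n V (coef F))"

lemma coeff_pull_sfn: "coef (pull_sfn F) A z = (if z \<in> W then coef F A (base_point n z) else 0)"
  unfolding pull_sfn_def by (subst coeff_Sfn) (auto simp: pull_def fun_eq_iff)

lemma pull_sfn_Cs: "F \<in> Cs \<Longrightarrow> pull_sfn F \<in> B.Cs"
proof (rule B.CsI)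
  assume F: "F \<in> Cs"
  show "coef (pull_sfn F) A z = 0" if "\<not> A \<subseteq> {..<2 * m}" for A z
  proof -
    have "\<not> A \<subseteq> {..<m}" using that by auto
    then show ?thesis using Cs_D(1)[OF F] by (simp add: coeff_pull_sfn)
  qed
  show "smooth_fun (2 * n) W (coef (pull_sfn F) A)" for A
    by (rule B.smooth_cong[OF smooth_pull[OF Cs_D(3)[OF F, of A]]]) (simp add: coeff_pull_sfn)
qed (simp add: coeff_pull_sfn)

lemma pull_sfn_Hs: "F \<in> Hs p \<Longrightarrow> pull_sfn F \<in> B.Hs p"
  unfolding B.Hs_iff using pull_sfn_Cs by (auto simp: Hs_iff coeff_pull_sfn)

lemma pull_sfn_zero: "pull_sfn 0 = 0" and pull_sfn_add: "pull_sfn (F + G) = pull_sfn F + pull_sfn G"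
  and pull_sfn_diff: "pull_sfn (F - G) = pull_sfn F - pull_sfn G" and pull_sfn_scale: "pull_sfn (r *\<^sub>R F) = r *\<^sub>R pull_sfn F"
  and pull_sfn_mult: "pull_sfn (F * G) = pull_sfn F * pull_sfn G"
  by (rule sfn_eqI; auto simp: coeff_pull_sfn coeff_simps coeff_mult)+

lemma base_point_in_V: "z \<in> W \<Longrightarrow> base_point n z \<in> V"
  by (simp add: cotangent_def)

lemma pull_sfn_unit_sfn: "pull_sfn unit_sfn = B.unit_sfn"
  by (rule sfn_eqI) (simp add: coeff_pull_sfn coeff_unit_sfn B.coeff_unit_sfn base_point_in_V)

lemma pull_sfn_sum: "pull_sfn (sum F J) = (\<Sum>j\<in>J. pull_sfn (F j))"
  by (induction J rule: infinite_finite_induct) (simp_all add: pull_sfn_zero pull_sfn_add)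

text \<open>Restriction to the zero section inverts the pull-back.\<close>

lemma pull_sfn_eq_zero:
  assumes "F \<in> Cs" "pull_sfn F = 0" shows "F = 0"
proof (rule sfn_eqI)
  fix A :: "nat set" and x
  show "coef F A x = coef 0 A x"
  proof (cases "x \<in> V")
    case True
    then have "coef (pull_sfn F) A x = coef F A x"
      using V_subset_cotangent base_point_V by (auto simp: coeff_pull_sfn)
    then show ?thesis using assms(2) by (simp add: coeff_simps)
  qed (use Cs_D(2)[OF assms(1)] in \<open>simp add: coeff_simps\<close>)
qed

text \<open>\<open>base_point\<close> ignores the even momenta and is the identity on the even
  positions. An odd momentum has an index at least \<open>m\<close>, and every coefficient of
  \<open>F\<close> at a set containing such an index is 0.\<close>

lemma pull_sfn_deriv:
  assumes a: "a \<in> coords n m" and F: "F \<in> Cs"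
  shows "deriv_sfn W a (pull_sfn F) = pull_sfn (deriv_sfn V a F)"
    and "deriv_sfn W (mom_index n m a) (pull_sfn F) = 0"
proof -
  have pull: "B.pd i (coef (pull_sfn F) A) z = (if i < n \<and> z \<in> W then pd i (coef F A) (base_point n z) else 0)"
    if i: "i < 2 * n" for i A z
  proof (rule B.pd_eqI)
    assume z: "z \<in> W"
    then have "base_point n z \<in> V" by (simp add: cotangent_def)
    with z show "has_partial i (coef (pull_sfn F) A) z
        (if i < n \<and> z \<in> W then pd i (coef F A) (base_point n z) else 0)"
      using has_partial_pull[OF z Cs_D(3)[OF F], of i A]
      by (subst B.has_partial_cong[OF _ z i, of _ "\<lambda>z. coef F A (base_point n z)"])
        (auto simp: coeff_pull_sfn pd_def)
  qed simp
  show "deriv_sfn W a (pull_sfn F) = pull_sfn (deriv_sfn V a F)"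
    using a
  proof (cases rule: coords_cases)
    case (1 i)
    then show ?thesis
      by (intro sfn_eqI) (simp add: coeff_pull_sfn coeff_Ev B.coeff_Ev pull)
  next
    case (2 j)
    then show ?thesis
      by (intro sfn_eqI) (simp add: coeff_pull_sfn coeff_Od B.coeff_Od)
  qed
  show "deriv_sfn W (mom_index n m a) (pull_sfn F) = 0"
    using a
  proof (cases rule: coords_cases)
    case (1 i)
    then show ?thesis
      by (intro sfn_eqI) (simp add: B.coeff_Ev pull coeff_simps)
  next
    case (2 j)
    have "coef F (insert (m + j) A) x = 0" for A x
      by (rule Cs_D(1)[OF F]) auto
    then show ?thesis
      unfolding 2 by (intro sfn_eqI) (simp add: coeff_pull_sfn B.coeff_Od coeff_simps)
  qed
qed

lemma coords_cotangent:
  assumes "a \<in> coords n m"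
  shows "a \<in> coords (2 * n) (2 * m)" "mom_index n m a \<in> coords (2 * n) (2 * m)"
    "parity (mom_index n m a) = parity a"
  using assms unfolding coords_def by auto

lemma mom_index_neq: "a \<in> coords n m \<Longrightarrow> a \<noteq> mom_index n m b"
  and mom_index_inj: "mom_index n m a = mom_index n m b \<longleftrightarrow> a = b"
  unfolding coords_def by (cases b; auto) (cases a; cases b; auto)

text \<open>\<open>S\<close> and \<open>T\<close> are the coefficients as elements of the type,
  \<open>s\<close> and \<open>t\<close> the same coefficients as plain families; \<open>rep\<close>
  ties them together.\<close>

context
  fixes S :: "coord_index \<Rightarrow> coord_index \<Rightarrow> sfn" and T :: "coord_index \<Rightarrow> sfn"
    and s :: "coord_index \<Rightarrow> coord_index \<Rightarrow> sfun" and t :: "coord_index \<Rightarrow> sfun"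
  assumes S_Hs: "\<And>a b. a \<in> coords n m \<Longrightarrow> b \<in> coords n m \<Longrightarrow> S a b \<in> Hs (parity a + parity b + 1)"
    and S_symm: "\<And>a b. a \<in> coords n m \<Longrightarrow> b \<in> coords n m \<Longrightarrow> S a b = (-1) ^ (parity a * parity b) *\<^sub>R S b a"
    and T_Hs: "\<And>a. a \<in> coords n m \<Longrightarrow> T a \<in> Hs (parity a + 1)"
    and s_rep: "\<And>a b. a \<in> coords n m \<Longrightarrow> b \<in> coords n m \<Longrightarrow> rep (s a b) (S a b)"
    and t_rep: "\<And>a. a \<in> coords n m \<Longrightarrow> rep (t a) (T a)"
begin

interpretation A: superdomain Hs Cs "coords n m" parity "deriv_sfn V" S T unit_sfn coord_sfn
  by (rule superdomain_coords) (fact S_Hs S_symm T_Hs)+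

interpretation BD: super_differential B.Hs B.Cs "coords n m" parity "deriv_sfn W"
  by (rule B.super_differential_deriv[of _ "\<lambda>a. a"]) (auto simp: finite_coords coords_cotangent)

interpretation BP: super_differential B.Hs B.Cs "coords n m" parity "\<lambda>a. deriv_sfn W (mom_index n m a)"
  by (rule B.super_differential_deriv) (auto simp: finite_coords coords_cotangent)

interpretation K: cotangent_superdomain B.Hs B.Cs "coords n m" parity "deriv_sfn W"
  "\<lambda>a b. pull_sfn (S a b)" "\<lambda>a. pull_sfn (T a)" B.unit_sfn "\<lambda>a. pull_sfn (coord_sfn a)"
  "\<lambda>a. deriv_sfn W (mom_index n m a)" "\<lambda>a. B.coord_sfn (mom_index n m a)"
proof
  fix a b assume ab: "a \<in> coords n m" "b \<in> coords n m"
  show "pull_sfn (S a b) \<in> B.Hs (parity a + parity b + 1)" by (intro pull_sfn_Hs S_Hs ab)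
  show "pull_sfn (S a b) = (-1) ^ (parity a * parity b) *\<^sub>R pull_sfn (S b a)"
    by (subst S_symm[OF ab]) (rule pull_sfn_scale)
  show "deriv_sfn W a (pull_sfn (coord_sfn b)) = (if a = b then B.unit_sfn else 0)"
    using ab by (simp add: pull_sfn_deriv Hs_Cs[OF coord_sfn_H] deriv_coord_sfn pull_sfn_unit_sfn pull_sfn_zero)
  show "deriv_sfn W (mom_index n m a) (deriv_sfn W b f) =
      (-1) ^ (parity a * parity b) *\<^sub>R deriv_sfn W b (deriv_sfn W (mom_index n m a) f)"
    if "f \<in> B.Cs" for f
    using B.deriv_comm[OF coords_cotangent(2)[OF ab(1)] coords_cotangent(1)[OF ab(2)] that]
    by (simp add: coords_cotangent(3)[OF ab(1)])
  show "deriv_sfn W (mom_index n m a) (B.coord_sfn (mom_index n m b)) = (if a = b then B.unit_sfn else 0)"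
    using ab by (simp add: B.deriv_coord_sfn coords_cotangent mom_index_inj)
  show "deriv_sfn W a (B.coord_sfn (mom_index n m b)) = 0"
    using ab by (simp add: B.deriv_coord_sfn coords_cotangent mom_index_neq)
  show "deriv_sfn W (mom_index n m a) (pull_sfn (coord_sfn b)) = 0"
    using ab by (simp add: pull_sfn_deriv Hs_Cs[OF coord_sfn_H])
  show "deriv_sfn W (mom_index n m c) (pull_sfn (S a b)) = 0" if "c \<in> coords n m" for c
    using that ab by (simp add: pull_sfn_deriv Hs_Cs[OF S_Hs])
next
  fix a assume a: "a \<in> coords n m"
  show "pull_sfn (T a) \<in> B.Hs (parity a + 1)" by (intro pull_sfn_Hs T_Hs a)
  show "pull_sfn (coord_sfn a) \<in> B.Hs (parity a)" by (intro pull_sfn_Hs coord_sfn_H a)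
  show "B.coord_sfn (mom_index n m a) \<in> B.Hs (parity a)"
    using B.coord_sfn_H[OF coords_cotangent(2)[OF a]] coords_cotangent(3)[OF a] by simp
  show "deriv_sfn W (mom_index n m c) (pull_sfn (T a)) = 0" if "c \<in> coords n m" for c
    using that a by (simp add: pull_sfn_deriv Hs_Cs[OF T_Hs])
qed (auto intro: B.unit_sfn_H B.unit_sfn_mult)

text \<open>The operator on the cotangent bundle acts on pulled-back functions as the operator in
  the chart. Hence Jacobiators and \<open>E\<close> of the coordinates, needed upstairs by the
  symbol calculus, are pull-backs of those in the chart.\<close>

lemma pull_sfn_L: "F \<in> Cs \<Longrightarrow> K.L (pull_sfn F) = pull_sfn (A.L F)"
  unfolding K.L_def A.L_def
  by (simp add: pull_sfn_add pull_sfn_scale pull_sfn_sum pull_sfn_mult pull_sfn_deriv deriv_Cs)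

lemma pull_sfn_br: "F \<in> Cs \<Longrightarrow> G \<in> Cs \<Longrightarrow> K.br p (pull_sfn F) (pull_sfn G) = pull_sfn (A.br p F G)"
  unfolding K.br_def A.br_def
  by (simp add: pull_sfn_diff pull_sfn_scale pull_sfn_mult pull_sfn_L Cs_mult flip: pull_sfn_mult)

lemma pull_sfn_E: "F \<in> Cs \<Longrightarrow> G \<in> Cs \<Longrightarrow> K.E (pull_sfn F) (pull_sfn G) = pull_sfn (A.E F G)"
  unfolding K.E_def A.E_def
  by (simp add: pull_sfn_diff pull_sfn_mult pull_sfn_L Cs_mult A.L_C flip: pull_sfn_mult)

lemma pull_sfn_jac: "F \<in> Cs \<Longrightarrow> G \<in> Cs \<Longrightarrow> H \<in> Cs \<Longrightarrow>
    K.jac p q r (pull_sfn F) (pull_sfn G) (pull_sfn H) = pull_sfn (A.jac p q r F G H)"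
  unfolding K.jac_def A.jac_def by (simp add: pull_sfn_add pull_sfn_scale pull_sfn_br A.br_C)

lemma pull_rep: "rep f F \<Longrightarrow> B.rep (pull n V f) (pull_sfn F)"
  by (rule B.repI[OF pull_sfn_Cs[OF rep_Cs]]) (auto simp: rep_def fun_eq_iff coeff_pull_sfn pull_def)

lemma mom_rep: "a \<in> coords n m \<Longrightarrow> B.rep (mom n m V a) (B.coord_sfn (mom_index n m a))"
  unfolding mom_def by (intro B.rep_coord_fun coords_cotangent)

lemma rep_poisson:
  "B.rep f F \<Longrightarrow> B.rep g G \<Longrightarrow> B.rep (poisson n m V 1 f g) (K.pois F G)"
  unfolding poisson_def K.pois_def Let_def cotangent_alg_def
  by (rule B.rep_minus; rule B.rep_finsum[OF finite_coords];
      rule B.rep_cong[OF B.rep_smult[OF B.rep_mult[OF B.rep_sderiv B.rep_sderiv]]])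
    (auto simp: coords_cotangent minus_one_power_iff)

lemma rep_principal_symbol:
  "B.rep (principal_symbol n m V s) K.symb"
  unfolding principal_symbol_def K.symb_def K.quad_def Let_def cotangent_alg_def
  by (intro B.rep_smult B.rep_finsum finite_coords B.rep_mult pull_rep mom_rep s_rep)

lemma rep_upper_connection_coeff:
  "a \<in> coords n m \<Longrightarrow> rep (upper_connection_coeff n m V s t a)
    ((\<Sum>b\<in>coords n m. deriv_sfn V b (S b a)) - 2 *\<^sub>R T a)"
  unfolding upper_connection_coeff_def Let_def
  by (intro rep_minus rep_smult rep_finsum finite_coords rep_sderiv s_rep t_rep)

lemma rep_upper_connection:
  "B.rep (upper_connection n m V s t) K.conn"
proof -
  have "K.conn = (\<Sum>a\<in>coords n m. pull_sfn ((\<Sum>b\<in>coords n m. deriv_sfn V b (S b a)) - 2 *\<^sub>R T a) * B.coord_sfn (mom_index n m a))"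
    unfolding K.conn_def K.lin_def
    by (intro sum.cong refl) (simp add: pull_sfn_diff pull_sfn_sum pull_sfn_scale pull_sfn_deriv Hs_Cs[OF S_Hs])
  then show ?thesis
    unfolding upper_connection_def Let_def cotangent_alg_def
    by (simp only:) (intro B.rep_finsum finite_coords B.rep_mult pull_rep mom_rep rep_upper_connection_coeff)
qed

theorem symbol_diff_eq_zero:
  assumes "\<And>a b c. a \<in> coords n m \<Longrightarrow> b \<in> coords n m \<Longrightarrow> c \<in> coords n m \<Longrightarrow>
    second_order.jac (coords n m) (deriv_sfn V) S T (parity a) (parity b) (parity c) (coord_sfn a) (coord_sfn b) (coord_sfn c) = 0"
  shows "symbol_diff n m V s
      (upper_connection n m V s t) = \<zero>\<^bsub>cotangent_alg n m V\<^esub> \<longleftrightarrow>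
    (\<forall>a\<in>coords n m. \<forall>b\<in>coords n m. second_order.E (coords n m) (deriv_sfn V) S T (coord_sfn a) (coord_sfn b) = 0)"
proof -
  have xC: "coord_sfn a \<in> Cs" if "a \<in> coords n m" for a using coord_sfn_H that by (blast intro: Hs_Cs)
  have "B.rep (symbol_diff n m V s
      (upper_connection n m V s t)) (K.pois K.symb K.conn)"
    unfolding symbol_diff_def by (intro rep_poisson rep_principal_symbol rep_upper_connection)
  then have "symbol_diff n m V s
      (upper_connection n m V s t) = \<zero>\<^bsub>cotangent_alg n m V\<^esub> \<longleftrightarrow>
      K.pois K.symb K.conn = 0"
    unfolding cotangent_alg_def by (rule B.rep_eq_iff[OF _ B.rep_zero])
  also have "\<dots> \<longleftrightarrow> (\<forall>a\<in>coords n m. \<forall>b\<in>coords n m. K.E (pull_sfn (coord_sfn a)) (pull_sfn (coord_sfn b)) = 0)"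
    by (rule K.pois_symb_conn_eq_zero) (simp add: pull_sfn_jac xC assms pull_sfn_zero)
  also have "\<dots> \<longleftrightarrow> (\<forall>a\<in>coords n m. \<forall>b\<in>coords n m. A.E (coord_sfn a) (coord_sfn b) = 0)"
    using pull_sfn_eq_zero[OF A.E_C] by (auto simp: pull_sfn_E xC pull_sfn_zero)
  finally show ?thesis .
qed

end

end

section \<open>Locality of the operators\<close>

text \<open>A substitute for restriction to a smaller domain: the operators keep their coefficients
  on \<open>V\<close>, and only their values over \<open>U\<close> are compared.\<close>

definition agree :: "(nat \<Rightarrow> real) set \<Rightarrow> sfn \<Rightarrow> sfn \<Rightarrow> bool" where
  "agree U F G \<longleftrightarrow> (\<forall>x\<in>U. \<forall>A. coef F A x = coef G A x)"

lemma agree_refl: "agree U F F"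
  unfolding agree_def by simp

lemma agree_subset: "agree U F G \<Longrightarrow> U' \<subseteq> U \<Longrightarrow> agree U' F G"
  unfolding agree_def by blast

lemma agree_add: "agree U F F' \<Longrightarrow> agree U G G' \<Longrightarrow> agree U (F + G) (F' + G')"
  and agree_diff: "agree U F F' \<Longrightarrow> agree U G G' \<Longrightarrow> agree U (F - G) (F' - G')"
  and agree_scale: "agree U F F' \<Longrightarrow> agree U (r *\<^sub>R F) (r *\<^sub>R F')"
  and agree_mult: "agree U F F' \<Longrightarrow> agree U G G' \<Longrightarrow> agree U (F * G) (F' * G')"
  unfolding agree_def by (simp_all add: coeff_simps coeff_mult)

lemma agree_sum: "(\<And>j. j \<in> J \<Longrightarrow> agree U (F j) (G j)) \<Longrightarrow> agree U (sum F J) (sum G J)"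
  by (induction J rule: infinite_finite_induct) (auto intro: agree_refl agree_add)

text \<open>An even derivative sees a neighbourhood, so \<open>U\<close> is taken open; an odd one
  acts pointwise on coefficients.\<close>

lemma agree_deriv:
  assumes U: "coordinate_domain n U" and a: "a \<in> coords n m" and FG: "agree U F G"
  shows "agree U (deriv_sfn V a F) (deriv_sfn V a G)"
proof (cases a)
  case (Ev i)
  then have "i < n" using a unfolding coords_def by auto
  then have "partial i (coef F A) x = partial i (coef G A) x" if "x \<in> U" for A x
    using FG that unfolding agree_def by (intro coordinate_domain.partial_cong[OF U]) auto
  then show ?thesis
    unfolding agree_def Ev coeff_deriv_sfn by simp
qed (use FG in \<open>simp add: agree_def coeff_deriv_sfn\<close>)

lemma coordinate_domain_Int:
  "coordinate_domain n U \<Longrightarrow> coordinate_domain n U' \<Longrightarrow> coordinate_domain n (U \<inter> U')"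
  unfolding coordinate_domain_def by (rule openin_Int)

section \<open>Functions on a chart\<close>

lemma superalg_hom_zero:
  assumes "h \<in> superalg_hom A (sfun_alg n m V)" "superalgebra A"
  shows "h \<zero>\<^bsub>A\<^esub> = (\<lambda>B x. 0)"
proof -
  have "ring A" using assms(2) unfolding superalgebra_def by simp
  then interpret ring A .
  have "h (\<zero>\<^bsub>A\<^esub> \<oplus>\<^bsub>A\<^esub> \<zero>\<^bsub>A\<^esub>) = h \<zero>\<^bsub>A\<^esub> \<oplus>\<^bsub>sfun_alg n m V\<^esub> h \<zero>\<^bsub>A\<^esub>"
    using assms(1) unfolding superalg_hom_def by (intro ring_hom_add) auto
  then have "h \<zero>\<^bsub>A\<^esub> = (\<lambda>B x. h \<zero>\<^bsub>A\<^esub> B x + h \<zero>\<^bsub>A\<^esub> B x)"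
    unfolding sfun_alg_def Let_def by simp
  then show ?thesis
    by (auto simp: fun_eq_iff)
qed

locale global_operator =
  fixes n m :: nat and M :: "('p, 'f) superspace" and \<Delta> :: "'f \<Rightarrow> 'f"
  assumes supermfd: "supermanifold n m M"
    and odd_op: "odd_operator (global_functions M) \<Delta>"
begin

abbreviation "G \<equiv> global_functions M"
abbreviation "Y \<equiv> topspace (topo M)"

lemma sheaf: "sheaf_of_superalgebras M" and hausdorff: "Hausdorff_space (topo M)"
  using supermfd unfolding supermanifold_def by auto

lemmas sheaf_conj = sheaf[unfolded sheaf_of_superalgebras_def]

lemmas superalgebra_sec = sheaf_conj[THEN conjunct1, rule_format]

lemma res_hom: "openin (topo M) U \<Longrightarrow> openin (topo M) W \<Longrightarrow> W \<subseteq> U \<Longrightarrow>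
    res M U W \<in> superalg_hom (sec M U) (sec M W)"
  by (rule sheaf_conj[THEN conjunct2, THEN conjunct1, rule_format]) (intro conjI)

lemma res_res: "openin (topo M) U \<Longrightarrow> openin (topo M) W \<Longrightarrow> openin (topo M) Z \<Longrightarrow> Z \<subseteq> W \<Longrightarrow> W \<subseteq> U \<Longrightarrow>
    f \<in> carrier (sec M U) \<Longrightarrow> res M W Z (res M U W f) = res M U Z f"
  by (rule sheaf_conj[THEN conjunct2, THEN conjunct2, THEN conjunct2, THEN conjunct1, rule_format])
    (intro conjI)

lemma glue:
  assumes "\<And>U. U \<in> \<U> \<Longrightarrow> openin (topo M) U" "\<And>U. U \<in> \<U> \<Longrightarrow> u U \<in> carrier (sec M U)"
    "\<And>U W. U \<in> \<U> \<Longrightarrow> W \<in> \<U> \<Longrightarrow> res M U (U \<inter> W) (u U) = res M W (U \<inter> W) (u W)" "\<Union>\<U> = Y"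
  shows "\<exists>!f. f \<in> carrier G \<and> (\<forall>U\<in>\<U>. res M Y U f = u U)"
proof -
  have "(\<forall>U\<in>\<U>. openin (topo M) U \<and> u U \<in> carrier (sec M U)) \<and>
      (\<forall>U\<in>\<U>. \<forall>W\<in>\<U>. res M U (U \<inter> W) (u U) = res M W (U \<inter> W) (u W))"
    by (intro conjI ballI assms)
  from sheaf_conj[THEN conjunct2, THEN conjunct2, THEN conjunct2, THEN conjunct2, rule_format, OF this]
  show ?thesis
    unfolding assms(4) global_functions_def .
qed

lemma ring_sec: "openin (topo M) U \<Longrightarrow> ring (sec M U)"
  by (drule superalgebra_sec) (simp only: superalgebra_def)

lemma sec_zero: "openin (topo M) U \<Longrightarrow> \<zero>\<^bsub>sec M U\<^esub> \<in> carrier (sec M U)"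
  by (rule ring.ring_simprules(2)[OF ring_sec])

lemma superalgebra_G: "superalgebra G"
  unfolding global_functions_def by (rule superalgebra_sec) simp

sublocale ring G
  using superalgebra_G unfolding superalgebra_def by (elim conjE)

lemma smult_closed [intro, simp]:
  assumes "f \<in> carrier G" shows "r \<odot>\<^bsub>G\<^esub> f \<in> carrier G"
proof -
  have "module (ring_of_type_algebra :: real ring) G"
    using superalgebra_G unfolding superalgebra_def by (elim conjE)
  from module.smult_closed[OF this _ assms, of r] show ?thesis
    by (simp add: ring_of_type_algebra_def)
qed

lemma homog_carrier:
  assumes "f \<in> homog G p" shows "f \<in> carrier G"
proof -
  have "submodule (even_part G) (ring_of_type_algebra :: real ring) G"
    using superalgebra_G unfolding superalgebra_def by (elim conjE)
  moreover have "submodule (odd_part G) (ring_of_type_algebra :: real ring) G"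
    using superalgebra_G unfolding superalgebra_def by (elim conjE)
  ultimately have "even_part G \<subseteq> carrier G" "odd_part G \<subseteq> carrier G"
    by (auto dest!: submodule.axioms(1) subgroup.subset)
  then show ?thesis
    using assms unfolding homog_def by (cases "even p") auto
qed

lemma carrier_split:
  assumes "f \<in> carrier G" shows "\<exists>u\<in>homog G 0. \<exists>v\<in>homog G 1. f = u \<oplus>\<^bsub>G\<^esub> v"
proof -
  have "\<forall>x\<in>carrier G. \<exists>u\<in>even_part G. \<exists>v\<in>odd_part G. x = u \<oplus>\<^bsub>G\<^esub> v"
    using superalgebra_G unfolding superalgebra_def by (elim conjE)
  then show ?thesis
    using assms by (simp add: homog_def)
qed

lemma \<Delta>_closed [intro, simp]: "f \<in> carrier G \<Longrightarrow> \<Delta> f \<in> carrier G"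
  using odd_op unfolding odd_operator_def by blast

definition theta :: "('p, 'f) chart \<Rightarrow> 'f \<Rightarrow> sfn" where
  "theta c f = Sfn (cfun c (cdom c) (res M Y (cdom c) f))"

text \<open>The chart domains cover the manifold, so this is the uniqueness half of the gluing axiom
  combined with injectivity of the chart isomorphisms.\<close>

lemma theta_inject:
  assumes f: "f \<in> carrier G" and g: "g \<in> carrier G"
    and eq: "\<And>c. is_chart n m M c \<Longrightarrow> theta c f = theta c g"
  shows "f = g"
proof -
  let ?\<U> = "cdom ` {c. is_chart n m M c}"
  let ?s = "\<lambda>U. res M Y U f"
  have op: "openin (topo M) U" if "U \<in> ?\<U>" for U
    using that unfolding is_chart_def by auto
  have "\<forall>x\<in>Y. \<exists>c. is_chart n m M c \<and> x \<in> cdom c"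
    using supermfd unfolding supermanifold_def by (elim conjE)
  then have "Y \<subseteq> \<Union>?\<U>" by auto
  moreover have "\<Union>?\<U> \<subseteq> Y"
    by (rule Union_least) (rule openin_subset, rule op)
  ultimately have cover: "\<Union>?\<U> = Y" by simp
  have res_f: "res M Y U h \<in> carrier (sec M U)" if U: "openin (topo M) U" and h: "h \<in> carrier G" for U h
  proof -
    have "res M Y U \<in> ring_hom (sec M Y) (sec M U)"
      using res_hom[OF openin_topspace U openin_subset[OF U]] unfolding superalg_hom_def by simp
    from ring_hom_closed[OF this] show ?thesis using h unfolding global_functions_def .
  qed
  have res_Int: "res M U (U \<inter> W) (?s U) = res M Y (U \<inter> W) f" "res M W (U \<inter> W) (?s W) = res M Y (U \<inter> W) f"
    if "U \<in> ?\<U>" "W \<in> ?\<U>" for U W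
    using f unfolding global_functions_def
    by (intro res_res openin_topspace openin_Int op that openin_subset[OF op]; simp)+
  have unique: "\<exists>!h. h \<in> carrier G \<and> (\<forall>U\<in>?\<U>. res M Y U h = ?s U)"
    by (rule glue) (simp_all only: op res_f f res_Int cover)
  have "res M Y (cdom c) g = res M Y (cdom c) f" if c: "is_chart n m M c" for c
  proof -
    have o: "openin (topo M) (cdom c)" using c unfolding is_chart_def by simp
    have bij: "bij_betw (cfun c (cdom c)) (carrier (sec M (cdom c))) (carrier (sfun_alg n m (cmap c ` cdom c)))"
      using c o unfolding is_chart_def by blast
    have V: "superdomain_alg n (cmap c ` cdom c)"
      using c unfolding is_chart_def superdomain_alg_def coordinate_domain_def crange_def by simp
    have "cfun c (cdom c) (res M Y (cdom c) h) \<in> carrier (sfun_alg n m (cmap c ` cdom c))"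
      if "h \<in> carrier G" for h
      using bij res_f[OF o that] bij_betwE by blast
    note car = this
    have "cfun c (cdom c) (res M Y (cdom c) g) = cfun c (cdom c) (res M Y (cdom c) f)"
      using arg_cong[OF eq[OF c], of coef]
      unfolding theta_def superdomain_alg.carrier_coeff_Sfn[OF V car[OF f]]
        superdomain_alg.carrier_coeff_Sfn[OF V car[OF g]] by simp
    then show ?thesis
      using bij res_f[OF o f] res_f[OF o g] unfolding bij_betw_def inj_on_def by blast
  qed
  then have "\<forall>U\<in>?\<U>. res M Y U g = ?s U" by auto
  then show ?thesis
    using unique f g by blast
qed

lemma bracket_closed: "f \<in> carrier G \<Longrightarrow> g \<in> carrier G \<Longrightarrow> bracket G \<Delta> p f g \<in> carrier G"
  unfolding bracket_def by simp

definition global_supercomm :: "nat \<Rightarrow> nat \<Rightarrow> ('f \<Rightarrow> 'f) \<Rightarrow> 'f \<Rightarrow> 'f \<Rightarrow> 'f" where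
  "global_supercomm s p Q f = (\<lambda>g. Q (f \<otimes>\<^bsub>G\<^esub> g) \<ominus>\<^bsub>G\<^esub> (-1) ^ (s * p) \<odot>\<^bsub>G\<^esub> (f \<otimes>\<^bsub>G\<^esub> Q g))"

lemma global_supercomm_closed: "(\<And>g. g \<in> carrier G \<Longrightarrow> Q g \<in> carrier G) \<Longrightarrow> f \<in> carrier G \<Longrightarrow> g \<in> carrier G \<Longrightarrow>
    global_supercomm s p Q f g \<in> carrier G"
  unfolding global_supercomm_def by simp

definition jacobiator :: "nat \<Rightarrow> nat \<Rightarrow> nat \<Rightarrow> 'f \<Rightarrow> 'f \<Rightarrow> 'f \<Rightarrow> 'f" where
  "jacobiator p q r f g h = bracket G \<Delta> (p + q + 1) (bracket G \<Delta> p f g) h \<oplus>\<^bsub>G\<^esub>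
        (-1) ^ (q * r) \<odot>\<^bsub>G\<^esub> bracket G \<Delta> (p + r + 1) (bracket G \<Delta> p f h) g \<oplus>\<^bsub>G\<^esub>
        (-1) ^ (p * (q + r)) \<odot>\<^bsub>G\<^esub> bracket G \<Delta> (q + r + 1) (bracket G \<Delta> q g h) f"

text \<open>Like the three definitions that follow, a statement on one chart about global functions,
  not about functions on the chart. With this choice the conjunction over all charts is the global
  identity by \<open>theta_inject\<close>; bump functions are called for only where coordinate
  functions have to be inserted.\<close>

definition jac_on where
  "jac_on c \<longleftrightarrow> (\<forall>p q r. \<forall>f\<in>homog G p. \<forall>g\<in>homog G q. \<forall>h\<in>homog G r. theta c (jacobiator p q r f g h) = 0)"

definition der_on where
  "der_on c \<longleftrightarrow> (\<forall>p q. \<forall>f\<in>homog G p. \<forall>g\<in>homog G q. theta c (\<Delta> (bracket G \<Delta> p f g)) =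
     theta c (\<ominus>\<^bsub>G\<^esub> bracket G \<Delta> (p + 1) (\<Delta> f) g \<ominus>\<^bsub>G\<^esub> (-1) ^ p \<odot>\<^bsub>G\<^esub> bracket G \<Delta> p f (\<Delta> g)))"

definition ord1_on where
  "ord1_on c \<longleftrightarrow> (\<forall>p. \<forall>f\<in>homog G p. \<forall>q. \<forall>g\<in>homog G q. \<forall>u\<in>carrier G.
     theta c (global_supercomm p q (global_supercomm 0 p (\<Delta> \<circ> \<Delta>) f) g u) = 0)"

definition ord2_on where
  "ord2_on c \<longleftrightarrow> (\<forall>p. \<forall>f\<in>homog G p. \<forall>q. \<forall>g\<in>homog G q. \<forall>r. \<forall>h\<in>homog G r. \<forall>u\<in>carrier G.
     theta c (global_supercomm (p + q) r (global_supercomm p q (global_supercomm 0 p (\<Delta> \<circ> \<Delta>) f) g) h u) = 0)"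

section \<open>Transfer of the operator and its brackets to one chart\<close>

context
  fixes c :: "('p, 'f) chart"
    and s :: "coord_index \<Rightarrow> coord_index \<Rightarrow> sfun" and t :: "coord_index \<Rightarrow> sfun"
  assumes chart: "is_chart n m M c" and expr: "coord_expression n m M \<Delta> c s t"
begin

abbreviation (input) "V \<equiv> crange c"
abbreviation (input) "J \<equiv> coords n m"

definition "S_sfn a b = Sfn (s a b)"
definition "T_sfn a = Sfn (t a)"

interpretation R: superdomain_alg n V m
  using chart unfolding is_chart_def superdomain_alg_def coordinate_domain_def by simp

lemma open_cdom: "openin (topo M) (cdom c)"
  using chart unfolding is_chart_def by simp

lemma cdom_subset: "cdom c \<subseteq> Y"
  using open_cdom by (rule openin_subset)

lemma cfun_hom: "openin (topo M) Z \<Longrightarrow> Z \<subseteq> cdom c \<Longrightarrow>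
    cfun c Z \<in> superalg_hom (sec M Z) (sfun_alg n m (cmap c ` Z))"
  and cfun_bij: "openin (topo M) Z \<Longrightarrow> Z \<subseteq> cdom c \<Longrightarrow>
    bij_betw (cfun c Z) (carrier (sec M Z)) (carrier (sfun_alg n m (cmap c ` Z)))"
  and cfun_res: "openin (topo M) Z \<Longrightarrow> Z \<subseteq> cdom c \<Longrightarrow> f \<in> carrier (sec M (cdom c)) \<Longrightarrow>
    cfun c Z (res M (cdom c) Z f) = sfun_restrict (cmap c ` Z) (cfun c (cdom c) f)"
  using chart open_cdom unfolding is_chart_def by blast+

lemma loc_rep:
  assumes f: "f \<in> carrier G"
  shows "R.rep (cfun c (cdom c) (res M Y (cdom c) f)) (theta c f)"
proof -
  have "res M Y (cdom c) f \<in> carrier (sec M (cdom c))"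
    using res_hom[OF _ open_cdom cdom_subset] f ring_hom_closed
    unfolding superalg_hom_def global_functions_def by fastforce
  then have "cfun c (cdom c) (res M Y (cdom c) f) \<in> carrier R.R"
    using cfun_bij[OF open_cdom] bij_betwE unfolding crange_def by blast
  then show ?thesis
    unfolding theta_def by (rule R.rep_Sfn)
qed

lemma loc_hom: "(\<lambda>f. cfun c (cdom c) (res M Y (cdom c) f)) \<in> superalg_hom G R.R"
proof -
  have h1: "res M Y (cdom c) \<in> superalg_hom G (sec M (cdom c))"
    unfolding global_functions_def by (intro res_hom open_cdom cdom_subset) simp
  have h2: "cfun c (cdom c) \<in> superalg_hom (sec M (cdom c)) R.R"
    using cfun_hom[OF open_cdom] unfolding crange_def by simp
  have "(cfun c (cdom c)) \<circ> (res M Y (cdom c)) \<in> ring_hom G R.R"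
    using h1 h2 unfolding superalg_hom_def by (intro ring_hom_trans) auto
  then show ?thesis
    using h1 h2 ring_hom_closed[of "res M Y (cdom c)" G "sec M (cdom c)"]
    unfolding superalg_hom_def by (auto simp: comp_def)
qed

lemma theta_Cs: "f \<in> carrier G \<Longrightarrow> theta c f \<in> R.Cs"
  by (rule R.rep_Cs[OF loc_rep])

lemma theta_eq: "f \<in> carrier G \<Longrightarrow> R.rep (cfun c (cdom c) (res M Y (cdom c) f)) F \<Longrightarrow> theta c f = F"
  using R.rep_eq_iff[OF loc_rep] by blast

lemma loc_ring_hom: "(\<lambda>f. cfun c (cdom c) (res M Y (cdom c) f)) \<in> ring_hom G R.R"
  and loc_smult: "f \<in> carrier G \<Longrightarrow> cfun c (cdom c) (res M Y (cdom c) (r \<odot>\<^bsub>G\<^esub> f)) =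
    r \<odot>\<^bsub>R.R\<^esub> cfun c (cdom c) (res M Y (cdom c) f)"
  and loc_homog: "f \<in> homog G p \<Longrightarrow> cfun c (cdom c) (res M Y (cdom c) f) \<in> homog R.R p"
  using loc_hom unfolding superalg_hom_def by auto

lemma theta_add: "f \<in> carrier G \<Longrightarrow> g \<in> carrier G \<Longrightarrow> theta c (f \<oplus>\<^bsub>G\<^esub> g) = theta c f + theta c g"
  by (intro theta_eq) (simp_all add: ring_hom_add[OF loc_ring_hom] R.rep_add loc_rep)

lemma theta_mult: "f \<in> carrier G \<Longrightarrow> g \<in> carrier G \<Longrightarrow> theta c (f \<otimes>\<^bsub>G\<^esub> g) = theta c f * theta c g"
  by (intro theta_eq) (simp_all add: ring_hom_mult[OF loc_ring_hom] R.rep_mult loc_rep)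

lemma theta_smult: "f \<in> carrier G \<Longrightarrow> theta c (r \<odot>\<^bsub>G\<^esub> f) = r *\<^sub>R theta c f"
  by (intro theta_eq) (simp_all add: loc_smult R.rep_smult loc_rep)

lemma theta_one: "theta c \<one>\<^bsub>G\<^esub> = R.unit_sfn"
  by (intro theta_eq) (simp_all add: ring_hom_one[OF loc_ring_hom] R.rep_one)

lemma theta_zero: "theta c \<zero>\<^bsub>G\<^esub> = 0"
  using theta_add[of "\<zero>\<^bsub>G\<^esub>" "\<zero>\<^bsub>G\<^esub>"] by simp

lemma theta_uminus: "f \<in> carrier G \<Longrightarrow> theta c (\<ominus>\<^bsub>G\<^esub> f) = - theta c f"
  using theta_add[of f "\<ominus>\<^bsub>G\<^esub> f"] by (simp add: r_neg theta_zero eq_neg_iff_add_eq_0 add.commute)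

lemma theta_minus: "f \<in> carrier G \<Longrightarrow> g \<in> carrier G \<Longrightarrow> theta c (f \<ominus>\<^bsub>G\<^esub> g) = theta c f - theta c g"
  unfolding a_minus_def by (simp add: theta_add theta_uminus)

lemma theta_Hs: "f \<in> homog G p \<Longrightarrow> theta c f \<in> R.Hs p"
  using loc_homog R.rep_homog[OF loc_rep[OF homog_carrier]] by blast

lemma expr_S: "a \<in> J \<Longrightarrow> b \<in> J \<Longrightarrow> s a b \<in> homog R.R (parity a + parity b + 1)"
  and expr_sym: "a \<in> J \<Longrightarrow> b \<in> J \<Longrightarrow> s a b = (-1) ^ (parity a * parity b) \<odot>\<^bsub>R.R\<^esub> s b a"
  and expr_T: "a \<in> J \<Longrightarrow> t a \<in> homog R.R (parity a + 1)"
  using expr unfolding coord_expression_def Let_def by blast+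

lemma s_rep: "a \<in> J \<Longrightarrow> b \<in> J \<Longrightarrow> R.rep (s a b) (S_sfn a b)"
  and t_rep: "a \<in> J \<Longrightarrow> R.rep (t a) (T_sfn a)"
  unfolding S_sfn_def T_sfn_def
  using expr_S expr_T R.homog_iff by (auto intro!: R.rep_Sfn)

lemma S_Hs: "a \<in> J \<Longrightarrow> b \<in> J \<Longrightarrow> S_sfn a b \<in> R.Hs (parity a + parity b + 1)"
  using R.rep_homog[OF s_rep] expr_S by blast

lemma T_Hs: "a \<in> J \<Longrightarrow> T_sfn a \<in> R.Hs (parity a + 1)"
  using R.rep_homog[OF t_rep] expr_T by blast

lemma S_symm: "a \<in> J \<Longrightarrow> b \<in> J \<Longrightarrow> S_sfn a b = (-1) ^ (parity a * parity b) *\<^sub>R S_sfn b a"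
  using R.rep_eq_iff[OF s_rep R.rep_smult[OF s_rep]] expr_sym by blast

interpretation A: superdomain R.Hs R.Cs J parity "deriv_sfn V" S_sfn T_sfn R.unit_sfn R.coord_sfn
  by (rule R.superdomain_coords) (fact S_Hs S_symm T_Hs)+

lemma theta_\<Delta>:
  assumes f: "f \<in> carrier G" shows "theta c (\<Delta> f) = A.L (theta c f)"
proof (rule theta_eq)
  have eq: "cfun c (cdom c) (res M Y (cdom c) (\<Delta> f)) =
      (1/2) \<odot>\<^bsub>R.R\<^esub> (\<Oplus>\<^bsub>R.R\<^esub>a\<in>J. \<Oplus>\<^bsub>R.R\<^esub>b\<in>J. s a b \<otimes>\<^bsub>R.R\<^esub>
          sderiv V b (sderiv V a (cfun c (cdom c) (res M Y (cdom c) f))))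
      \<oplus>\<^bsub>R.R\<^esub> (\<Oplus>\<^bsub>R.R\<^esub>a\<in>J. t a \<otimes>\<^bsub>R.R\<^esub> sderiv V a (cfun c (cdom c) (res M Y (cdom c) f)))"
    using expr f unfolding coord_expression_def Let_def by blast
  show "R.rep (cfun c (cdom c) (res M Y (cdom c) (\<Delta> f))) (A.L (theta c f))"
    unfolding eq A.L_def
    by (intro R.rep_add R.rep_smult R.rep_finsum R.finite_coords R.rep_mult R.rep_sderiv s_rep t_rep loc_rep f)
qed (use f in simp)

lemma theta_bracket:
  "f \<in> carrier G \<Longrightarrow> g \<in> carrier G \<Longrightarrow> theta c (bracket G \<Delta> p f g) = A.br p (theta c f) (theta c g)"
  unfolding bracket_def A.br_def by (simp add: theta_minus theta_mult theta_smult theta_\<Delta>)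

text \<open>
  Multiply by a bump function and extend by zero: its support is compact, hence closed in the
  Hausdorff space \<open>M\<close>.
\<close>

lemma theta_locally_onto:
  assumes F: "F \<in> R.Hs p" and x0: "x0 \<in> V"
  obtains f U where "f \<in> homog G p" "coordinate_domain n U" "x0 \<in> U" "U \<subseteq> V" "agree U (theta c f) F"
proof -
  obtain r where r: "r > 0" "\<And>y. (\<And>i. i \<ge> n \<Longrightarrow> y i = 0) \<Longrightarrow> (\<And>i. i < n \<Longrightarrow> \<bar>y i - x0 i\<bar> \<le> r) \<Longrightarrow> y \<in> V"
    using R.box[OF x0] by blast
  obtain \<phi> where \<phi>: "smooth_fun n V \<phi>" "\<And>y. (\<And>i. i < n \<Longrightarrow> \<bar>y i - x0 i\<bar> \<le> r / 2) \<Longrightarrow> \<phi> y = 1"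
    "\<And>y i. i < n \<Longrightarrow> \<bar>y i - x0 i\<bar> \<ge> r \<Longrightarrow> \<phi> y = 0"
    using R.bump[OF r(1), of x0] by blast
  \<comment> \<open>On \<open>V\<close> the bump function vanishes outside \<open>K\<close>, a
    product of closed intervals and single points, hence compact; on the open box \<open>U\<close>
    it is 1.\<close>
  define K where "K = {y. (\<forall>i\<ge>n. y i = 0) \<and> (\<forall>i<n. \<bar>y i - x0 i\<bar> \<le> r)}"
  define U where "U = {y. (\<forall>i\<ge>n. y i = 0) \<and> (\<forall>i<n. \<bar>y i - x0 i\<bar> < r / 2)}"
  have KV: "K \<subseteq> V" and UV: "U \<subseteq> V"
    unfolding K_def U_def using r by (auto intro!: r(2))
  have x0U: "x0 \<in> U" unfolding U_def using r(1) R.V_zero[OF x0] by auto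
  have U: "coordinate_domain n U"
  proof
    have "open (\<Inter>i<n. (\<lambda>y::nat \<Rightarrow> real. y i) -` ball (x0 i) (r / 2))"
      by (intro open_INT finite_lessThan ballI open_vimage open_ball continuous_on_product_coordinates)
    moreover have "U = {x. \<forall>i\<ge>n. x i = 0} \<inter> (\<Inter>i<n. (\<lambda>y::nat \<Rightarrow> real. y i) -` ball (x0 i) (r / 2))"
      unfolding U_def by (auto simp: dist_real_def abs_minus_commute)
    ultimately show "openin (Euclidean_space n) U"
      unfolding Euclidean_space_eq openin_open by blast
  qed
  have "compact K"
  proof -
    have "K = Pi\<^sub>E UNIV (\<lambda>i. if i < n then cball (x0 i) r else {0})"
      unfolding K_def by (auto simp: PiE_iff dist_real_def abs_minus_commute split: if_splits)
    then have "compactin (product_topology (\<lambda>i. euclidean) UNIV) K"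
      by (simp add: compactin_PiE)
    then show ?thesis by (simp add: euclidean_product_topology)
  qed
  define H where "H = Sfn (\<lambda>A x. \<phi> x * coef F A x)"
  have cH: "coef H A x = \<phi> x * coef F A x" for A x
    unfolding H_def by (subst coeff_Sfn) auto
  have FC: "F \<in> R.Cs" using F by (rule R.Hs_Cs)
  have "H \<in> R.Cs"
  proof (rule R.CsI)
    show "coef H A x = 0" if "\<not> A \<subseteq> {..<m}" for A x
      unfolding cH R.Cs_D(1)[OF FC that] by simp
    show "coef H A x = 0" if "x \<notin> V" for A x
      unfolding cH R.Cs_D(2)[OF FC that] by simp
    show "smooth_fun n V (coef H A)" for A
      unfolding cH[abs_def] by (intro R.smooth_mult \<phi>(1) R.Cs_D(3) FC)
  qed
  then have HH: "H \<in> R.Hs p"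
    using F unfolding R.Hs_iff by (simp add: cH)
  have "coef H \<in> carrier (sfun_alg n m (cmap c ` cdom c))"
    using R.rep_carrier[OF R.rep_coeff[OF R.Hs_Cs[OF HH]]] unfolding crange_def .
  then obtain h where h: "h \<in> carrier (sec M (cdom c))" "cfun c (cdom c) h = coef H"
    using bij_betw_imp_surj_on[OF cfun_bij[OF open_cdom order_refl]] by (metis imageE)
  define K' where "K' = {q \<in> cdom c. cmap c q \<in> K}"
  have "cmap c ` K' = K"
    using KV unfolding K'_def crange_def by blast
  have "compactin (subtopology (topo M) (cdom c)) K'"
  proof -
    have "homeomorphic_map (subtopology (topo M) (cdom c)) (subtopology (Euclidean_space n) V) (cmap c)"
      using chart unfolding is_chart_def by blast
    moreover have "compactin (subtopology (Euclidean_space n) V) K"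
      using \<open>compact K\<close> KV unfolding R.subtopology_V by (simp add: compactin_subtopology)
    ultimately show ?thesis
      using \<open>cmap c ` K' = K\<close> cdom_subset
      by (subst homeomorphic_map_compactness_eq) (auto simp: K'_def)
  qed
  then have "closedin (topo M) K'"
    using hausdorff by (intro compactin_imp_closedin) (simp_all add: compactin_subtopology)
  define N where "N = Y - K'"
  have N: "openin (topo M) N" "N \<subseteq> Y"
    unfolding N_def using \<open>closedin (topo M) K'\<close> by auto
  have vanish: "res M (cdom c) Z h = \<zero>\<^bsub>sec M Z\<^esub>" if Z: "openin (topo M) Z" "Z \<subseteq> cdom c" "Z \<subseteq> N" for Z
  proof -
    have "\<phi> (cmap c q) = 0" if "q \<in> Z" for q
    proof -
      have "cmap c q \<in> V" using that Z unfolding crange_def by blast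
      moreover have "cmap c q \<notin> K" using that Z unfolding N_def K'_def by blast
      ultimately show ?thesis
        unfolding K_def using R.V_zero by (force intro: \<phi>(3))
    qed
    then have "cfun c Z (res M (cdom c) Z h) = (\<lambda>A x. 0)"
      unfolding cfun_res[OF Z(1,2) h(1)] h(2) sfun_restrict_def by (auto simp: cH fun_eq_iff)
    also have "\<dots> = cfun c Z \<zero>\<^bsub>sec M Z\<^esub>"
      using superalg_hom_zero[OF cfun_hom[OF Z(1,2)] superalgebra_sec[OF Z(1)]] by simp
    finally have eq: "cfun c Z (res M (cdom c) Z h) = cfun c Z \<zero>\<^bsub>sec M Z\<^esub>" .
    have "res M (cdom c) Z h \<in> carrier (sec M Z)"
      using res_hom[OF open_cdom Z(1,2)] h(1) ring_hom_closed unfolding superalg_hom_def by fastforce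
    moreover have "\<zero>\<^bsub>sec M Z\<^esub> \<in> carrier (sec M Z)"
      by (rule sec_zero[OF Z(1)])
    ultimately show ?thesis
      using eq cfun_bij[OF Z(1,2)] unfolding bij_betw_def inj_on_def by blast
  qed
  have res_zero: "res M N Z \<zero>\<^bsub>sec M N\<^esub> = \<zero>\<^bsub>sec M Z\<^esub>" if "openin (topo M) Z" "Z \<subseteq> N" for Z
    using res_hom[OF N(1) that] ring_hom_zero[of "res M N Z" "sec M N" "sec M Z"]
      ring_sec[OF that(1)] ring_sec[OF N(1)]
    unfolding superalg_hom_def by blast
  \<comment> \<open>Data for gluing over two open sets: \<open>h\<close> on the chart domain and 0
    on \<open>N\<close>; \<open>vanish\<close> provides the compatibility on the overlap.\<close>
  define u where "u Z = (if Z = cdom c then h else \<zero>\<^bsub>sec M Z\<^esub>)" for Z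
  have "\<zero>\<^bsub>sec M N\<^esub> \<in> carrier (sec M N)"
    by (rule sec_zero[OF N(1)])
  moreover have "res M (cdom c) (cdom c \<inter> N) h = res M N (cdom c \<inter> N) \<zero>\<^bsub>sec M N\<^esub>"
    using vanish[of "cdom c \<inter> N"] res_zero[of "cdom c \<inter> N"] open_cdom N(1) by (simp add: openin_Int)
  moreover have "\<Union>{cdom c, N} = Y"
    using cdom_subset N(2) unfolding N_def K'_def by auto
  ultimately have "\<exists>!f. f \<in> carrier G \<and> (\<forall>Z\<in>{cdom c, N}. res M Y Z f = u Z)"
    using h(1) open_cdom N(1) by (intro glue) (auto simp: u_def Int_commute)
  then obtain f where f: "f \<in> carrier G" "res M Y (cdom c) f = h"
    by (auto simp: u_def)
  have tf: "theta c f = H"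
    by (rule theta_eq[OF f(1)]) (simp add: f(2) h(2) R.rep_coeff R.Hs_Cs[OF HH])
  \<comment> \<open>Gluing does not return a homogeneous function. Its component of parity
    \<open>p\<close> has the same image in the chart, because \<open>theta\<close> respects parity
    and \<open>H\<close> is homogeneous.\<close>
  obtain f0 f1 where f01: "f0 \<in> homog G 0" "f1 \<in> homog G 1" "f = f0 \<oplus>\<^bsub>G\<^esub> f1"
    using carrier_split[OF f(1)] by blast
  have "theta c f = theta c f0 + theta c f1"
    using f01 by (simp add: theta_add homog_carrier)
  then have sum: "coef H A x = coef (theta c f0) A x + coef (theta c f1) A x" for A x
    unfolding tf by (simp add: coeff_simps)
  have "\<exists>f'\<in>homog G p. theta c f' = H"
  proof (cases "even p")
    case True
    have "coef (theta c f0) A x = coef H A x" for A x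
      using theta_Hs[OF f01(1)] theta_Hs[OF f01(2)] HH True sum[of A x] unfolding R.Hs_iff
      by (cases "even (card A)") auto
    then have "theta c f0 = H" by (intro sfn_eqI)
    then show ?thesis using f01(1) True by (auto simp: homog_def)
  next
    case False
    have "coef (theta c f1) A x = coef H A x" for A x
      using theta_Hs[OF f01(1)] theta_Hs[OF f01(2)] HH False sum[of A x] unfolding R.Hs_iff
      by (cases "even (card A)") auto
    then have "theta c f1 = H" by (intro sfn_eqI)
    then show ?thesis using f01(2) False by (auto simp: homog_def)
  qed
  then obtain f' where "f' \<in> homog G p" "theta c f' = H" by blast
  moreover have "\<phi> y = 1" if "y \<in> U" for y
    using that unfolding U_def by (intro \<phi>(2)) (simp add: less_imp_le)
  then have "agree U H F"
    unfolding agree_def by (simp add: cH)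
  ultimately show thesis
    using that U x0U UV by blast
qed

lemma agree_L: "coordinate_domain n U \<Longrightarrow> agree U F F' \<Longrightarrow> agree U (A.L F) (A.L F')"
  unfolding A.L_def
  by (intro agree_add agree_scale agree_sum agree_mult agree_refl agree_deriv; assumption)

lemma agree_br: "coordinate_domain n U \<Longrightarrow> agree U F F' \<Longrightarrow> agree U H H' \<Longrightarrow>
    agree U (A.br p F H) (A.br p F' H')"
  unfolding A.br_def by (intro agree_diff agree_scale agree_mult agree_L)

lemma agree_E: "coordinate_domain n U \<Longrightarrow> agree U F F' \<Longrightarrow> agree U H H' \<Longrightarrow>
    agree U (A.E F H) (A.E F' H')"
  unfolding A.E_def by (intro agree_diff agree_mult agree_L)

lemma agree_jac: "coordinate_domain n U \<Longrightarrow> agree U F F' \<Longrightarrow> agree U H H' \<Longrightarrow> agree U K K' \<Longrightarrow>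
    agree U (A.jac p q r F H K) (A.jac p q r F' H' K')"
  unfolding A.jac_def by (intro agree_add agree_scale agree_br)

lemma eq_zeroI:
  assumes "F \<in> R.Cs" "\<And>x. x \<in> V \<Longrightarrow> \<exists>U. x \<in> U \<and> agree U 0 F"
  shows "F = 0"
proof (rule sfn_eqI)
  fix A :: "nat set" and x
  show "coef F A x = coef 0 A x"
    using assms(2)[of x] R.Cs_D(2)[OF assms(1), of x] unfolding agree_def
    by (cases "x \<in> V") (auto simp: coeff_simps)
qed

text \<open>Near each point a function on the chart agrees with the image of a global one of the
  same parity, and \<open>E\<close> is local.\<close>

lemma E_dense:
  assumes E: "\<And>p q f g. f \<in> homog G p \<Longrightarrow> g \<in> homog G q \<Longrightarrow> A.E (theta c f) (theta c g) = 0"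
    and F: "F \<in> R.Hs p" and H: "H \<in> R.Hs q"
  shows "A.E F H = 0"
proof (rule eq_zeroI)
  show "A.E F H \<in> R.Cs" by (intro A.E_C R.Hs_Cs[OF F] R.Hs_Cs[OF H])
  fix x assume x: "x \<in> V"
  obtain f U where f: "f \<in> homog G p" "coordinate_domain n U" "x \<in> U" "U \<subseteq> V" "agree U (theta c f) F"
    by (rule theta_locally_onto[OF F x])
  obtain g U' where g: "g \<in> homog G q" "coordinate_domain n U'" "x \<in> U'" "U' \<subseteq> V" "agree U' (theta c g) H"
    by (rule theta_locally_onto[OF H x])
  have "agree (U \<inter> U') (A.E (theta c f) (theta c g)) (A.E F H)"
    using f g by (intro agree_E coordinate_domain_Int) (auto intro: agree_subset)
  then show "\<exists>U. x \<in> U \<and> agree U 0 (A.E F H)"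
    using E[OF f(1) g(1)] f(3) g(3) by auto
qed

lemma jac_dense:
  assumes jac: "\<And>p q r f g h. f \<in> homog G p \<Longrightarrow> g \<in> homog G q \<Longrightarrow> h \<in> homog G r \<Longrightarrow>
      A.jac p q r (theta c f) (theta c g) (theta c h) = 0"
    and F: "F \<in> R.Hs p" and H: "H \<in> R.Hs q" and K: "K \<in> R.Hs r"
  shows "A.jac p q r F H K = 0"
proof (rule eq_zeroI)
  show "A.jac p q r F H K \<in> R.Cs"
    unfolding A.jac_def by (intro A.C_add A.C_scale A.br_C R.Hs_Cs[OF F] R.Hs_Cs[OF H] R.Hs_Cs[OF K])
  fix x assume x: "x \<in> V"
  obtain f U where f: "f \<in> homog G p" "coordinate_domain n U" "x \<in> U" "U \<subseteq> V" "agree U (theta c f) F"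
    by (rule theta_locally_onto[OF F x])
  obtain g U' where g: "g \<in> homog G q" "coordinate_domain n U'" "x \<in> U'" "U' \<subseteq> V" "agree U' (theta c g) H"
    by (rule theta_locally_onto[OF H x])
  obtain h U'' where h: "h \<in> homog G r" "coordinate_domain n U''" "x \<in> U''" "U'' \<subseteq> V" "agree U'' (theta c h) K"
    by (rule theta_locally_onto[OF K x])
  have "agree (U \<inter> U' \<inter> U'') (A.jac p q r (theta c f) (theta c g) (theta c h)) (A.jac p q r F H K)"
    using f g h by (intro agree_jac coordinate_domain_Int) (auto intro: agree_subset)
  then show "\<exists>U. x \<in> U \<and> agree U 0 (A.jac p q r F H K)"
    using jac[OF f(1) g(1) h(1)] f(3) g(3) h(3) by (intro exI[of _ "U \<inter> U' \<inter> U''"]) auto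
qed

lemmas theta_simps = theta_add theta_minus theta_mult theta_smult theta_uminus theta_\<Delta> theta_bracket
  bracket_closed

lemma theta_jacobiator:
  "f \<in> carrier G \<Longrightarrow> g \<in> carrier G \<Longrightarrow> h \<in> carrier G \<Longrightarrow>
    theta c (jacobiator p q r f g h) = A.jac p q r (theta c f) (theta c g) (theta c h)"
  unfolding jacobiator_def A.jac_def by (simp add: theta_simps)

lemma theta_global_supercomm:
  assumes "\<And>g. g \<in> carrier G \<Longrightarrow> Q g \<in> carrier G" "\<And>g. g \<in> carrier G \<Longrightarrow> theta c (Q g) = Q' (theta c g)"
    and "f \<in> carrier G" "g \<in> carrier G"
  shows "theta c (global_supercomm a p Q f g) = A.supercomm a p Q' (theta c f) (theta c g)"
  unfolding global_supercomm_def A.supercomm_def using assms by (simp add: theta_simps)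

lemma theta_global_supercomm2:
  assumes f: "f \<in> carrier G" and g: "g \<in> carrier G" and u: "u \<in> carrier G"
  shows "theta c (global_supercomm p q (global_supercomm 0 p (\<Delta> \<circ> \<Delta>) f) g u) =
    A.supercomm p q (A.supercomm 0 p (\<lambda>v. A.L (A.L v)) (theta c f)) (theta c g) (theta c u)"
proof (rule theta_global_supercomm[OF _ _ g u])
  show "theta c (global_supercomm 0 p (\<Delta> \<circ> \<Delta>) f v) = A.supercomm 0 p (\<lambda>v. A.L (A.L v)) (theta c f) (theta c v)"
    if "v \<in> carrier G" for v
    by (rule theta_global_supercomm[OF _ _ f that]) (auto simp: theta_simps)
qed (auto intro: global_supercomm_closed f)

lemma theta_global_supercomm3:
  assumes f: "f \<in> carrier G" and g: "g \<in> carrier G" and h: "h \<in> carrier G" and u: "u \<in> carrier G"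
  shows "theta c (global_supercomm (p + q) r (global_supercomm p q (global_supercomm 0 p (\<Delta> \<circ> \<Delta>) f) g) h u) =
    A.supercomm (p + q) r (A.supercomm p q (A.supercomm 0 p (\<lambda>v. A.L (A.L v)) (theta c f)) (theta c g)) (theta c h) (theta c u)"
proof (rule theta_global_supercomm[OF _ _ h u])
  show "theta c (global_supercomm p q (global_supercomm 0 p (\<Delta> \<circ> \<Delta>) f) g v) =
      A.supercomm p q (A.supercomm 0 p (\<lambda>v. A.L (A.L v)) (theta c f)) (theta c g) (theta c v)"
    if "v \<in> carrier G" for v
    by (rule theta_global_supercomm2[OF f g that])
qed (auto intro!: global_supercomm_closed f g)

lemma theta_homog_Cs: "f \<in> homog G p \<Longrightarrow> theta c f \<in> R.Cs"
  by (rule theta_Cs[OF homog_carrier])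

lemma jac_on_iff_triple:
  "jac_on c \<longleftrightarrow> (\<forall>p q. \<forall>f\<in>homog G p. \<forall>g\<in>homog G q. \<forall>u\<in>carrier G.
     A.triple p q (theta c f) (theta c g) (theta c u) = 0)" (is "_ \<longleftrightarrow> ?P")
proof
  assume J: "jac_on c"
  show ?P
  proof (intro allI ballI)
    fix p q f g u assume fg: "f \<in> homog G p" "g \<in> homog G q" and u: "u \<in> carrier G"
    have *: "A.triple p q (theta c f) (theta c g) (theta c h) = 0" if h: "h \<in> homog G r" for h r
      using J fg h unfolding jac_on_def
      by (simp add: theta_jacobiator homog_carrier flip: A.jac_eq_triple[OF theta_Hs[OF fg(1)]
            theta_Hs[OF fg(2)] theta_Hs[OF h]])
    obtain u0 u1 where "u0 \<in> homog G 0" "u1 \<in> homog G 1" "u = u0 \<oplus>\<^bsub>G\<^esub> u1"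
      using carrier_split[OF u] by blast
    then show "A.triple p q (theta c f) (theta c g) (theta c u) = 0"
      using * by (simp add: theta_simps homog_carrier A.triple_add theta_homog_Cs[OF fg(1)] theta_homog_Cs[OF fg(2)]
          theta_homog_Cs)
  qed
next
  assume P: ?P
  show "jac_on c"
    unfolding jac_on_def
  proof (intro allI ballI)
    fix p q r f g h assume fgh: "f \<in> homog G p" "g \<in> homog G q" "h \<in> homog G r"
    show "theta c (jacobiator p q r f g h) = 0"
      using P fgh by (simp add: theta_jacobiator homog_carrier A.jac_eq_triple[OF theta_Hs[OF fgh(1)]
            theta_Hs[OF fgh(2)] theta_Hs[OF fgh(3)]])
  qed
qed

text \<open>The third commutator is a combination of two values of \<open>triple\<close>, so it
  vanishes with the Jacobiator. At the unit one of the two is 0 by \<open>triple_e\<close>, and the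
  other is the Jacobiator itself.\<close>

lemma jac_on_iff_ord2_on: "jac_on c \<longleftrightarrow> ord2_on c"
proof
  assume "jac_on c"
  then have P: "A.triple p q (theta c f) (theta c g) (theta c u) = 0"
    if "f \<in> homog G p" "g \<in> homog G q" "u \<in> carrier G" for p q f g u
    using that unfolding jac_on_iff_triple by blast
  show "ord2_on c"
    unfolding ord2_on_def
  proof (intro allI ballI)
    fix p q r f g h u assume f: "f \<in> homog G p" and g: "g \<in> homog G q" and h: "h \<in> homog G r"
      and u: "u \<in> carrier G"
    have hu: "theta c h * theta c u = theta c (h \<otimes>\<^bsub>G\<^esub> u)"
      using h u by (simp add: theta_simps homog_carrier)
    show "theta c (global_supercomm (p + q) r (global_supercomm p q (global_supercomm 0 p (\<Delta> \<circ> \<Delta>) f) g) h u) = 0"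
      unfolding theta_global_supercomm3[OF homog_carrier[OF f] homog_carrier[OF g] homog_carrier[OF h] u]
        A.supercomm_supercomm_supercomm_eq[OF theta_Hs[OF f] theta_Hs[OF g] theta_Hs[OF h]
          theta_Cs[OF u]] hu
      using P[OF f g] u h by (simp add: homog_carrier)
  qed
next
  assume O: "ord2_on c"
  show "jac_on c"
    unfolding jac_on_def
  proof (intro allI ballI)
    fix p q r f g h assume f: "f \<in> homog G p" and g: "g \<in> homog G q" and h: "h \<in> homog G r"
    note H = theta_Hs[OF f] theta_Hs[OF g] theta_Hs[OF h]
    have "theta c (global_supercomm (p + q) r (global_supercomm p q (global_supercomm 0 p (\<Delta> \<circ> \<Delta>) f) g) h \<one>\<^bsub>G\<^esub>) = 0"
      using O f g h unfolding ord2_on_def by blast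
    then have "A.triple p q (theta c f) (theta c g) (theta c h) = 0"
      unfolding theta_global_supercomm3[OF homog_carrier[OF f] homog_carrier[OF g] homog_carrier[OF h] one_closed]
        theta_one A.supercomm_supercomm_supercomm_eq[OF H A.e_C]
      by (simp add: A.mult_e A.triple_e R.Hs_Cs[OF H(1)] R.Hs_Cs[OF H(2)] R.Hs_Cs[OF H(3)])
    then show "theta c (jacobiator p q r f g h) = 0"
      using f g h by (simp add: theta_jacobiator homog_carrier A.jac_eq_triple[OF H])
  qed
qed

lemma der_on_iff_E:
  "der_on c \<longleftrightarrow> (\<forall>p q. \<forall>f\<in>homog G p. \<forall>g\<in>homog G q. A.E (theta c f) (theta c g) = 0)"
proof -
  have "theta c (\<Delta> (bracket G \<Delta> p f g)) =
     theta c (\<ominus>\<^bsub>G\<^esub> bracket G \<Delta> (p + 1) (\<Delta> f) g \<ominus>\<^bsub>G\<^esub> (-1) ^ p \<odot>\<^bsub>G\<^esub> bracket G \<Delta> p f (\<Delta> g)) \<longleftrightarrow>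
     A.E (theta c f) (theta c g) = 0" if "f \<in> homog G p" "g \<in> homog G q" for p q f g
    using that by (simp add: theta_simps homog_carrier A.E_eq[of _ _ p] theta_homog_Cs[OF that(1)] theta_homog_Cs[OF that(2)]
        eq_neg_iff_add_eq_0 eq_diff_eq add_ac)
  then show ?thesis
    unfolding der_on_def by blast
qed

text \<open>If \<open>E\<close> vanishes, so does \<open>triple\<close>, and with it the double
  commutator; conversely the double commutator at the unit is \<open>E f g\<close>.\<close>

lemma der_on_iff_ord1_on: "der_on c \<longleftrightarrow> ord1_on c"
  unfolding der_on_iff_E
proof
  assume E: "\<forall>p q. \<forall>f\<in>homog G p. \<forall>g\<in>homog G q. A.E (theta c f) (theta c g) = 0"
  have E': "A.E (theta c f) (theta c u) = 0" if f: "f \<in> homog G p" and u: "u \<in> carrier G" for p f u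
  proof -
    obtain u0 u1 where "u0 \<in> homog G 0" "u1 \<in> homog G 1" "u = u0 \<oplus>\<^bsub>G\<^esub> u1"
      using carrier_split[OF u] by blast
    then show ?thesis
      using E f by (simp add: theta_simps homog_carrier A.E_add theta_homog_Cs[OF f] theta_homog_Cs)
  qed
  show "ord1_on c"
    unfolding ord1_on_def
  proof (intro allI ballI)
    fix p q f g u assume f: "f \<in> homog G p" and g: "g \<in> homog G q" and u: "u \<in> carrier G"
    have gu: "theta c g * theta c u = theta c (g \<otimes>\<^bsub>G\<^esub> u)"
      using g u by (simp add: theta_simps homog_carrier)
    show "theta c (global_supercomm p q (global_supercomm 0 p (\<Delta> \<circ> \<Delta>) f) g u) = 0"
      unfolding theta_global_supercomm2[OF homog_carrier[OF f] homog_carrier[OF g] u]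
        A.supercomm_supercomm_eq[OF theta_Hs[OF f] theta_Hs[OF g] theta_Cs[OF u]]
        A.triple_def gu
      using E'[OF f] g u by (simp add: homog_carrier)
  qed
next
  assume O: "ord1_on c"
  show "\<forall>p q. \<forall>f\<in>homog G p. \<forall>g\<in>homog G q. A.E (theta c f) (theta c g) = 0"
  proof (intro allI ballI)
    fix p q f g assume f: "f \<in> homog G p" and g: "g \<in> homog G q"
    note H = theta_Hs[OF f] theta_Hs[OF g]
    have "theta c (global_supercomm p q (global_supercomm 0 p (\<Delta> \<circ> \<Delta>) f) g \<one>\<^bsub>G\<^esub>) = 0"
      using O f g unfolding ord1_on_def by blast
    then show "A.E (theta c f) (theta c g) = 0"
      unfolding theta_global_supercomm2[OF homog_carrier[OF f] homog_carrier[OF g] one_closed]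
        theta_one A.supercomm_supercomm_eq[OF H A.e_C]
      by (simp add: A.mult_e A.triple_e A.E_C R.Hs_Cs[OF H(1)] R.Hs_Cs[OF H(2)])
  qed
qed

text \<open>Chart coordinates are in general not restrictions of global functions;
  \<open>jac_dense\<close> and \<open>E_dense\<close> lead from global functions to them. In the
  other direction \<open>E_eq_zero\<close> passes from coordinates to all functions, and the Jacobi
  identity supplies its condition on \<open>triple\<close>.\<close>

lemma der_on_iff_symbol_diff:
  assumes J: "jac_on c"
  shows "der_on c \<longleftrightarrow> symbol_diff n m V s (upper_connection n m V s t) = \<zero>\<^bsub>cotangent_alg n m V\<^esub>"
proof -
  have jac: "A.jac p q r F H K = 0" if "F \<in> R.Hs p" "H \<in> R.Hs q" "K \<in> R.Hs r" for p q r F H K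
  proof (rule jac_dense[OF _ that])
    fix p q r f g h assume fgh: "f \<in> homog G p" "g \<in> homog G q" "h \<in> homog G r"
    then have "theta c (jacobiator p q r f g h) = 0"
      using J unfolding jac_on_def by blast
    then show "A.jac p q r (theta c f) (theta c g) (theta c h) = 0"
      using fgh by (simp add: theta_jacobiator homog_carrier)
  qed
  have "symbol_diff n m V s (upper_connection n m V s t) = \<zero>\<^bsub>cotangent_alg n m V\<^esub> \<longleftrightarrow>
      (\<forall>a\<in>J. \<forall>b\<in>J. A.E (R.coord_sfn a) (R.coord_sfn b) = 0)"
    by (rule R.symbol_diff_eq_zero)
      (fact S_Hs S_symm T_Hs s_rep
        t_rep jac[OF R.coord_sfn_H R.coord_sfn_H R.coord_sfn_H])+
  also have "\<dots> \<longleftrightarrow> der_on c"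
    unfolding der_on_iff_E
  proof
    assume E: "\<forall>p q. \<forall>f\<in>homog G p. \<forall>g\<in>homog G q. A.E (theta c f) (theta c g) = 0"
    show "\<forall>a\<in>J. \<forall>b\<in>J. A.E (R.coord_sfn a) (R.coord_sfn b) = 0"
      using E by (intro ballI E_dense[OF _ R.coord_sfn_H R.coord_sfn_H]) auto
  next
    assume E: "\<forall>a\<in>J. \<forall>b\<in>J. A.E (R.coord_sfn a) (R.coord_sfn b) = 0"
    show "\<forall>p q. \<forall>f\<in>homog G p. \<forall>g\<in>homog G q. A.E (theta c f) (theta c g) = 0"
    proof (intro allI ballI)
      fix p q f g assume f: "f \<in> homog G p" and g: "g \<in> homog G q"
      show "A.E (theta c f) (theta c g) = 0"
      proof (rule A.E_eq_zero[OF _ _ theta_Hs[OF f] theta_homog_Cs[OF g]])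
        show "A.E (R.coord_sfn a) (R.coord_sfn b) = 0" if "a \<in> J" "b \<in> J" for a b
          using E that by blast
        show "A.triple (parity a) (parity b) (R.coord_sfn a) (R.coord_sfn b) H = 0"
          if "a \<in> J" "b \<in> J" "H \<in> R.Hs r" for a b r H
          using jac[OF R.coord_sfn_H[OF that(1)] R.coord_sfn_H[OF that(2)] that(3)]
            A.jac_eq_triple[OF R.coord_sfn_H[OF that(1)] R.coord_sfn_H[OF that(2)] that(3)] by simp
      qed
    qed
  qed
  finally show ?thesis by blast
qed

end

section \<open>From all charts to the manifold\<close>

context
  fixes S :: "('p, 'f) chart \<Rightarrow> coord_index \<Rightarrow> coord_index \<Rightarrow> sfun"
    and T :: "('p, 'f) chart \<Rightarrow> coord_index \<Rightarrow> sfun"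
  assumes expr: "\<And>c. is_chart n m M c \<Longrightarrow> coord_expression n m M \<Delta> c (S c) (T c)"
begin

lemma zero_iff: "f \<in> carrier G \<Longrightarrow> f = \<zero>\<^bsub>G\<^esub> \<longleftrightarrow> (\<forall>c. is_chart n m M c \<longrightarrow> theta c f = 0)"
  using theta_inject[of f "\<zero>\<^bsub>G\<^esub>"] theta_zero expr by (metis zero_closed)

lemma jacobi_iff: "jacobi_identity G \<Delta> \<longleftrightarrow> (\<forall>c. is_chart n m M c \<longrightarrow> jac_on c)"
proof -
  have "jacobiator p q r f g h = \<zero>\<^bsub>G\<^esub> \<longleftrightarrow> (\<forall>c. is_chart n m M c \<longrightarrow> theta c (jacobiator p q r f g h) = 0)"
    if "f \<in> homog G p" "g \<in> homog G q" "h \<in> homog G r" for p q r f g h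
    using that by (intro zero_iff) (simp add: jacobiator_def bracket_closed homog_carrier)
  then show ?thesis
    unfolding jacobi_identity_def jac_on_def jacobiator_def[symmetric] by blast
qed

lemma derivation_iff: "derivation_of_bracket G \<Delta> \<longleftrightarrow> (\<forall>c. is_chart n m M c \<longrightarrow> der_on c)"
proof -
  have "\<Delta> (bracket G \<Delta> p f g) =
      \<ominus>\<^bsub>G\<^esub> bracket G \<Delta> (p + 1) (\<Delta> f) g \<ominus>\<^bsub>G\<^esub> (-1) ^ p \<odot>\<^bsub>G\<^esub> bracket G \<Delta> p f (\<Delta> g) \<longleftrightarrow>
    (\<forall>c. is_chart n m M c \<longrightarrow> theta c (\<Delta> (bracket G \<Delta> p f g)) =
     theta c (\<ominus>\<^bsub>G\<^esub> bracket G \<Delta> (p + 1) (\<Delta> f) g \<ominus>\<^bsub>G\<^esub> (-1) ^ p \<odot>\<^bsub>G\<^esub> bracket G \<Delta> p f (\<Delta> g)))"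
    (is "?l = ?r \<longleftrightarrow> ?P") if "f \<in> homog G p" "g \<in> homog G q" for p q f g
  proof
    assume ?P
    then show "?l = ?r"
      using that by (intro theta_inject) (simp_all add: bracket_closed homog_carrier)
  qed simp
  then show ?thesis
    unfolding derivation_of_bracket_def der_on_def by blast
qed

lemma global_supercomm_zero_iff:
  assumes "\<And>g. g \<in> carrier G \<Longrightarrow> Q g \<in> carrier G" "f \<in> carrier G" "u \<in> carrier G"
  shows "global_supercomm a p Q f u = \<zero>\<^bsub>G\<^esub> \<longleftrightarrow> (\<forall>c. is_chart n m M c \<longrightarrow> theta c (global_supercomm a p Q f u) = 0)"
  by (intro zero_iff global_supercomm_closed assms)

lemma order_le_1_iff: "order_le G 1 0 (\<Delta> \<circ> \<Delta>) \<longleftrightarrow> (\<forall>c. is_chart n m M c \<longrightarrow> ord1_on c)"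
proof -
  have "order_le G 1 0 (\<Delta> \<circ> \<Delta>) \<longleftrightarrow> (\<forall>p. \<forall>f\<in>homog G p. \<forall>q. \<forall>g\<in>homog G q. \<forall>u\<in>carrier G.
     global_supercomm p q (global_supercomm 0 p (\<Delta> \<circ> \<Delta>) f) g u = \<zero>\<^bsub>G\<^esub>)"
    unfolding order_le_def One_nat_def order_less.simps add_0 global_supercomm_def ..
  also have "\<dots> \<longleftrightarrow> (\<forall>p. \<forall>f\<in>homog G p. \<forall>q. \<forall>g\<in>homog G q. \<forall>u\<in>carrier G.
     \<forall>c. is_chart n m M c \<longrightarrow> theta c (global_supercomm p q (global_supercomm 0 p (\<Delta> \<circ> \<Delta>) f) g u) = 0)"
    by (intro all_cong1 ball_cong refl global_supercomm_zero_iff) (auto intro: global_supercomm_closed homog_carrier)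
  finally show ?thesis
    unfolding ord1_on_def by blast
qed

lemma order_le_2_iff: "order_le G 2 0 (\<Delta> \<circ> \<Delta>) \<longleftrightarrow> (\<forall>c. is_chart n m M c \<longrightarrow> ord2_on c)"
proof -
  have "order_le G 2 0 (\<Delta> \<circ> \<Delta>) \<longleftrightarrow> (\<forall>p. \<forall>f\<in>homog G p. \<forall>q. \<forall>g\<in>homog G q. \<forall>r. \<forall>h\<in>homog G r. \<forall>u\<in>carrier G.
     global_supercomm (p + q) r (global_supercomm p q (global_supercomm 0 p (\<Delta> \<circ> \<Delta>) f) g) h u = \<zero>\<^bsub>G\<^esub>)"
    unfolding order_le_def numeral_2_eq_2 order_less.simps add_0 global_supercomm_def ..
  also have "\<dots> \<longleftrightarrow> (\<forall>p. \<forall>f\<in>homog G p. \<forall>q. \<forall>g\<in>homog G q. \<forall>r. \<forall>h\<in>homog G r. \<forall>u\<in>carrier G.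
     \<forall>c. is_chart n m M c \<longrightarrow> theta c (global_supercomm (p + q) r (global_supercomm p q (global_supercomm 0 p (\<Delta> \<circ> \<Delta>) f) g) h u) = 0)"
    by (intro all_cong1 ball_cong refl global_supercomm_zero_iff) (auto intro!: global_supercomm_closed intro: homog_carrier)
  finally show ?thesis
    unfolding ord2_on_def by blast
qed

theorem derivation_iff_flat:
  "(jacobi_identity G \<Delta> \<longleftrightarrow> order_le G 2 0 (\<Delta> \<circ> \<Delta>)) \<and>
    (jacobi_identity G \<Delta> \<longrightarrow>
      (derivation_of_bracket G \<Delta> \<longleftrightarrow>
        (\<forall>c. is_chart n m M c \<longrightarrow>
           symbol_diff n m (crange c) (S c) (upper_connection n m (crange c) (S c) (T c))
             = \<zero>\<^bsub>cotangent_alg n m (crange c)\<^esub>)) \<and>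
      (derivation_of_bracket G \<Delta> \<longleftrightarrow> order_le G 1 0 (\<Delta> \<circ> \<Delta>)))"
  using jac_on_iff_ord2_on[OF _ expr] der_on_iff_ord1_on[OF _ expr] der_on_iff_symbol_diff[OF _ expr]
  unfolding jacobi_iff derivation_iff order_le_1_iff order_le_2_iff by meson

end

end

theorem theorem2:
  fixes M :: "('p, 'f) superspace" and n m :: nat
    and \<Delta> :: "'f \<Rightarrow> 'f"
    and S :: "('p, 'f) chart \<Rightarrow> coord_index \<Rightarrow> coord_index \<Rightarrow> sfun"
    and T :: "('p, 'f) chart \<Rightarrow> coord_index \<Rightarrow> sfun"
  assumes "supermanifold n m M"
    and "odd_operator (global_functions M) \<Delta>"
    and "\<Delta> \<one>\<^bsub>global_functions M\<^esub> = \<zero>\<^bsub>global_functions M\<^esub>"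
    and "\<And>c. is_chart n m M c \<Longrightarrow> coord_expression n m M \<Delta> c (S c) (T c)"
  shows "(jacobi_identity (global_functions M) \<Delta> \<longleftrightarrow> order_le (global_functions M) 2 0 (\<Delta> \<circ> \<Delta>)) \<and>
    (jacobi_identity (global_functions M) \<Delta> \<longrightarrow>
      (derivation_of_bracket (global_functions M) \<Delta> \<longleftrightarrow>
        (\<forall>c. is_chart n m M c \<longrightarrow>
           symbol_diff n m (crange c) (S c) (upper_connection n m (crange c) (S c) (T c))
             = \<zero>\<^bsub>cotangent_alg n m (crange c)\<^esub>)) \<and>
      (derivation_of_bracket (global_functions M) \<Delta> \<longleftrightarrow> order_le (global_functions M) 1 0 (\<Delta> \<circ> \<Delta>)))"
  by (rule global_operator.derivation_iff_flat[OF global_operator.intro, OF assms(1,2)]) (rule assms(4))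

end
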